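(* Let $G$ be a complex reductive algebraic group and let $m\in\{0,1,2,\dots,\infty\}$ be fixed. (1) Let $X$ be an affine $G$-variety and suppose that $X=\bigcup_\alpha X_\alpha$ where the $X_\alpha$ are affine, Zariski open and $G$-saturated in $X$. Then $X$ is $m$-very good (resp. $m$-good, resp. $D$-finite) if and only if each $X_\alpha$ is $m$-very good (resp. $m$-good, resp. $D$-finite). (2) Let $W$ be a $G$-module and let $U=W_f=\{w\in W: f(w)\neq 0\}$ where $f\in\mathcal{O}(W)^G$ and $f(0)\neq 0$. Then $W$ is $m$-very good (resp. $m$-good, resp. $D$-finite) if and only if $U$ is $m$-very good (resp. $m$-good, resp. $D$-finite).
   Context: Everything is over $\mathbb{C}$; a $G$-module is a finite-dimensional rational representation. For a scheme $X$ of finite type and an integer $m\ge 0$, the jet scheme $X_m$ is characterized by functorial bijections $\mathrm{Hom}(\mathrm{Spec}\,A,X_m)\cong\mathrm{Hom}(\mathrm{Spec}\,A[t]/\langle t^{m+1}\rangle,X)$ for $\mathbb{C}$-algebras $A$; the arc space is $X_\infty=\varprojlim X_m$. If $X=\mathrm{Spec}\,\mathbb{C}[y_1,\dots,y_r]/\langle f_1,\dots,f_k\rangle$, then $\mathcal{O}(X_\infty)$ is the quotient of $\mathbb{C}[y_j^{(i)}: 1\le j\le r,\ i\ge 0]$ by the ideal generated by all $D^i f_l$, where $D$ is the derivation with $D y_j^{(i)}=y_j^{(i+1)}$ and $y_j=y_j^{(0)}$; $D$ induces a derivation of $\mathcal{O}(X_\infty)$. For an affine $G$-variety $X$, put $X/\!\!/G=\mathrm{Spec}(\mathcal{O}(X)^G)$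 with canonical map $p\colon X\to X/\!\!/G$. By functoriality $G_m$ acts on $X_m$, and $p$ induces $p_m\colon X_m\to (X/\!\!/G)_m$ and $p_m^*\colon\mathcal{O}((X/\!\!/G)_m)\to\mathcal{O}(X_m)^{G_m}$ ($m\le\infty$). $X$ is $m$-very good if $p_m^*$ is an isomorphism and $m$-good if $p_m^*$ is surjective. $X$ is $D$-finite if $\mathcal{O}(X_\infty)^{G_\infty}$ is finitely generated as a differential algebra (with derivation $D$). A subset $S\subset X$ is $G$-saturated if $S=p^{-1}(p(S))$. *)

theory Defs
  imports
    Complex_Main
    "HOL-Library.Poly_Mapping"
    "HOL-Library.Extended_Nat"
    "HOL-Library.FuncSet"
    "HOL-Algebra.QuotRing"
    "HOL-Algebra.Group_Action"
    "Jordan_Normal_Form.Matrix"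
begin

section \<open>Complex polynomials in an arbitrary set of variables\<close>

type_synonym 'v mpoly = "('v \<Rightarrow>\<^sub>0 nat) \<Rightarrow>\<^sub>0 complex"

definition pvars :: "'v mpoly \<Rightarrow> 'v set" where
  "pvars p = (\<Union>M\<in>Poly_Mapping.keys p. Poly_Mapping.keys M)"

definition pconst :: "complex \<Rightarrow> 'v mpoly" where
  "pconst c = Poly_Mapping.single 0 c"

definition pvar :: "'v \<Rightarrow> 'v mpoly" where
  "pvar v = Poly_Mapping.single (Poly_Mapping.single v 1) 1"

definition peval :: "'v mpoly \<Rightarrow> ('v \<Rightarrow> complex) \<Rightarrow> complex" where
  "peval p x =
     (\<Sum>M\<in>Poly_Mapping.keys p.
        Poly_Mapping.lookup p M * (\<Prod>v\<in>Poly_Mapping.keys M. x v ^ Poly_Mapping.lookup M v))"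

text \<open>The algebra map sending the variable \<open>v\<close> to the variable \<open>s v\<close>.\<close>

definition prename :: "('v \<Rightarrow> 'w) \<Rightarrow> 'v mpoly \<Rightarrow> 'w mpoly" where
  "prename s p =
     (\<Sum>M\<in>Poly_Mapping.keys p. Poly_Mapping.single
        (\<Sum>v\<in>Poly_Mapping.keys M. Poly_Mapping.single (s v) (Poly_Mapping.lookup M v))
        (Poly_Mapping.lookup p M))"

text \<open>The \<open>\<complex>\<close>-linear derivation sending the variable \<open>v\<close> to the variable \<open>d v\<close>.\<close>

definition pderivation :: "('v \<Rightarrow> 'v) \<Rightarrow> 'v mpoly \<Rightarrow> 'v mpoly" where
  "pderivation d p =
     (\<Sum>M\<in>Poly_Mapping.keys p. \<Sum>v\<in>Poly_Mapping.keys M.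
        Poly_Mapping.single (M - Poly_Mapping.single v 1 + Poly_Mapping.single (d v) 1)
          (Poly_Mapping.lookup p M * of_nat (Poly_Mapping.lookup M v)))"


section \<open>Affine varieties\<close>

text \<open>
  A variety is a set of points together with an algebra of complex functions on it. The functions
  are extensional: they are \<open>undefined\<close> outside the set of points. Varieties are reduced, but
  need be neither irreducible nor nonempty.
\<close>

record 'a fun_space =
  pts :: "'a set"
  regs :: "('a \<Rightarrow> complex) set"

definition cfun :: "'a set \<Rightarrow> complex \<Rightarrow> 'a \<Rightarrow> complex" where
  "cfun A c = (\<lambda>x\<in>A. c)"

definition addf :: "'a set \<Rightarrow> ('a \<Rightarrow> complex) \<Rightarrow> ('a \<Rightarrow> complex) \<Rightarrow> 'a \<Rightarrow> complex" where
  "addf A f g = (\<lambda>x\<in>A. f x + g x)"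

definition mulf :: "'a set \<Rightarrow> ('a \<Rightarrow> complex) \<Rightarrow> ('a \<Rightarrow> complex) \<Rightarrow> 'a \<Rightarrow> complex" where
  "mulf A f g = (\<lambda>x\<in>A. f x * g x)"

definition affine_space :: "nat \<Rightarrow> complex vec fun_space" where
  "affine_space n =
     \<lparr>pts = carrier_vec n,
      regs = {(\<lambda>w\<in>carrier_vec n. peval p (\<lambda>i. w $ i)) | p. pvars p \<subseteq> {..<n}}\<rparr>"

definition zariski_closed :: "'a fun_space \<Rightarrow> 'a set \<Rightarrow> bool" where
  "zariski_closed X Z \<longleftrightarrow> (\<exists>F\<subseteq>regs X. Z = {x \<in> pts X. \<forall>f\<in>F. f x = 0})"

definition zariski_open :: "'a fun_space \<Rightarrow> 'a set \<Rightarrow> bool" where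
  "zariski_open X U \<longleftrightarrow> U \<subseteq> pts X \<and> zariski_closed X (pts X - U)"

text \<open>
  An affine variety is a space with functions that is isomorphic to a Zariski closed subset of
  some \<open>\<complex>\<^sup>n\<close> with the restrictions of the polynomial functions.
\<close>

definition affine_variety :: "'a fun_space \<Rightarrow> bool" where
  "affine_variety X \<longleftrightarrow>
     (\<exists>n Z \<phi>. zariski_closed (affine_space n) Z \<and> bij_betw \<phi> (pts X) Z \<and>
        regs X = {(\<lambda>x\<in>pts X. h (\<phi> x)) | h. h \<in> regs (affine_space n)})"

text \<open>
  The open subspace of an affine variety on an open set \<open>U\<close>; its functions are the regular ones,
  i.e. those that locally are fractions of elements of \<open>regs X\<close>.
\<close>

definition open_sub :: "'a fun_space \<Rightarrow> 'a set \<Rightarrow> 'a fun_space" where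
  "open_sub X U =
     \<lparr>pts = U,
      regs = {h \<in> extensional U. \<forall>x\<in>U. \<exists>a\<in>regs X. \<exists>b\<in>regs X.
                b x \<noteq> 0 \<and> (\<forall>y\<in>U. b y \<noteq> 0 \<longrightarrow> h y = a y / b y)}\<rparr>"

definition pullback :: "'a fun_space \<Rightarrow> ('a \<Rightarrow> 'b) \<Rightarrow> ('b \<Rightarrow> complex) \<Rightarrow> 'a \<Rightarrow> complex" where
  "pullback X \<phi> h = (\<lambda>x\<in>pts X. h (\<phi> x))"

definition morphism :: "'a fun_space \<Rightarrow> 'b fun_space \<Rightarrow> ('a \<Rightarrow> 'b) \<Rightarrow> bool" where
  "morphism X Y \<phi> \<longleftrightarrow> \<phi> \<in> pts X \<rightarrow> pts Y \<and> (\<forall>h\<in>regs Y. pullback X \<phi> h \<in> regs X)"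

text \<open>For affine \<open>X\<close> and \<open>Y\<close>, the coordinate ring of the product is the tensor product.\<close>

definition prod_space :: "'a fun_space \<Rightarrow> 'b fun_space \<Rightarrow> ('a \<times> 'b) fun_space" where
  "prod_space X Y =
     \<lparr>pts = pts X \<times> pts Y,
      regs = {(\<lambda>(x, y)\<in>pts X \<times> pts Y. \<Sum>i<k. a i x * b i y) | (k::nat) a b.
                (\<forall>i<k. a i \<in> regs X \<and> b i \<in> regs Y)}\<rparr>"


section \<open>Reductive groups, modules and actions\<close>

record 'g alg_group = "'g monoid" +
  gregs :: "('g \<Rightarrow> complex) set"

definition group_space :: "'g alg_group \<Rightarrow> 'g fun_space" where
  "group_space G = \<lparr>pts = carrier G, regs = gregs G\<rparr>"

definition algebraic_group :: "'g alg_group \<Rightarrow> bool" where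
  "algebraic_group G \<longleftrightarrow>
     group G \<and> affine_variety (group_space G) \<and>
     morphism (prod_space (group_space G) (group_space G)) (group_space G)
       (\<lambda>(g, h). g \<otimes>\<^bsub>G\<^esub> h) \<and>
     morphism (group_space G) (group_space G) (\<lambda>g. inv\<^bsub>G\<^esub> g)"

text \<open>A \<open>G\<close>-module of dimension \<open>n\<close>, in coordinates: a rational representation on \<open>\<complex>\<^sup>n\<close>.\<close>

definition G_module :: "'g alg_group \<Rightarrow> nat \<Rightarrow> ('g \<Rightarrow> complex mat) \<Rightarrow> bool" where
  "G_module G n \<rho> \<longleftrightarrow>
     (\<forall>g\<in>carrier G. \<rho> g \<in> carrier_mat n n) \<and>
     \<rho> \<one>\<^bsub>G\<^esub> = 1\<^sub>m n \<and>
     (\<forall>g\<in>carrier G. \<forall>h\<in>carrier G. \<rho> (g \<otimes>\<^bsub>G\<^esub> h) = \<rho> g * \<rho> h) \<and>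
     (\<forall>i<n. \<forall>j<n. (\<lambda>g\<in>carrier G. \<rho> g $$ (i, j)) \<in> gregs G)"

definition submodule :: "'g alg_group \<Rightarrow> nat \<Rightarrow> ('g \<Rightarrow> complex mat) \<Rightarrow> complex vec set \<Rightarrow> bool" where
  "submodule G n \<rho> S \<longleftrightarrow>
     S \<subseteq> carrier_vec n \<and> 0\<^sub>v n \<in> S \<and>
     (\<forall>v\<in>S. \<forall>w\<in>S. v + w \<in> S) \<and> (\<forall>c. \<forall>v\<in>S. c \<cdot>\<^sub>v v \<in> S) \<and>
     (\<forall>g\<in>carrier G. \<forall>v\<in>S. \<rho> g *\<^sub>v v \<in> S)"

definition completely_reducible :: "'g alg_group \<Rightarrow> nat \<Rightarrow> ('g \<Rightarrow> complex mat) \<Rightarrow> bool" where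
  "completely_reducible G n \<rho> \<longleftrightarrow>
     (\<forall>S. submodule G n \<rho> S \<longrightarrow>
        (\<exists>T. submodule G n \<rho> T \<and> S \<inter> T = {0\<^sub>v n} \<and>
             {v + w | v w. v \<in> S \<and> w \<in> T} = carrier_vec n))"

text \<open>
  Reductive in the sense of invariant theory: every \<open>G\<close>-module is completely reducible. Over
  \<open>\<complex>\<close> this is equivalent to the triviality of the unipotent radical.
\<close>

definition reductive_group :: "'g alg_group \<Rightarrow> bool" where
  "reductive_group G \<longleftrightarrow>
     algebraic_group G \<and> (\<forall>n \<rho>. G_module G n \<rho> \<longrightarrow> completely_reducible G n \<rho>)"

definition affine_G_variety :: "'g alg_group \<Rightarrow> 'a fun_space \<Rightarrow> ('g \<Rightarrow> 'a \<Rightarrow> 'a) \<Rightarrow> bool" where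
  "affine_G_variety G X act \<longleftrightarrow>
     affine_variety X \<and> group_action G (pts X) act \<and>
     morphism (prod_space (group_space G) X) X (\<lambda>(g, x). act g x)"

definition linear_act :: "nat \<Rightarrow> ('g \<Rightarrow> complex mat) \<Rightarrow> 'g \<Rightarrow> complex vec \<Rightarrow> complex vec" where
  "linear_act n \<rho> g = (\<lambda>w\<in>carrier_vec n. \<rho> g *\<^sub>v w)"

definition restrict_act :: "('g \<Rightarrow> 'a \<Rightarrow> 'a) \<Rightarrow> 'a set \<Rightarrow> 'g \<Rightarrow> 'a \<Rightarrow> 'a" where
  "restrict_act act U g = (\<lambda>x\<in>U. act g x)"


section \<open>The quotient\<close>

definition inv_functions ::
  "'g alg_group \<Rightarrow> 'a fun_space \<Rightarrow> ('g \<Rightarrow> 'a \<Rightarrow> 'a) \<Rightarrow> ('a \<Rightarrow> complex) set" where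
  "inv_functions G X act =
     {h \<in> regs X. \<forall>g\<in>carrier G. \<forall>x\<in>pts X. h (act g x) = h x}"

text \<open>
  The spectrum of the algebra of invariants \<open>A\<close>: the points are the algebra homomorphisms
  \<open>\<chi> : A \<rightarrow> \<complex>\<close>, and an element \<open>h\<close> of \<open>A\<close> is the function \<open>\<chi> \<mapsto> \<chi> h\<close>.
\<close>

definition quot_pts ::
  "'g alg_group \<Rightarrow> 'a fun_space \<Rightarrow> ('g \<Rightarrow> 'a \<Rightarrow> 'a) \<Rightarrow> (('a \<Rightarrow> complex) \<Rightarrow> complex) set" where
  "quot_pts G X act =
     {\<chi> \<in> extensional (inv_functions G X act).
        (\<forall>c. \<chi> (cfun (pts X) c) = c) \<and>
        (\<forall>f\<in>inv_functions G X act. \<forall>h\<in>inv_functions G X act.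
           \<chi> (addf (pts X) f h) = \<chi> f + \<chi> h \<and> \<chi> (mulf (pts X) f h) = \<chi> f * \<chi> h)}"

definition quot_space ::
  "'g alg_group \<Rightarrow> 'a fun_space \<Rightarrow> ('g \<Rightarrow> 'a \<Rightarrow> 'a) \<Rightarrow> (('a \<Rightarrow> complex) \<Rightarrow> complex) fun_space" where
  "quot_space G X act =
     \<lparr>pts = quot_pts G X act,
      regs = {(\<lambda>\<chi>\<in>quot_pts G X act. \<chi> h) | h. h \<in> inv_functions G X act}\<rparr>"

definition quot_map ::
  "'g alg_group \<Rightarrow> 'a fun_space \<Rightarrow> ('g \<Rightarrow> 'a \<Rightarrow> 'a) \<Rightarrow> 'a \<Rightarrow> ('a \<Rightarrow> complex) \<Rightarrow> complex" where
  "quot_map G X act x = (\<lambda>h\<in>inv_functions G X act. h x)"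

definition saturated ::
  "'g alg_group \<Rightarrow> 'a fun_space \<Rightarrow> ('g \<Rightarrow> 'a \<Rightarrow> 'a) \<Rightarrow> 'a set \<Rightarrow> bool" where
  "saturated G X act S \<longleftrightarrow>
     S = {x \<in> pts X. quot_map G X act x \<in> quot_map G X act ` S}"


section \<open>Jet schemes and arc spaces\<close>

text \<open>
  The coordinate ring \<open>\<O>(X\<^sub>m)\<close> for \<open>m \<le> \<infinity>\<close>. Present \<open>\<O>(X)\<close> with all its elements \<open>r\<close> as
  generators, subject to the relations that express the algebra structure; then \<open>\<O>(X\<^sub>m)\<close> is
  generated by variables \<open>r\<^sup>(\<^sup>i\<^sup>)\<close> with \<open>i \<le> m\<close>, here the pairs \<open>(r, i)\<close>, subject to the relations
  \<open>D\<^sup>k f\<close> with \<open>k \<le> m\<close>. Since a generic \<open>m\<close>-jet is \<open>r \<mapsto> \<Sum>i\<le>m. r\<^sup>(\<^sup>i\<^sup>) t\<^sup>i / i!\<close>, algebra maps from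
  \<open>\<O>(X\<^sub>m)\<close> to \<open>A\<close> correspond to algebra maps from \<open>\<O>(X)\<close> to \<open>A[t]/(t\<^sup>m\<^sup>+\<^sup>1)\<close>, or to \<open>A[[t]]\<close> if
  \<open>m = \<infinity>\<close>. The ring \<open>\<O>(X\<^sub>m)\<close> need not be reduced.
\<close>

type_synonym 'a jet_var = "('a \<Rightarrow> complex) \<times> nat"

definition jet_derivation :: "'a jet_var mpoly \<Rightarrow> 'a jet_var mpoly" where
  "jet_derivation = pderivation (\<lambda>(r, i). (r, Suc i))"

definition alg_relations :: "'a fun_space \<Rightarrow> 'a jet_var mpoly set" where
  "alg_relations X =
     {pvar (cfun (pts X) c, 0) - pconst c | c. True} \<union>
     {pvar (addf (pts X) f g, 0) - (pvar (f, 0) + pvar (g, 0)) | f g. f \<in> regs X \<and> g \<in> regs X} \<union>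
     {pvar (mulf (pts X) f g, 0) - pvar (f, 0) * pvar (g, 0) | f g. f \<in> regs X \<and> g \<in> regs X}"

definition jet_poly_ring :: "enat \<Rightarrow> 'a fun_space \<Rightarrow> 'a jet_var mpoly ring" where
  "jet_poly_ring m X =
     \<lparr>carrier = {p. pvars p \<subseteq> regs X \<times> {i. enat i \<le> m}},
      monoid.mult = (*), one = 1, zero = 0, add = (+)\<rparr>"

definition jet_ideal :: "enat \<Rightarrow> 'a fun_space \<Rightarrow> 'a jet_var mpoly set" where
  "jet_ideal m X =
     Idl\<^bsub>jet_poly_ring m X\<^esub>
       {(jet_derivation ^^ k) f | k f. enat k \<le> m \<and> f \<in> alg_relations X}"

definition jet_ring :: "enat \<Rightarrow> 'a fun_space \<Rightarrow> 'a jet_var mpoly set ring" where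
  "jet_ring m X = jet_poly_ring m X Quot jet_ideal m X"

definition jet_class :: "enat \<Rightarrow> 'a fun_space \<Rightarrow> 'a jet_var mpoly \<Rightarrow> 'a jet_var mpoly set" where
  "jet_class m X p = jet_ideal m X +>\<^bsub>jet_poly_ring m X\<^esub> p"

text \<open>
  The comorphism \<open>\<O>(Y\<^sub>m) \<rightarrow> \<O>(X\<^sub>m)\<close> of the map \<open>X\<^sub>m \<rightarrow> Y\<^sub>m\<close> induced by a morphism \<open>\<phi> : X \<rightarrow> Y\<close>,
  which sends \<open>r\<^sup>(\<^sup>i\<^sup>)\<close> to \<open>(\<phi>\<^sup>* r)\<^sup>(\<^sup>i\<^sup>)\<close>. It does not depend on representatives, so the union is over
  equal classes; the same holds for \<open>jet_D\<close> below.
\<close>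

definition jet_comorphism ::
  "enat \<Rightarrow> 'a fun_space \<Rightarrow> ('a \<Rightarrow> 'b) \<Rightarrow> 'b jet_var mpoly set \<Rightarrow> 'a jet_var mpoly set" where
  "jet_comorphism m X \<phi> P =
     (\<Union>p\<in>P. jet_class m X (prename (\<lambda>(r, i). (pullback X \<phi> r, i)) p))"

text \<open>The derivation \<open>D\<close> of the coordinate ring of the arc space.\<close>

definition jet_D :: "'a fun_space \<Rightarrow> 'a jet_var mpoly set \<Rightarrow> 'a jet_var mpoly set" where
  "jet_D X P = (\<Union>p\<in>P. jet_class \<infinity> X (jet_derivation p))"

text \<open>
  The invariants \<open>\<O>(X\<^sub>m)\<close>\<open>\<^sup>G\<^sup>m\<close> of the group scheme \<open>G\<^sub>m\<close>. Since \<open>(G \<times> X)\<^sub>m = G\<^sub>m \<times> X\<^sub>m\<close>, the action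
  of \<open>G\<^sub>m\<close> on \<open>X\<^sub>m\<close> is the map induced by the action \<open>G \<times> X \<rightarrow> X\<close>. A function on the possibly
  nonreduced scheme \<open>X\<^sub>m\<close> is invariant if its pullbacks to \<open>G\<^sub>m \<times> X\<^sub>m\<close> along the action map and
  along the projection coincide.
\<close>

definition jet_invariants ::
  "enat \<Rightarrow> 'g alg_group \<Rightarrow> 'a fun_space \<Rightarrow> ('g \<Rightarrow> 'a \<Rightarrow> 'a) \<Rightarrow> 'a jet_var mpoly set set" where
  "jet_invariants m G X act =
     {P \<in> carrier (jet_ring m X).
        jet_comorphism m (prod_space (group_space G) X) (\<lambda>(g, x). act g x) P =
        jet_comorphism m (prod_space (group_space G) X) snd P}"


section \<open>Very good, good and \<open>D\<close>-finite varieties\<close>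

text \<open>The map \<open>p\<^sub>m\<^sup>*\<close> for the quotient map \<open>p\<close>.\<close>

definition quot_comorphism ::
  "enat \<Rightarrow> 'g alg_group \<Rightarrow> 'a fun_space \<Rightarrow> ('g \<Rightarrow> 'a \<Rightarrow> 'a) \<Rightarrow>
     (('a \<Rightarrow> complex) \<Rightarrow> complex) jet_var mpoly set \<Rightarrow> 'a jet_var mpoly set" where
  "quot_comorphism m G X act = jet_comorphism m X (quot_map G X act)"

definition very_good :: "enat \<Rightarrow> 'g alg_group \<Rightarrow> 'a fun_space \<Rightarrow> ('g \<Rightarrow> 'a \<Rightarrow> 'a) \<Rightarrow> bool" where
  "very_good m G X act \<longleftrightarrow>
     quot_comorphism m G X act \<in>
       ring_iso (jet_ring m (quot_space G X act))
                ((jet_ring m X)\<lparr>carrier := jet_invariants m G X act\<rparr>)"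

definition good :: "enat \<Rightarrow> 'g alg_group \<Rightarrow> 'a fun_space \<Rightarrow> ('g \<Rightarrow> 'a \<Rightarrow> 'a) \<Rightarrow> bool" where
  "good m G X act \<longleftrightarrow>
     quot_comorphism m G X act ` carrier (jet_ring m (quot_space G X act)) =
       jet_invariants m G X act"

inductive_set diff_alg_gen ::
  "'a fun_space \<Rightarrow> 'a jet_var mpoly set set \<Rightarrow> 'a jet_var mpoly set set" for X F where
  gen: "P \<in> F \<Longrightarrow> P \<in> diff_alg_gen X F"
| const: "jet_class \<infinity> X (pconst c) \<in> diff_alg_gen X F"
| add: "P \<in> diff_alg_gen X F \<Longrightarrow> Q \<in> diff_alg_gen X F \<Longrightarrow> P \<oplus>\<^bsub>jet_ring \<infinity> X\<^esub> Q \<in> diff_alg_gen X F"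
| mult: "P \<in> diff_alg_gen X F \<Longrightarrow> Q \<in> diff_alg_gen X F \<Longrightarrow> P \<otimes>\<^bsub>jet_ring \<infinity> X\<^esub> Q \<in> diff_alg_gen X F"
| deriv: "P \<in> diff_alg_gen X F \<Longrightarrow> jet_D X P \<in> diff_alg_gen X F"

definition D_finite :: "'g alg_group \<Rightarrow> 'a fun_space \<Rightarrow> ('g \<Rightarrow> 'a \<Rightarrow> 'a) \<Rightarrow> bool" where
  "D_finite G X act \<longleftrightarrow>
     (\<exists>F. finite F \<and> F \<subseteq> jet_invariants \<infinity> G X act \<and>
          diff_alg_gen X F = jet_invariants \<infinity> G X act)"

end

theory Submission
  imports
    Defs
    "HOL-Computational_Algebra.Polynomial"
    "HOL-Computational_Algebra.Fundamental_Theorem_Algebra"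
    "HOL-Analysis.Continuum_Not_Denumerable"
begin

text \<open>
  The algebra of invariants of \<open>X\<^sub>m\<close> is the equalizer of the two maps from \<open>\<O>(X\<^sub>m)\<close> to
  \<open>\<O>((G \<times> X)\<^sub>m)\<close>, and \<open>p\<^sub>m\<^sup>*\<close> maps the jet ring of the equalizer \<open>\<O>(X)\<^sup>G\<close> to it. Jet rings
  commute with the localization at a function, hence for an invariant \<open>f\<close> all of this localizes from
  \<open>X\<close> to \<open>X\<^sub>f\<close>. So each of the three properties passes from \<open>X\<close> to \<open>X\<^sub>f\<close>, and it passes back from
  \<open>X\<^sub>f\<close> for \<open>f\<close> in a set of invariants that generates the unit ideal of \<open>\<O>(X)\<^sup>G\<close>.

  Reductivity enters through one statement: if \<open>\<Sum>\<^sub>i q\<^sub>i h\<^sub>i = 1\<close> with \<open>h\<^sub>i\<close> invariant, then the \<open>q\<^sub>i\<close> can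
  be replaced by invariants that still vanish on given \<open>G\<close>-stable sets on which the \<open>q\<^sub>i\<close> vanish.
  With the Nullstellensatz, invariants without common zero generate the unit ideal of \<open>\<O>(X)\<^sup>G\<close>, and
  a saturated open set contains with each point \<open>x\<close> some \<open>X\<^sub>f\<close> with \<open>f\<close> invariant and \<open>f x \<noteq> 0\<close>.
  This gives the first part. For the second part, \<open>W\<close> is covered by the images of \<open>W\<^sub>f\<close> under the
  homotheties, because \<open>f\<close> does not vanish at the origin.
\<close>

text \<open>Jet rings may be nonreduced, so nothing about them can be tested at points; points serve
  only in order zero, where equal functions are literally the same variable. Everything else is a
  congruence between polynomials in jet variables modulo an ideal given by generators. The delicate
  half of localization is the kernel: an element that dies in the jets of \<open>X_f\<close> must be
  killed by a power of \<open>f\<close>. This follows from a left inverse with values in polynomials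
  in one unknown \<open>y\<close> over the jet polynomials of \<open>X\<close>, modulo
  \<open>y * f = 1\<close>, with the derivation extended to \<open>y\<close>. Descent along a cover
  sees equalities only up to powers of the \<open>f_j\<close>. The relation
  \<open>sum c_j * f_j = 1\<close> removes these powers, but it has to hold among the jets of
  invariants, so the \<open>c_j\<close> must be invariant too. This is why reductivity is phrased as
  making the solution of a linear equation invariant. The Nullstellensatz is proved for countably
  many variables by comparing the countable dimension of the polynomial ring with the uncountable
  field of coefficients.\<close>

interpretation idl: Modules.module "(*) :: 'r::comm_ring_1 \<Rightarrow> 'r \<Rightarrow> 'r"
  by standard (auto simp: algebra_simps)

text \<open>Seen over itself, a commutative ring is a module whose submodules are the ideals, so
  \<open>idl.span\<close> is the generated ideal. As a simp rule, \<open>idl.scale_scale\<close>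
  would regroup products to the left, against \<open>mult.assoc\<close>.\<close>

declare idl.scale_scale [simp del]

lemma idl_mult_left: "x \<in> idl.span S \<Longrightarrow> c * x \<in> idl.span S"
  by (rule idl.span_scale)

lemma idl_mult_right: "x \<in> idl.span S \<Longrightarrow> x * c \<in> idl.span S"
  by (metis idl.span_scale mult.commute)

section \<open>Polynomial rings\<close>

lemma poly_mapping_eq_sum_single:
  "p = (\<Sum>M\<in>Poly_Mapping.keys p. Poly_Mapping.single M (Poly_Mapping.lookup p M))"
  by (rule poly_mapping_eqI)
     (auto simp: lookup_sum lookup_single when_def in_keys_iff sum.delta)

text \<open>The coefficient map is a parameter so that a single evaluation \<open>phom\<close>
  covers values at points, renaming and substitution of variables, and maps to polynomials in one
  more unknown.\<close>

definition chom :: "(complex \<Rightarrow> 'r::comm_ring_1) \<Rightarrow> bool" where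
  "chom c \<longleftrightarrow> c 0 = 0 \<and> c 1 = 1 \<and> (\<forall>a b. c (a + b) = c a + c b) \<and> (\<forall>a b. c (a * b) = c a * c b)"

definition pmonom :: "('v \<Rightarrow> 'r::comm_ring_1) \<Rightarrow> ('v \<Rightarrow>\<^sub>0 nat) \<Rightarrow> 'r" where
  "pmonom x M = (\<Prod>v\<in>Poly_Mapping.keys M. x v ^ Poly_Mapping.lookup M v)"

definition phom :: "(complex \<Rightarrow> 'r::comm_ring_1) \<Rightarrow> ('v \<Rightarrow> 'r) \<Rightarrow> 'v mpoly \<Rightarrow> 'r" where
  "phom c x p = (\<Sum>M\<in>Poly_Mapping.keys p. c (Poly_Mapping.lookup p M) * pmonom x M)"

lemma pmonom_superset:
  assumes "finite A" "Poly_Mapping.keys M \<subseteq> A"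
  shows "pmonom x M = (\<Prod>v\<in>A. x v ^ Poly_Mapping.lookup M v)"
  unfolding pmonom_def
  by (rule prod.mono_neutral_left) (use assms in \<open>auto simp: in_keys_iff\<close>)

lemma pmonom_add: "pmonom x (M + N) = pmonom x M * pmonom x N"
proof -
  let ?A = "Poly_Mapping.keys M \<union> Poly_Mapping.keys N"
  have "Poly_Mapping.keys (M + N) \<subseteq> ?A" by (rule keys_add)
  then show ?thesis
    by (simp add: pmonom_superset[of ?A] lookup_add power_add prod.distrib)
qed

lemma pmonom_0 [simp]: "pmonom x 0 = 1"
  by (simp add: pmonom_def)

lemma phom_superset:
  assumes "chom c" "finite A" "Poly_Mapping.keys p \<subseteq> A"
  shows "phom c x p = (\<Sum>M\<in>A. c (Poly_Mapping.lookup p M) * pmonom x M)"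
  unfolding phom_def
  by (rule sum.mono_neutral_left) (use assms in \<open>auto simp: in_keys_iff chom_def\<close>)

lemma phom_add:
  assumes "chom c" shows "phom c x (p + q) = phom c x p + phom c x q"
proof -
  let ?A = "Poly_Mapping.keys p \<union> Poly_Mapping.keys q"
  have "Poly_Mapping.keys (p + q) \<subseteq> ?A" by (rule keys_add)
  moreover have "c (a + b) = c a + c b" for a b using assms by (auto simp: chom_def)
  ultimately show ?thesis
    by (simp add: phom_superset[OF assms, of ?A] lookup_add algebra_simps sum.distrib)
qed

lemma phom_0 [simp]: "phom c x 0 = 0"
  by (simp add: phom_def)

lemma phom_single: "chom c \<Longrightarrow> phom c x (Poly_Mapping.single M a) = c a * pmonom x M"
  by (cases "a = 0") (auto simp: phom_def chom_def)

lemma phom_sum: "chom c \<Longrightarrow> phom c x (sum f A) = (\<Sum>a\<in>A. phom c x (f a))"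
  by (induction A rule: infinite_finite_induct) (auto simp: phom_add)

lemma phom_mult:
  assumes "chom c" shows "phom c x (p * q) = phom c x p * phom c x q"
proof -
  let ?s = "\<lambda>p M. Poly_Mapping.single M (Poly_Mapping.lookup p M)"
  have cm: "c (a * b) = c a * c b" for a b using assms by (auto simp: chom_def)
  have "p * q = (\<Sum>M\<in>Poly_Mapping.keys p. ?s p M) * (\<Sum>M\<in>Poly_Mapping.keys q. ?s q M)"
    by (simp flip: poly_mapping_eq_sum_single)
  then have "phom c x (p * q) = (\<Sum>M\<in>Poly_Mapping.keys p. \<Sum>N\<in>Poly_Mapping.keys q.
      c (Poly_Mapping.lookup p M) * c (Poly_Mapping.lookup q N) * pmonom x (M + N))"
    by (simp add: sum_product phom_sum[OF assms] mult_single phom_single[OF assms] cm)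
  also have "\<dots> = phom c x p * phom c x q"
    unfolding phom_def sum_product
    by (simp add: pmonom_add mult_ac)
  finally show ?thesis .
qed

lemma phom_pconst: "chom c \<Longrightarrow> phom c x (pconst a) = c a"
  by (simp add: pconst_def phom_single)

lemma phom_1: "chom c \<Longrightarrow> phom c x 1 = 1"
  using phom_pconst[of c x 1] by (simp add: pconst_def chom_def)

lemma phom_uminus: "chom c \<Longrightarrow> phom c x (- p) = - phom c x p"
  using phom_add[of c x p "-p"] by (simp add: add_eq_0_iff)

lemma phom_diff: "chom c \<Longrightarrow> phom c x (p - q) = phom c x p - phom c x q"
  using phom_add[of c x p "-q"] by (simp add: phom_uminus)

lemma phom_power: "chom c \<Longrightarrow> phom c x (p ^ k) = phom c x p ^ k"
  by (induction k) (auto simp: phom_1 phom_mult)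

lemma phom_prod: "chom c \<Longrightarrow> phom c x (prod f A) = (\<Prod>a\<in>A. phom c x (f a))"
  by (induction A rule: infinite_finite_induct) (auto simp: phom_mult phom_1)

lemma phom_pvar: "chom c \<Longrightarrow> phom c x (pvar v) = x v"
  by (simp add: pvar_def phom_single pmonom_def) (simp add: chom_def)

lemmas phom_simps = phom_add phom_mult phom_pconst phom_1 phom_uminus phom_diff phom_power
  phom_pvar phom_sum phom_prod

lemma pconst_0 [simp]: "pconst 0 = 0" and pconst_1 [simp]: "pconst 1 = 1"
  by (simp_all add: pconst_def)

lemma pconst_add: "pconst (a + b) = pconst a + pconst b"
  and pconst_mult: "pconst (a * b) = pconst a * pconst b"
  by (simp_all add: pconst_def single_add mult_single)

lemma chom_pconst: "chom pconst"
  by (simp add: chom_def pconst_add pconst_mult)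

lemma chom_id: "chom (\<lambda>a. a)"
  by (simp add: chom_def)

lemma single_power:
  "Poly_Mapping.single M (1::complex) ^ k = Poly_Mapping.single (\<Sum>i<k. M) 1"
  by (induction k) (simp_all add: mult_single add.commute)

lemma sum_const_single:
  "(\<Sum>i<k. Poly_Mapping.single v (1::nat)) = Poly_Mapping.single v k"
  by (induction k) (simp_all add: single_add[symmetric])

lemma pvar_power: "pvar v ^ k = Poly_Mapping.single (Poly_Mapping.single v k) 1"
  unfolding pvar_def single_power sum_const_single ..

lemma prod_pvar_power:
  "finite A \<Longrightarrow> (\<Prod>v\<in>A. pvar (s v) ^ k v) =
     Poly_Mapping.single (\<Sum>v\<in>A. Poly_Mapping.single (s v) (k v)) 1"
  by (induction A rule: finite_induct) (simp_all add: pvar_power mult_single)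

lemma prename_phom: "prename s p = phom pconst (\<lambda>v. pvar (s v)) p"
  unfolding prename_def phom_def pmonom_def
  by (rule sum.cong) (simp_all add: prod_pvar_power pconst_def mult_single)

lemma phom_pvar_id: "phom pconst pvar p = p"
proof -
  have "prename (\<lambda>v. v) p = (\<Sum>M\<in>Poly_Mapping.keys p. Poly_Mapping.single M (Poly_Mapping.lookup p M))"
    unfolding prename_def by (rule sum.cong) (simp_all flip: poly_mapping_eq_sum_single)
  then show ?thesis unfolding prename_phom by (simp flip: poly_mapping_eq_sum_single)
qed

lemma peval_phom: "peval p x = phom (\<lambda>a. a) x p"
  by (simp add: peval_def phom_def pmonom_def)

lemmas peval_simps = phom_simps[OF chom_id, folded peval_phom]

lemmas prename_simps = phom_simps[OF chom_pconst, where x = "\<lambda>v. pvar (s v)" for s, folded prename_phom]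

section \<open>Polynomials in a prescribed set of variables\<close>

definition pring :: "'v set \<Rightarrow> 'v mpoly set" where
  "pring V = {p. pvars p \<subseteq> V}"

lemma pring_alt: "p \<in> pring V \<longleftrightarrow> (\<forall>M\<in>Poly_Mapping.keys p. Poly_Mapping.keys M \<subseteq> V)"
  by (auto simp: pring_def pvars_def)

lemma pring_add: "p \<in> pring V \<Longrightarrow> q \<in> pring V \<Longrightarrow> p + q \<in> pring V"
  unfolding pring_alt using keys_add[of p q] by blast

lemma pring_uminus: "p \<in> pring V \<Longrightarrow> - p \<in> pring V"
  unfolding pring_alt by (simp add: in_keys_iff Ball_def)

lemma pring_diff: "p \<in> pring V \<Longrightarrow> q \<in> pring V \<Longrightarrow> p - q \<in> pring V"
  using pring_add[of p V "-q"] pring_uminus by force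

lemma pring_mult: "p \<in> pring V \<Longrightarrow> q \<in> pring V \<Longrightarrow> p * q \<in> pring V"
proof -
  assume pq: "p \<in> pring V" "q \<in> pring V"
  show ?thesis unfolding pring_alt
  proof
    fix M assume "M \<in> Poly_Mapping.keys (p * q)"
    then obtain A B where "A \<in> Poly_Mapping.keys p" "B \<in> Poly_Mapping.keys q" "M = A + B"
      using keys_mult[of p q] by blast
    with pq show "Poly_Mapping.keys M \<subseteq> V"
      using keys_add[of A B] unfolding pring_alt by blast
  qed
qed

lemma pring_pconst [simp]: "pconst c \<in> pring V"
  by (simp add: pring_alt pconst_def)

lemma pring_0 [simp]: "0 \<in> pring V" and pring_1 [simp]: "1 \<in> pring V"
  using pring_pconst[of 0] pring_pconst[of 1] by simp_all

lemma pring_pvar [simp]: "pvar v \<in> pring V \<longleftrightarrow> v \<in> V"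
  by (simp add: pring_alt pvar_def)

lemma pring_power: "p \<in> pring V \<Longrightarrow> p ^ k \<in> pring V"
  by (induction k) (auto intro: pring_mult)

lemma pring_sum: "(\<And>a. a \<in> A \<Longrightarrow> f a \<in> pring V) \<Longrightarrow> sum f A \<in> pring V"
  by (induction A rule: infinite_finite_induct) (auto intro: pring_add)

lemma pring_prod: "(\<And>a. a \<in> A \<Longrightarrow> f a \<in> pring V) \<Longrightarrow> prod f A \<in> pring V"
  by (induction A rule: infinite_finite_induct) (auto intro: pring_mult)

lemmas pring_intros = pring_add pring_mult pring_uminus pring_diff pring_power pring_sum pring_prod

lemma pring_mono: "V \<subseteq> V' \<Longrightarrow> p \<in> pring V \<Longrightarrow> p \<in> pring V'"
  by (auto simp: pring_def)

lemma pring_UNIV [simp]: "p \<in> pring UNIV"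
  by (simp add: pring_def)

text \<open>A polynomial is its own value at the variables (\<open>phom_pvar_id\<close>), hence
  built by finitely many sums and products. The strengthened predicate \<open>Q\<close> records that
  all intermediate results stay in \<open>pring V\<close>.\<close>

lemma pring_induct [consumes 1, case_names const var add mult]:
  assumes p: "p \<in> pring V"
    and const: "\<And>c. P (pconst c)"
    and var: "\<And>v. v \<in> V \<Longrightarrow> P (pvar v)"
    and add: "\<And>p q. p \<in> pring V \<Longrightarrow> q \<in> pring V \<Longrightarrow> P p \<Longrightarrow> P q \<Longrightarrow> P (p + q)"
    and mult: "\<And>p q. p \<in> pring V \<Longrightarrow> q \<in> pring V \<Longrightarrow> P p \<Longrightarrow> P q \<Longrightarrow> P (p * q)"
  shows "P p"
proof -
  define Q where "Q p \<longleftrightarrow> p \<in> pring V \<and> P p" for p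
  have c: "Q (pconst c)" for c by (simp add: Q_def const)
  have 01: "Q 0" "Q 1" using c[of 0] c[of 1] by simp_all
  have m: "Q (p * q)" if "Q p" "Q q" for p q
    using that by (auto simp: Q_def pring_mult mult)
  have a: "Q (p + q)" if "Q p" "Q q" for p q
    using that by (auto simp: Q_def pring_add add)
  have pw: "Q (p ^ k)" if "Q p" for p k by (induction k) (auto simp: 01 m that)
  have pr: "Q (prod f A)" if "\<And>a. a \<in> A \<Longrightarrow> Q (f a)" for f and A :: "'v set"
    using that by (induction A rule: infinite_finite_induct) (auto simp: 01 m)
  have sm: "Q (sum f A)" if "\<And>a. a \<in> A \<Longrightarrow> Q (f a)" for f and A :: "('v \<Rightarrow>\<^sub>0 nat) set"
    using that by (induction A rule: infinite_finite_induct) (auto simp: 01 a)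
  have "Q (phom pconst pvar p)"
    unfolding phom_def pmonom_def using p[unfolded pring_alt]
    by (intro sm m c pr pw) (auto simp: Q_def var subset_iff)
  then show ?thesis by (simp add: phom_pvar_id Q_def)
qed

lemma phom_cong:
  assumes c: "chom c" and "\<And>v. v \<in> V \<Longrightarrow> x v = y v" "p \<in> pring V"
  shows "phom c x p = phom c y p"
  using assms(3) by (induction p rule: pring_induct) (simp_all add: assms phom_simps)

lemma phom_in_pring:
  assumes "p \<in> pring V" "\<And>v. v \<in> V \<Longrightarrow> x v \<in> pring W"
  shows "phom pconst x p \<in> pring W"
  using assms(1)
  by (induction p rule: pring_induct)
     (simp_all add: assms phom_simps[OF chom_pconst] pring_add pring_mult)

lemma prename_cong:
  "(\<And>v. v \<in> V \<Longrightarrow> s v = t v) \<Longrightarrow> p \<in> pring V \<Longrightarrow> prename s p = prename t p"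
  unfolding prename_phom by (rule phom_cong[OF chom_pconst, of V]) auto

lemma prename_prename: "prename s (prename t p) = prename (\<lambda>v. s (t v)) p"
  by (rule pring_induct[of p UNIV, OF pring_UNIV]) (simp_all add: prename_simps)

lemma prename_id: "(\<And>v. v \<in> V \<Longrightarrow> s v = v) \<Longrightarrow> p \<in> pring V \<Longrightarrow> prename s p = p"
  using prename_cong[of V s "\<lambda>v. v" p] by (simp add: prename_phom phom_pvar_id)

subsection \<open>Derivations\<close>

definition mderiv :: "('v \<Rightarrow> 'v) \<Rightarrow> ('v \<Rightarrow>\<^sub>0 nat) \<Rightarrow> 'v mpoly" where
  "mderiv d M = (\<Sum>v\<in>Poly_Mapping.keys M. Poly_Mapping.single
     (M - Poly_Mapping.single v 1 + Poly_Mapping.single (d v) 1) (of_nat (Poly_Mapping.lookup M v)))"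

lemma mderiv_superset:
  assumes "finite A" "Poly_Mapping.keys M \<subseteq> A"
  shows "mderiv d M = (\<Sum>v\<in>A. Poly_Mapping.single
     (M - Poly_Mapping.single v 1 + Poly_Mapping.single (d v) 1) (of_nat (Poly_Mapping.lookup M v)))"
  unfolding mderiv_def
  by (rule sum.mono_neutral_left) (use assms in \<open>auto simp: in_keys_iff\<close>)

text \<open>Subtraction of exponents truncates at zero, so the regrouping requires \<open>v\<close>
  to occur in \<open>M\<close>.\<close>

lemma minus_single_add:
  fixes M N :: "'v \<Rightarrow>\<^sub>0 nat"
  assumes "Poly_Mapping.lookup M v > 0"
  shows "M + N - Poly_Mapping.single v 1 = N + (M - Poly_Mapping.single v 1)"
  by (rule poly_mapping_eqI) (use assms in \<open>auto simp: lookup_add lookup_minus lookup_single when_def\<close>)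

lemma mderiv_add:
  "mderiv d (M + N) =
     Poly_Mapping.single N 1 * mderiv d M + Poly_Mapping.single M 1 * mderiv d N"
proof -
  let ?A = "Poly_Mapping.keys M \<union> Poly_Mapping.keys N"
  let ?s = "Poly_Mapping.single"
  have sub: "Poly_Mapping.keys (M + N) \<subseteq> ?A" by (rule keys_add)
  \<comment> \<open>If \<open>v\<close> does not occur in \<open>M\<close>, both sides have the
    coefficient zero and the truncated exponent is harmless.\<close>
  have 1: "?s (M + N - ?s v 1 + ?s (d v) 1) (of_nat (Poly_Mapping.lookup M v)) =
     ?s N 1 * ?s (M - ?s v 1 + ?s (d v) 1) (of_nat (Poly_Mapping.lookup M v) :: complex)"
    for v and M N :: "'a \<Rightarrow>\<^sub>0 nat"
    by (cases "Poly_Mapping.lookup M v = 0")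
       (simp_all add: minus_single_add mult_single add.assoc del: One_nat_def)
  have "mderiv d (M + N) = (\<Sum>v\<in>?A. ?s (M + N - ?s v 1 + ?s (d v) 1) (of_nat (Poly_Mapping.lookup M v))
     + ?s (M + N - ?s v 1 + ?s (d v) 1) (of_nat (Poly_Mapping.lookup N v)))"
    unfolding mderiv_superset[OF _ sub, simplified]
    by (simp add: lookup_add single_add)
  also have "\<dots> = (\<Sum>v\<in>?A. ?s N 1 * ?s (M - ?s v 1 + ?s (d v) 1) (of_nat (Poly_Mapping.lookup M v))
     + ?s M 1 * ?s (N - ?s v 1 + ?s (d v) 1) (of_nat (Poly_Mapping.lookup N v)))"
    using 1[of M N] 1[of N M] by (simp add: add.commute[of N M])
  also have "\<dots> = ?s N 1 * mderiv d M + ?s M 1 * mderiv d N"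
    by (simp add: mderiv_superset[of ?A] sum.distrib sum_distrib_left)
  finally show ?thesis .
qed

lemma pderivation_mderiv:
  "pderivation d p = (\<Sum>M\<in>Poly_Mapping.keys p. pconst (Poly_Mapping.lookup p M) * mderiv d M)"
  by (simp add: pderivation_def mderiv_def pconst_def sum_distrib_left mult_single)

lemma pderivation_superset:
  assumes "finite A" "Poly_Mapping.keys p \<subseteq> A"
  shows "pderivation d p = (\<Sum>M\<in>A. pconst (Poly_Mapping.lookup p M) * mderiv d M)"
  unfolding pderivation_mderiv
  by (rule sum.mono_neutral_left) (use assms in \<open>auto simp: in_keys_iff\<close>)

lemma pderivation_add: "pderivation d (p + q) = pderivation d p + pderivation d q"
proof -
  let ?A = "Poly_Mapping.keys p \<union> Poly_Mapping.keys q"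
  have "Poly_Mapping.keys (p + q) \<subseteq> ?A" by (rule keys_add)
  then show ?thesis
    by (simp add: pderivation_superset[of ?A] lookup_add pconst_add algebra_simps sum.distrib)
qed

lemma pderivation_single: "pderivation d (Poly_Mapping.single M a) = pconst a * mderiv d M"
  by (cases "a = 0") (simp_all add: pderivation_mderiv)

lemma pderivation_0 [simp]: "pderivation d 0 = 0"
  by (simp add: pderivation_def)

lemma pderivation_sum: "pderivation d (sum f A) = (\<Sum>a\<in>A. pderivation d (f a))"
  by (induction A rule: infinite_finite_induct) (auto simp: pderivation_add)

lemma pderivation_mult: "pderivation d (p * q) = pderivation d p * q + p * pderivation d q"
proof -
  let ?s = "\<lambda>p M. Poly_Mapping.single M (Poly_Mapping.lookup p M)"
  have 1: "pderivation d (Poly_Mapping.single M a * Poly_Mapping.single N b) =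
      pderivation d (Poly_Mapping.single M a) * Poly_Mapping.single N b +
      Poly_Mapping.single M a * pderivation d (Poly_Mapping.single N b)" for M N a b
  proof -
    have M: "Poly_Mapping.single M a = pconst a * Poly_Mapping.single M 1"
      and N: "Poly_Mapping.single N b = pconst b * Poly_Mapping.single N 1"
      by (simp_all add: pconst_def mult_single)
    have "pderivation d (Poly_Mapping.single M a * Poly_Mapping.single N b) =
        pconst a * pconst b * (Poly_Mapping.single N 1 * mderiv d M + Poly_Mapping.single M 1 * mderiv d N)"
      by (simp only: mult_single pderivation_single mderiv_add pconst_mult)
    moreover have "pderivation d (Poly_Mapping.single M a) * Poly_Mapping.single N b +
        Poly_Mapping.single M a * pderivation d (Poly_Mapping.single N b) =
        pconst a * mderiv d M * (pconst b * Poly_Mapping.single N 1) +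
        pconst a * Poly_Mapping.single M 1 * (pconst b * mderiv d N)"
      by (simp only: pderivation_single) (simp only: M N)
    ultimately show ?thesis by (simp add: algebra_simps)
  qed
  have "p * q = (\<Sum>M\<in>Poly_Mapping.keys p. \<Sum>N\<in>Poly_Mapping.keys q. ?s p M * ?s q N)"
    unfolding sum_product[symmetric] by (simp flip: poly_mapping_eq_sum_single)
  then have "pderivation d (p * q) = (\<Sum>M\<in>Poly_Mapping.keys p. \<Sum>N\<in>Poly_Mapping.keys q.
     pderivation d (?s p M) * ?s q N + ?s p M * pderivation d (?s q N))"
    by (simp only: pderivation_sum 1)
  also have "\<dots> = pderivation d (\<Sum>M\<in>Poly_Mapping.keys p. ?s p M) * (\<Sum>M\<in>Poly_Mapping.keys q. ?s q M)
     + (\<Sum>M\<in>Poly_Mapping.keys p. ?s p M) * pderivation d (\<Sum>M\<in>Poly_Mapping.keys q. ?s q M)"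
    by (simp only: pderivation_sum sum_product sum.distrib)
  finally show ?thesis by (simp flip: poly_mapping_eq_sum_single)
qed

lemma pderivation_pconst [simp]: "pderivation d (pconst a) = 0"
  by (simp add: pconst_def pderivation_single) (simp add: mderiv_def)

lemma pderivation_pvar: "pderivation d (pvar v) = pvar (d v)"
  by (simp add: pvar_def pderivation_single) (simp add: mderiv_def)

text \<open>Stated over any ring, since besides \<open>jet_derivation\<close> its extension to
  polynomials in one more unknown is needed.\<close>

definition is_der :: "('r::comm_ring_1 \<Rightarrow> 'r) \<Rightarrow> bool" where
  "is_der D \<longleftrightarrow> (\<forall>p q. D (p + q) = D p + D q) \<and> (\<forall>p q. D (p * q) = D p * q + p * D q)"

lemma is_derD:
  assumes "is_der D"
  shows "D (p + q) = D p + D q" "D (p * q) = D p * q + p * D q"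
    "D 0 = 0" "D (- p) = - D p" "D (p - q) = D p - D q" "D 1 = 0"
proof -
  have add: "D (p + q) = D p + D q" and mult: "D (p * q) = D p * q + p * D q" for p q
    using assms by (auto simp: is_der_def)
  have z: "D 0 = 0" using add[of 0 0] by simp
  have neg: "D (- p) = - D p" for p
    using add[of p "-p"] by (simp add: z eq_neg_iff_add_eq_0 add.commute)
  show "D (p + q) = D p + D q" "D (p * q) = D p * q + p * D q" "D 0 = 0" "D (- p) = - D p"
    by (fact add mult z neg)+
  show "D (p - q) = D p - D q" using add[of p "-q"] neg by simp
  show "D 1 = 0" using mult[of 1 1] by simp
qed

lemma is_der_pderivation: "is_der (pderivation d)"
  by (simp add: is_der_def pderivation_add pderivation_mult)

lemma is_der_jet: "is_der jet_derivation"
  unfolding jet_derivation_def by (rule is_der_pderivation)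

lemma jet_derivation_pvar [simp]: "jet_derivation (pvar (r, i)) = pvar (r, Suc i)"
  by (simp add: jet_derivation_def pderivation_pvar)

lemma jet_derivation_pconst [simp]: "jet_derivation (pconst a) = 0"
  by (simp add: jet_derivation_def)

text \<open>By the Leibniz rule \<open>D (c * x) = D c * x + c * D x\<close>, so generators suffice.
  The larger set \<open>T\<close> is there because differentiating a jet relation raises its
  order.\<close>

lemma is_der_span:
  assumes D: "is_der D" and "S \<subseteq> T" "D ` S \<subseteq> idl.span T" "p \<in> idl.span S"
  shows "D p \<in> idl.span T"
  using assms(4)
proof (induction rule: idl.span_induct_alt)
  case base
  then show ?case by (simp add: is_derD[OF D] idl.span_zero)
next
  case (step c x y)
  have "x \<in> idl.span T" "D x \<in> idl.span T"
    using step(1) assms(2,3) by (auto intro: idl.span_base)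
  then show ?case
    using step(2) by (auto simp: is_derD[OF D] intro!: idl.span_add idl_mult_left)
qed

text \<open>Both sides obey the Leibniz rule over \<open>phom c x\<close>, so agreement on constants
  and variables is enough.\<close>

lemma phom_der_commute:
  assumes c: "chom c" and D: "is_der D" "is_der D'"
    and "\<And>a. D (pconst a) = 0" "\<And>a. D' (c a) = 0"
    and "\<And>v. v \<in> V \<Longrightarrow> phom c x (D (pvar v)) = D' (x v)" "p \<in> pring V"
  shows "phom c x (D p) = D' (phom c x p)"
  using assms(7)
  by (induction p rule: pring_induct) (simp_all add: assms phom_simps is_derD)

section \<open>The Nullstellensatz\<close>

text \<open>Zorn's lemma for the proper ideals containing \<open>S\<close>. The inverse
  \<open>b\<close> exists because maximality forces 1 into the ideal generated by \<open>M\<close>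
  and \<open>a\<close>.\<close>

lemma maximal_ideal_exists:
  fixes S :: "'r::comm_ring_1 set"
  assumes "1 \<notin> idl.span S"
  obtains M where "idl.subspace M" "S \<subseteq> M" "1 \<notin> M" "\<And>a. a \<notin> M \<Longrightarrow> \<exists>b. b * a - 1 \<in> M"
proof -
  define \<A> where "\<A> = {J. idl.subspace J \<and> S \<subseteq> J \<and> 1 \<notin> J}"
  have "\<exists>M\<in>\<A>. \<forall>X\<in>\<A>. M \<subseteq> X \<longrightarrow> X = M"
  proof (rule subset_Zorn_nonempty)
    show "\<A> \<noteq> {}" using assms by (auto simp: \<A>_def intro: idl.span_base)
    fix \<C> assume C: "\<C> \<noteq> {}" "subset.chain \<A> \<C>"
    then have sub: "\<And>J. J \<in> \<C> \<Longrightarrow> J \<in> \<A>" and lin: "\<And>J K. J \<in> \<C> \<Longrightarrow> K \<in> \<C> \<Longrightarrow> J \<subseteq> K \<or> K \<subseteq> J"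
      by (auto simp: subset.chain_def)
    have "idl.subspace (\<Union>\<C>)"
      unfolding idl.subspace_def
    proof (intro conjI allI ballI)
      show "0 \<in> \<Union>\<C>" using C(1) sub by (auto simp: \<A>_def idl.subspace_def)
      fix x y assume "x \<in> \<Union>\<C>" "y \<in> \<Union>\<C>"
      then obtain J K where J: "J \<in> \<C>" "K \<in> \<C>" "x \<in> J" "y \<in> K" by blast
      then obtain L where "L \<in> \<C>" "x \<in> L" "y \<in> L" using lin[of J K] by blast
      then show "x + y \<in> \<Union>\<C>" using sub[of L] by (auto simp: \<A>_def idl.subspace_def)
    next
      fix c x assume "x \<in> \<Union>\<C>"
      then obtain J where "J \<in> \<C>" "x \<in> J" by blast
      then show "c * x \<in> \<Union>\<C>" using sub[of J]
        by (intro UnionI[of J]) (auto simp: \<A>_def idl.subspace_def)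
    qed
    then show "\<Union>\<C> \<in> \<A>" using C(1) sub by (auto simp: \<A>_def)
  qed
  then obtain M where M: "M \<in> \<A>" and max: "\<And>X. X \<in> \<A> \<Longrightarrow> M \<subseteq> X \<Longrightarrow> X = M" by blast
  have sM: "idl.subspace M" "S \<subseteq> M" "1 \<notin> M" using M by (auto simp: \<A>_def)
  have "\<exists>b. b * a - 1 \<in> M" if a: "a \<notin> M" for a
  proof -
    have MI: "idl.span M = M" using sM(1) by simp
    have "M \<subseteq> idl.span (insert a M)" "a \<in> idl.span (insert a M)" by (auto intro: idl.span_base)
    with max[of "idl.span (insert a M)"] a sM have "1 \<in> idl.span (insert a M)"
      unfolding \<A>_def by blast
    then obtain k where "1 - k * a \<in> M" unfolding idl.span_breakdown_eq MI by blast
    then have "- (1 - k * a) \<in> M" by (rule idl.subspace_neg[OF sM(1)])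
    then show ?thesis by (intro exI[of _ k]) simp
  qed
  with sM show ?thesis by (intro that)
qed

text \<open>A monomial is recovered from the finite graph of its nonzero exponents. So the
  polynomial ring in countably many variables has countable dimension over the complex
  numbers.\<close>

lemma countable_monomials: "countable (UNIV :: (nat \<Rightarrow>\<^sub>0 nat) set)"
proof -
  let ?g = "\<lambda>M :: nat \<Rightarrow>\<^sub>0 nat. (\<lambda>v. (v, Poly_Mapping.lookup M v)) ` Poly_Mapping.keys M"
  have lk: "Poly_Mapping.lookup M v = n \<longleftrightarrow> (if n = 0 then \<forall>k. (v, k) \<notin> ?g M else (v, n) \<in> ?g M)"
    for M v n by (auto simp: in_keys_iff image_iff)
  have "inj ?g"
  proof (rule injI, rule poly_mapping_eqI)
    fix M N v assume *: "?g M = ?g N"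
    show "Poly_Mapping.lookup M v = Poly_Mapping.lookup N v"
      unfolding lk[of M] unfolding * by (auto simp: in_keys_iff)
  qed
  moreover have "countable (?g ` UNIV)"
    by (rule countable_subset[of _ "{A :: (nat \<times> nat) set. finite A}"])
       (auto intro: countable_Collect_finite)
  ultimately show ?thesis
    by (rule countable_image_inj_on[rotated])
qed

text \<open>\<open>poly (map_poly pconst q) a\<close> is the value of a univariate complex
  polynomial \<open>q\<close> at an element \<open>a\<close> of a polynomial ring; the lemmas up to
  \<open>pev_prod_linear\<close> compute it.\<close>

lemma pev_add:
  fixes a :: "'v mpoly"
  shows "poly (map_poly pconst (p + q)) a = poly (map_poly pconst p) a + poly (map_poly pconst q) a"
proof -
  have "map_poly pconst (p + q) = (map_poly pconst p + map_poly pconst q :: 'v mpoly poly)"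
    by (rule poly_eqI) (simp add: coeff_map_poly pconst_add)
  then show ?thesis by simp
qed

lemma pev_smult:
  fixes a :: "'v mpoly"
  shows "poly (map_poly pconst (smult c p)) a = pconst c * poly (map_poly pconst p) a"
proof -
  have "map_poly pconst (smult c p) = smult (pconst c :: 'v mpoly) (map_poly pconst p)"
    by (rule poly_eqI) (simp add: coeff_map_poly pconst_mult)
  then show ?thesis by simp
qed

lemma pev_linear:
  fixes a :: "'v mpoly"
  shows "poly (map_poly pconst ([:- z, 1:] * r)) a = (a - pconst z) * poly (map_poly pconst r) a"
proof -
  have "pconst (- z) = - (pconst z :: 'v mpoly)" for z
    using pconst_add[of z "-z"] by (simp add: eq_neg_iff_add_eq_0 add.commute)
  moreover have "[:- z, 1:] * r = smult (- z) r + pCons 0 r" by simp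
  ultimately show ?thesis
    by (simp only: pev_add pev_smult) (simp add: map_poly_pCons algebra_simps)
qed

lemma pev_sum: "poly (map_poly pconst (sum f A)) a = (\<Sum>i\<in>A. poly (map_poly pconst (f i)) a)"
  by (induction A rule: infinite_finite_induct) (simp_all add: pev_add)

lemma pev_prod_linear:
  "poly (map_poly pconst (\<Prod>d\<in>A. [:- g d, 1:])) a = (\<Prod>d\<in>A. a - pconst (g d))"
  by (induction A rule: infinite_finite_induct) (simp_all add: pev_linear del: mult_pCons_left)

text \<open>Over the complex numbers \<open>q\<close> splits into linear factors up to a constant,
  and a prime ideal containing the product of the \<open>a - z\<close> contains one of them.\<close>

lemma poly_root_in_maximal_ideal:
  fixes a :: "'v mpoly"
  assumes M: "idl.subspace M" "1 \<notin> M" and prime: "\<And>x y. x * y \<in> M \<Longrightarrow> x \<in> M \<or> y \<in> M"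
    and q: "q \<noteq> 0" "poly (map_poly pconst q) a \<in> M"
  shows "\<exists>z. a - pconst z \<in> M"
proof -
  let ?ev = "\<lambda>q. poly (map_poly pconst q) a"
  show ?thesis using q
  proof (induction "degree q" arbitrary: q)
    case 0
    then obtain c where q: "q = [:c:]" by (metis degree_0_id)
    with 0 have c: "c \<noteq> 0" "pconst c \<in> M" by (auto simp: map_poly_pCons)
    then have "pconst (inverse c) * pconst c \<in> M" using M(1) by (auto simp: idl.subspace_def)
    then show ?case using c M(2) by (simp flip: pconst_mult)
  next
    case (Suc n)
    then have "\<not> constant (poly q)" by (simp add: constant_degree)
    then obtain z where "poly q z = 0" using fundamental_theorem_of_algebra by blast
    then obtain r where r: "q = [:-z, 1:] * r" by (auto simp: poly_eq_0_iff_dvd)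
    with Suc.prems have r0: "r \<noteq> 0" by auto
    have "degree q = Suc (degree r)" unfolding r by (subst degree_mult_eq) (use r0 in auto)
    moreover have "?ev q = (a - pconst z) * ?ev r"
      unfolding r by (rule pev_linear)
    ultimately show ?case using Suc prime[of "a - pconst z" "?ev r"] r0 by auto
  qed
qed

text \<open>If no \<open>a - z\<close> lies in \<open>M\<close>, then all \<open>a - c\<close> with
  \<open>c\<close> real are invertible modulo \<open>M\<close>, and uncountably many inverses do not
  fit into countable dimension without a linear relation. Clearing denominators in that relation
  gives a nonzero polynomial with value in \<open>M\<close> at \<open>a\<close>.\<close>

lemma residue_constant:
  fixes a :: "nat mpoly"
  assumes M: "idl.subspace M" "1 \<notin> M" and inv: "\<And>a. a \<notin> M \<Longrightarrow> \<exists>b. b * a - 1 \<in> M"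
    and prime: "\<And>x y. x * y \<in> M \<Longrightarrow> x \<in> M \<or> y \<in> M"
  shows "\<exists>z. a - pconst z \<in> M"
proof (rule ccontr)
  assume neg: "\<not> ?thesis"
  have M_add: "x + y \<in> M" if "x \<in> M" "y \<in> M" for x y
    using that M(1) by (auto simp: idl.subspace_def)
  have M_mult: "c * x \<in> M" if "x \<in> M" for c x
    using that M(1) by (auto simp: idl.subspace_def)
  have M_diff: "x - y \<in> M" if "x \<in> M" "y \<in> M" for x y
    using that idl.subspace_diff[OF M(1)] by blast
  interpret cv: vector_space "\<lambda>(c::complex) (p::nat mpoly). pconst c * p"
    by standard (simp_all add: algebra_simps pconst_add pconst_mult)
  define x where "x c = a - pconst (complex_of_real c)" for c
  have "\<forall>c. \<exists>b. b * x c - 1 \<in> M" using neg inv unfolding x_def by blast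
  then obtain b where b: "\<And>c. b c * x c - 1 \<in> M" by metis
  define e :: "nat \<Rightarrow> nat \<Rightarrow>\<^sub>0 nat" where "e = from_nat_into UNIV"
  have e: "range e = UNIV"
    unfolding e_def by (rule range_from_nat_into) (simp_all add: countable_monomials)
  \<comment> \<open>The finite sets \<open>B n\<close> exhaust the monomials, so each chosen inverse
    lies in the span of some \<open>B n\<close>.\<close>
  define B where "B n = (\<lambda>i. Poly_Mapping.single (e i) (1::complex)) ` {..<n}" for n
  have "\<exists>n. p \<in> cv.span (B n)" for p
  proof -
    have "finite (inv_into UNIV e ` Poly_Mapping.keys p)" by simp
    then obtain n where n: "\<And>i. i \<in> inv_into UNIV e ` Poly_Mapping.keys p \<Longrightarrow> i < n"
      by (metis finite_nat_set_iff_bounded)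
    have "(\<Sum>M\<in>Poly_Mapping.keys p. pconst (Poly_Mapping.lookup p M) * Poly_Mapping.single M 1) \<in> cv.span (B n)"
    proof (intro cv.span_sum cv.span_scale cv.span_base)
      fix M assume "M \<in> Poly_Mapping.keys p"
      then have "inv_into UNIV e M < n" using n by blast
      moreover have "e (inv_into UNIV e M) = M" using e by (simp add: f_inv_into_f)
      ultimately show "Poly_Mapping.single M 1 \<in> B n"
        unfolding B_def by (metis imageI lessThan_iff)
    qed
    also have "(\<Sum>M\<in>Poly_Mapping.keys p. pconst (Poly_Mapping.lookup p M) * Poly_Mapping.single M 1) = p"
      by (simp add: pconst_def mult_single flip: poly_mapping_eq_sum_single)
    finally show ?thesis ..
  qed
  then have "\<forall>c. \<exists>n. b c \<in> cv.span (B n)" by blast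
  then obtain N where N: "\<And>c. b c \<in> cv.span (B (N c))" by metis
  \<comment> \<open>Uncountably many reals are distributed over countably many values of
    \<open>N\<close>, so a single space of finite dimension contains the inverses for infinitely
    many of them.\<close>
  have "\<exists>n. infinite {c. N c = n}"
  proof (rule ccontr)
    assume "\<not> ?thesis"
    then have "countable (\<Union>n. {c. N c = n})" by (auto intro: countable_finite)
    moreover have "(\<Union>n. {c. N c = n}) = UNIV" by auto
    ultimately show False using uncountable_UNIV_real by simp
  qed
  then obtain n where n: "infinite {c. N c = n}" by blast
  define C where "C = {c. N c = n}"
  \<comment> \<open>One element cannot be inverse to two of the \<open>x c\<close> modulo
    \<open>M\<close>, as these differ by nonzero constants. Hence infinitely many reals give
    infinitely many vectors.\<close>
  have inj: "inj b"
  proof (rule injI, rule ccontr)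
    fix c d assume cd: "b c = b d" "c \<noteq> d"
    have "b c * x c - 1 - (b d * x d - 1) \<in> M" by (intro M_diff b)
    also have "b c * x c - 1 - (b d * x d - 1) =
        pconst (complex_of_real d) * b c - pconst (complex_of_real c) * b c"
      unfolding x_def cd(1) by (simp add: algebra_simps)
    also have "\<dots> = pconst (complex_of_real d - complex_of_real c) * b c"
      by (simp add: cv.scale_left_diff_distrib)
    finally have "pconst (inverse (complex_of_real d - complex_of_real c)) *
        (pconst (complex_of_real d - complex_of_real c) * b c) \<in> M" by (rule M_mult)
    then have "b c \<in> M" using cd(2) by (simp flip: mult.assoc pconst_mult)
    then have "x c * b c - (b c * x c - 1) \<in> M" by (intro M_diff M_mult b)
    then show False using M(2) by (simp add: mult.commute)
  qed
  have "cv.dependent (b ` C)"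
  proof (rule ccontr)
    assume "\<not> ?thesis"
    moreover have "b ` C \<subseteq> cv.span (B n)" using N unfolding C_def by auto
    moreover have "finite (B n)" by (simp add: B_def)
    ultimately have "finite (b ` C)" using cv.independent_span_bound by blast
    then show False using n inj unfolding C_def by (metis finite_imageD inj_on_subset subset_UNIV)
  qed
  then obtain t u where t: "finite t" "t \<subseteq> b ` C" "(\<Sum>v\<in>t. pconst (u v) * v) = 0" "\<exists>v\<in>t. u v \<noteq> 0"
    unfolding cv.dependent_explicit by blast
  obtain T where T: "finite T" "t = b ` T"
    using t(1,2) by (meson finite_subset_image)
  define l where "l c = u (b c)" for c
  have sum0: "(\<Sum>c\<in>T. pconst (l c) * b c) = 0"
    using t(3) unfolding T(2) by (subst (asm) sum.reindex) (auto simp: l_def intro: inj_on_subset[OF inj])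
  obtain c0 where c0: "c0 \<in> T" "l c0 \<noteq> 0" using t(4) T(2) by (auto simp: l_def)
  \<comment> \<open>The relation between the inverses of the \<open>a - c\<close>, multiplied by the
    product of all \<open>a - d\<close> with \<open>d\<close> in \<open>T\<close>. At
    \<open>c0\<close> only one summand survives, so \<open>q\<close> is not zero.\<close>
  define q where "q = (\<Sum>c\<in>T. smult (l c) (\<Prod>d\<in>T - {c}. [:- complex_of_real d, 1:]))"
  have "poly q (of_real c0) = (\<Sum>c\<in>T. l c * (\<Prod>d\<in>T - {c}. complex_of_real c0 - of_real d))"
    by (simp add: q_def poly_sum poly_prod)
  also have "\<dots> = (\<Sum>c\<in>{c0}. l c * (\<Prod>d\<in>T - {c}. complex_of_real c0 - of_real d))"
    by (rule sum.mono_neutral_right) (use T c0 in auto)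
  finally have "poly q (of_real c0) \<noteq> 0" using c0 T by auto
  then have "q \<noteq> 0" by auto
  moreover have "poly (map_poly pconst q) a \<in> M"
  proof -
    have ev: "poly (map_poly pconst q) a = (\<Sum>c\<in>T. pconst (l c) * (\<Prod>d\<in>T - {c}. x d))"
      by (simp add: q_def pev_sum pev_smult pev_prod_linear x_def)
    have "(\<Sum>c\<in>T. pconst (l c) * (\<Prod>d\<in>T - {c}. x d) * (b c * x c - 1)) \<in> M"
      by (intro idl.subspace_sum M(1) M_mult b)
    also have "(\<Sum>c\<in>T. pconst (l c) * (\<Prod>d\<in>T - {c}. x d) * (b c * x c - 1)) =
        (\<Sum>c\<in>T. (\<Prod>d\<in>T. x d) * (pconst (l c) * b c)) - poly (map_poly pconst q) a"
      unfolding ev sum_subtractf[symmetric]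
      by (rule sum.cong) (simp_all add: prod.remove[OF T(1)] algebra_simps)
    also have "\<dots> = - poly (map_poly pconst q) a"
      by (simp add: sum0 flip: sum_distrib_left)
    finally show ?thesis using idl.subspace_neg[OF M(1)] by fastforce
  qed
  ultimately show False
    using poly_root_in_maximal_ideal[OF M prime] neg by blast
qed

text \<open>Modulo a maximal ideal every element is a constant, and the constants congruent to the
  variables are the coordinates of a common zero. Since only cardinalities enter, countably many
  variables are allowed, which leaves room to add or interleave coordinates later.\<close>

theorem nullstellensatz:
  fixes S :: "nat mpoly set"
  assumes "\<And>x. \<exists>p\<in>S. peval p x \<noteq> 0"
  shows "1 \<in> idl.span S"
proof (rule ccontr)
  assume "1 \<notin> idl.span S"
  then obtain M where M: "idl.subspace M" "S \<subseteq> M" "1 \<notin> M"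
    and inv: "\<And>a. a \<notin> M \<Longrightarrow> \<exists>b. b * a - 1 \<in> M"
    by (rule maximal_ideal_exists) blast
  have M_add: "x + y \<in> M" if "x \<in> M" "y \<in> M" for x y
    using that M(1) by (auto simp: idl.subspace_def)
  have M_mult: "c * x \<in> M" if "x \<in> M" for c x
    using that M(1) by (auto simp: idl.subspace_def)
  have prime: "x \<in> M \<or> y \<in> M" if "x * y \<in> M" for x y
  proof (rule disjCI)
    assume "y \<notin> M"
    then obtain b where "b * y - 1 \<in> M" using inv by blast
    then have "b * (x * y) + - x * (b * y - 1) \<in> M" by (intro M_add M_mult that)
    then show "x \<in> M" by (simp add: algebra_simps)
  qed
  have "\<exists>z. pvar v - pconst z \<in> M" for v
    by (rule residue_constant[OF M(1) M(3) inv prime])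
  then obtain x where x: "\<And>v. pvar v - pconst (x v) \<in> M" by metis
  \<comment> \<open>Every polynomial is congruent modulo \<open>M\<close> to its value at
    \<open>x\<close>, so a nonzero value of an element of \<open>S\<close> would be a unit in
    \<open>M\<close>.\<close>
  have res: "p - pconst (peval p x) \<in> M" for p
  proof (induction p rule: pring_induct[OF pring_UNIV])
    case (1 c)
    then show ?case using M(1) by (simp add: peval_simps idl.subspace_def)
  next
    case (2 v)
    then show ?case using x by (simp add: peval_simps)
  next
    case (3 p q)
    then show ?case using M_add[OF 3(3,4)] by (simp add: peval_simps pconst_add algebra_simps)
  next
    case (4 p q)
    have "q * (p - pconst (peval p x)) + pconst (peval p x) * (q - pconst (peval q x)) \<in> M"
      using 4 by (intro M_add M_mult) auto
    then show ?case by (simp add: peval_simps pconst_mult algebra_simps)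
  qed
  obtain p where p: "p \<in> S" "peval p x \<noteq> 0" using assms by blast
  have "p + - 1 * (p - pconst (peval p x)) \<in> M"
    using p(1) M(2) by (intro M_add M_mult res) auto
  then have "pconst (inverse (peval p x)) * pconst (peval p x) \<in> M" by (intro M_mult) simp
  then show False using p M(3) by (simp flip: pconst_mult)
qed

section \<open>Algebras of functions\<close>

text \<open>The bare algebra structure, so that jet localization applies alike to \<open>X\<close>,
  to the product with the group and to the algebra of invariants.\<close>

definition fun_alg :: "'a fun_space \<Rightarrow> bool" where
  "fun_alg X \<longleftrightarrow> regs X \<subseteq> extensional (pts X) \<and> (\<forall>c. cfun (pts X) c \<in> regs X) \<and>
     (\<forall>f\<in>regs X. \<forall>g\<in>regs X. addf (pts X) f g \<in> regs X \<and> mulf (pts X) f g \<in> regs X)"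

text \<open>Regularity of a function whose values off \<open>pts X\<close> are irrelevant.\<close>

definition reg :: "'a fun_space \<Rightarrow> ('a \<Rightarrow> complex) \<Rightarrow> bool" where
  "reg X h \<longleftrightarrow> restrict h (pts X) \<in> regs X"

lemma fun_algD:
  assumes "fun_alg X"
  shows "f \<in> regs X \<Longrightarrow> f \<in> extensional (pts X)" "cfun (pts X) c \<in> regs X"
    "f \<in> regs X \<Longrightarrow> g \<in> regs X \<Longrightarrow> addf (pts X) f g \<in> regs X"
    "f \<in> regs X \<Longrightarrow> g \<in> regs X \<Longrightarrow> mulf (pts X) f g \<in> regs X"
  using assms by (auto simp: fun_alg_def)

lemma regs_reg: "fun_alg X \<Longrightarrow> f \<in> regs X \<Longrightarrow> reg X f"
  by (simp add: reg_def extensional_restrict fun_algD)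

lemma reg_regs: "f \<in> extensional (pts X) \<Longrightarrow> reg X f \<Longrightarrow> f \<in> regs X"
  by (simp add: reg_def extensional_restrict)

lemma reg_cong: "(\<And>x. x \<in> pts X \<Longrightarrow> f x = g x) \<Longrightarrow> reg X f \<longleftrightarrow> reg X g"
  unfolding reg_def by (metis restrict_ext)

lemma reg_const: "fun_alg X \<Longrightarrow> reg X (\<lambda>x. c)"
  using fun_algD(2) by (auto simp: reg_def cfun_def)

lemma reg_add:
  assumes "fun_alg X" "reg X f" "reg X g" shows "reg X (\<lambda>x. f x + g x)"
proof -
  have "restrict (\<lambda>x. f x + g x) (pts X) = addf (pts X) (restrict f (pts X)) (restrict g (pts X))"
    by (auto simp: addf_def)
  then show ?thesis using assms by (simp add: reg_def fun_algD)
qed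

lemma reg_mult:
  assumes "fun_alg X" "reg X f" "reg X g" shows "reg X (\<lambda>x. f x * g x)"
proof -
  have "restrict (\<lambda>x. f x * g x) (pts X) = mulf (pts X) (restrict f (pts X)) (restrict g (pts X))"
    by (auto simp: mulf_def)
  then show ?thesis using assms by (simp add: reg_def fun_algD)
qed

lemma reg_uminus: "fun_alg X \<Longrightarrow> reg X f \<Longrightarrow> reg X (\<lambda>x. - f x)"
  using reg_mult[OF _ reg_const[of X "-1"], of f] by simp

lemma reg_diff: "fun_alg X \<Longrightarrow> reg X f \<Longrightarrow> reg X g \<Longrightarrow> reg X (\<lambda>x. f x - g x)"
  using reg_add[of X f "\<lambda>x. - g x"] reg_uminus by fastforce

lemma reg_power: "fun_alg X \<Longrightarrow> reg X f \<Longrightarrow> reg X (\<lambda>x. f x ^ n)"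
  by (induction n) (simp_all add: reg_const reg_mult)

lemma reg_sum: "fun_alg X \<Longrightarrow> (\<And>i. i \<in> A \<Longrightarrow> reg X (f i)) \<Longrightarrow> reg X (\<lambda>x. \<Sum>i\<in>A. f i x)"
  by (induction A rule: infinite_finite_induct) (simp_all add: reg_const reg_add)

lemma fun_algI:
  assumes "regs X \<subseteq> extensional (pts X)" "\<And>c. reg X (\<lambda>x. c)"
    and "\<And>f g. reg X f \<Longrightarrow> reg X g \<Longrightarrow> reg X (\<lambda>x. f x + g x)"
    and "\<And>f g. reg X f \<Longrightarrow> reg X g \<Longrightarrow> reg X (\<lambda>x. f x * g x)"
  shows "fun_alg X"
proof -
  have "reg X f" if "f \<in> regs X" for f
    using that assms(1) by (auto simp: reg_def extensional_restrict subset_iff)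
  then show ?thesis
    using assms unfolding fun_alg_def cfun_def addf_def mulf_def reg_def[symmetric] by blast
qed

subsection \<open>Localization at a function\<close>

text \<open>The localization is described by global fractions \<open>a / f^n\<close>. For affine
  \<open>X\<close>, \<open>open_sub_principal\<close> identifies it with the open subspace where
  \<open>f\<close> does not vanish, whose functions are by definition fractions only
  locally.\<close>

definition loc :: "'a fun_space \<Rightarrow> ('a \<Rightarrow> complex) \<Rightarrow> 'a fun_space" where
  "loc X f = \<lparr>pts = {x \<in> pts X. f x \<noteq> 0},
     regs = {h \<in> extensional {x \<in> pts X. f x \<noteq> 0}.
        \<exists>a n. reg X a \<and> (\<forall>x\<in>pts X. f x \<noteq> 0 \<longrightarrow> h x = a x / f x ^ n)}\<rparr>"

lemma pts_loc [simp]: "pts (loc X f) = {x \<in> pts X. f x \<noteq> 0}"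
  by (simp add: loc_def)

lemma reg_loc_iff:
  "reg (loc X f) h \<longleftrightarrow> (\<exists>a n. reg X a \<and> (\<forall>x\<in>pts X. f x \<noteq> 0 \<longrightarrow> h x = a x / f x ^ n))"
  by (auto simp: reg_def loc_def)

lemma reg_loc_fracI:
  "reg X a \<Longrightarrow> (\<And>x. x \<in> pts X \<Longrightarrow> f x \<noteq> 0 \<Longrightarrow> h x = a x / f x ^ n) \<Longrightarrow> reg (loc X f) h"
  unfolding reg_loc_iff by blast

lemma reg_locI: "reg X a \<Longrightarrow> reg (loc X f) a"
  by (rule reg_loc_fracI[of _ _ _ _ 0]) auto

lemma reg_loc_inverse: "fun_alg X \<Longrightarrow> reg (loc X f) (\<lambda>x. 1 / f x)"
  by (rule reg_loc_fracI[of _ "\<lambda>x. 1" _ _ 1]) (auto intro: reg_const)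

lemma fun_alg_loc:
  assumes X: "fun_alg X" and f: "reg X f"
  shows "fun_alg (loc X f)"
proof (rule fun_algI)
  show "regs (loc X f) \<subseteq> extensional (pts (loc X f))" by (auto simp: loc_def)
  show "reg (loc X f) (\<lambda>x. c)" for c by (intro reg_locI reg_const X)
  fix g h assume "reg (loc X f) g" "reg (loc X f) h"
  then obtain a n b k where a: "reg X a" "\<And>x. x \<in> pts X \<Longrightarrow> f x \<noteq> 0 \<Longrightarrow> g x = a x / f x ^ n"
    and b: "reg X b" "\<And>x. x \<in> pts X \<Longrightarrow> f x \<noteq> 0 \<Longrightarrow> h x = b x / f x ^ k"
    unfolding reg_loc_iff by blast
  show "reg (loc X f) (\<lambda>x. g x + h x)"
    by (rule reg_loc_fracI[of _ "\<lambda>x. a x * f x ^ k + b x * f x ^ n" _ _ "n + k"])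
       (use a b X f in \<open>auto intro!: reg_add reg_mult reg_power simp: field_simps power_add\<close>)
  show "reg (loc X f) (\<lambda>x. g x * h x)"
    by (rule reg_loc_fracI[of _ "\<lambda>x. a x * b x" _ _ "n + k"])
       (use a b X f in \<open>auto intro!: reg_mult simp: power_add\<close>)
qed

subsection \<open>Products\<close>

lemma pts_prod_space [simp]: "pts (prod_space X Y) = pts X \<times> pts Y"
  by (simp add: prod_space_def)

lemma reg_prod_iff:
  assumes "fun_alg X" "fun_alg Y"
  shows "reg (prod_space X Y) h \<longleftrightarrow> (\<exists>(k::nat) a b. (\<forall>i<k. reg X (a i) \<and> reg Y (b i)) \<and>
    (\<forall>x\<in>pts X. \<forall>y\<in>pts Y. h (x, y) = (\<Sum>i<k. a i x * b i y)))" (is "?L \<longleftrightarrow> ?R")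
proof
  assume ?L
  then obtain k :: nat and a b where ab: "\<forall>i<k. a i \<in> regs X \<and> b i \<in> regs Y"
    and h: "restrict h (pts X \<times> pts Y) = (\<lambda>(x, y)\<in>pts X \<times> pts Y. \<Sum>i<k. a i x * b i y)"
    by (auto simp: reg_def prod_space_def)
  have "h (x, y) = (\<Sum>i<k. a i x * b i y)" if "x \<in> pts X" "y \<in> pts Y" for x y
    using fun_cong[OF h, of "(x, y)"] that by simp
  moreover have "\<forall>i<k. reg X (a i) \<and> reg Y (b i)" using ab assms by (simp add: regs_reg)
  ultimately show ?R by (intro exI[of _ k] exI[of _ a] exI[of _ b]) simp
next
  assume ?R
  then obtain k :: nat and a b where ab: "\<forall>i<k. reg X (a i) \<and> reg Y (b i)"
    and h: "\<And>x y. x \<in> pts X \<Longrightarrow> y \<in> pts Y \<Longrightarrow> h (x, y) = (\<Sum>i<k. a i x * b i y)"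
    by blast
  have "restrict h (pts X \<times> pts Y) = (\<lambda>(x, y)\<in>pts X \<times> pts Y. \<Sum>i<k. restrict (a i) (pts X) x * restrict (b i) (pts Y) y)"
    using h by (auto simp: restrict_def fun_eq_iff)
  moreover have "\<forall>i<k. restrict (a i) (pts X) \<in> regs X \<and> restrict (b i) (pts Y) \<in> regs Y"
    using ab by (simp add: reg_def)
  ultimately show ?L
    unfolding reg_def prod_space_def fun_space.simps mem_Collect_eq
    by (intro exI[of _ k] exI[of _ "\<lambda>i. restrict (a i) (pts X)"] exI[of _ "\<lambda>i. restrict (b i) (pts Y)"]) simp
qed

lemma reg_prod_add:
  assumes "fun_alg X" "fun_alg Y" "reg (prod_space X Y) g" "reg (prod_space X Y) h"
  shows "reg (prod_space X Y) (\<lambda>z. g z + h z)"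
proof -
  obtain k :: nat and a b where ab: "\<forall>i<k. reg X (a i) \<and> reg Y (b i)"
    and g: "\<And>x y. x \<in> pts X \<Longrightarrow> y \<in> pts Y \<Longrightarrow> g (x, y) = (\<Sum>i<k. a i x * b i y)"
    using assms(3) unfolding reg_prod_iff[OF assms(1,2)] by blast
  obtain l :: nat and c d where cd: "\<forall>i<l. reg X (c i) \<and> reg Y (d i)"
    and h: "\<And>x y. x \<in> pts X \<Longrightarrow> y \<in> pts Y \<Longrightarrow> h (x, y) = (\<Sum>i<l. c i x * d i y)"
    using assms(4) unfolding reg_prod_iff[OF assms(1,2)] by blast
  let ?a = "\<lambda>i. if i < k then a i else c (i - k)" and ?b = "\<lambda>i. if i < k then b i else d (i - k)"
  have "(\<Sum>i<k + l. ?a i x * ?b i y) = (\<Sum>i<k. a i x * b i y) + (\<Sum>i<l. c i x * d i y)" for x y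
    by (induction l) (simp_all add: add.assoc)
  moreover have "\<forall>i<k + l. reg X (?a i) \<and> reg Y (?b i)" using ab cd by auto
  ultimately show ?thesis unfolding reg_prod_iff[OF assms(1,2)]
    by (intro exI[of _ "k + l"] exI[of _ ?a] exI[of _ ?b]) (simp add: g h)
qed

lemma reg_prod_tensor:
  "fun_alg X \<Longrightarrow> fun_alg Y \<Longrightarrow> reg X a \<Longrightarrow> reg Y b \<Longrightarrow> reg (prod_space X Y) (\<lambda>(x, y). a x * b y)"
  by (subst reg_prod_iff) (auto intro!: exI[of _ "1::nat"] exI[of _ "\<lambda>_. a"] exI[of _ "\<lambda>_. b"])

lemma reg_prod_cong:
  "(\<And>x y. x \<in> pts X \<Longrightarrow> y \<in> pts Y \<Longrightarrow> g (x, y) = h (x, y)) \<Longrightarrow>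
    reg (prod_space X Y) g \<longleftrightarrow> reg (prod_space X Y) h"
  by (rule reg_cong) auto

lemma fun_alg_prod:
  assumes X: "fun_alg X" and Y: "fun_alg Y"
  shows "fun_alg (prod_space X Y)"
proof (rule fun_algI)
  show "regs (prod_space X Y) \<subseteq> extensional (pts (prod_space X Y))"
    by (auto simp: prod_space_def)
  show c: "reg (prod_space X Y) (\<lambda>z. c)" for c
    using reg_prod_tensor[OF X Y reg_const[OF X, of c] reg_const[OF Y, of 1]]
    by (rule iffD1[OF reg_prod_cong, rotated]) auto
  fix g h assume gh: "reg (prod_space X Y) g" "reg (prod_space X Y) h"
  show "reg (prod_space X Y) (\<lambda>z. g z + h z)" by (rule reg_prod_add[OF X Y gh])
  have sum: "reg (prod_space X Y) (\<lambda>z. \<Sum>i\<in>A. F i z)"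
    if "\<And>i. i \<in> A \<Longrightarrow> reg (prod_space X Y) (F i)" for F and A :: "nat set"
    using that by (induction A rule: infinite_finite_induct) (simp_all add: c reg_prod_add[OF X Y])
  obtain k :: nat and a b where ab: "\<forall>i<k. reg X (a i) \<and> reg Y (b i)"
    and g: "\<And>x y. x \<in> pts X \<Longrightarrow> y \<in> pts Y \<Longrightarrow> g (x, y) = (\<Sum>i<k. a i x * b i y)"
    using gh(1) unfolding reg_prod_iff[OF X Y] by blast
  obtain l :: nat and c d where cd: "\<forall>i<l. reg X (c i) \<and> reg Y (d i)"
    and h: "\<And>x y. x \<in> pts X \<Longrightarrow> y \<in> pts Y \<Longrightarrow> h (x, y) = (\<Sum>i<l. c i x * d i y)"
    using gh(2) unfolding reg_prod_iff[OF X Y] by blast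
  have "reg (prod_space X Y) (\<lambda>z. \<Sum>i<k. \<Sum>j<l. (\<lambda>(x, y). (a i x * c j x) * (b i y * d j y)) z)"
    using ab cd by (intro sum reg_prod_tensor X Y reg_mult) auto
  then show "reg (prod_space X Y) (\<lambda>z. g z * h z)"
    by (rule iffD1[OF reg_prod_cong, rotated]) (simp add: g h sum_product mult_ac)
qed

lemma reg_prod_fst:
  assumes "fun_alg X" "fun_alg Y" "reg X a" shows "reg (prod_space X Y) (\<lambda>z. a (fst z))"
  using reg_prod_tensor[OF assms(1,2,3) reg_const[OF assms(2), of 1]]
  by (rule iffD1[OF reg_prod_cong, rotated]) auto

lemma reg_prod_snd:
  assumes "fun_alg X" "fun_alg Y" "reg Y b" shows "reg (prod_space X Y) (\<lambda>z. b (snd z))"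
  using reg_prod_tensor[OF assms(1,2) reg_const[OF assms(1), of 1] assms(3)]
  by (rule iffD1[OF reg_prod_cong, rotated]) auto

lemma fun_space_eqI:
  fixes X Y :: "'a fun_space"
  assumes "pts X = pts Y" "regs X \<subseteq> extensional (pts X)" "regs Y \<subseteq> extensional (pts Y)"
    and "\<And>h. reg X h \<longleftrightarrow> reg Y h"
  shows "X = Y"
proof -
  have "regs X = regs Y"
    using assms by (auto simp: reg_def extensional_restrict subset_iff) (metis extensional_restrict)+
  with assms(1) show ?thesis by simp
qed

text \<open>A denominator in the second variable is absorbed by the second tensor factors. In the
  application, localizing \<open>G \<times> X\<close> at an invariant gives the product of
  \<open>G\<close> with \<open>X_f\<close>.\<close>

lemma loc_prod:
  assumes X: "fun_alg X" and Y: "fun_alg Y" and f: "reg Y f"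
  shows "loc (prod_space X Y) (\<lambda>z. f (snd z)) = prod_space X (loc Y f)" (is "?A = ?B")
proof (rule fun_space_eqI)
  show "pts ?A = pts ?B" by auto
  show "regs ?A \<subseteq> extensional (pts ?A)" "regs ?B \<subseteq> extensional (pts ?B)"
    by (auto simp: loc_def prod_space_def)
  note XL = X fun_alg_loc[OF Y f]
  fix h show "reg ?A h \<longleftrightarrow> reg ?B h"
  proof
    assume "reg ?A h"
    then obtain a n where "reg (prod_space X Y) a"
      and h: "\<And>x y. x \<in> pts X \<Longrightarrow> y \<in> pts Y \<Longrightarrow> f y \<noteq> 0 \<Longrightarrow> h (x, y) = a (x, y) / f y ^ n"
      unfolding reg_loc_iff by auto
    then obtain k :: nat and b c where bc: "\<forall>i<k. reg X (b i) \<and> reg Y (c i)"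
      and a: "\<And>x y. x \<in> pts X \<Longrightarrow> y \<in> pts Y \<Longrightarrow> a (x, y) = (\<Sum>i<k. b i x * c i y)"
      unfolding reg_prod_iff[OF X Y] by blast
    have "\<forall>i<k. reg X (b i) \<and> reg (loc Y f) (\<lambda>y. c i y / f y ^ n)"
      using bc unfolding reg_loc_iff by blast
    moreover have "\<forall>x\<in>pts X. \<forall>y\<in>pts (loc Y f). h (x, y) = (\<Sum>i<k. b i x * (c i y / f y ^ n))"
      by (simp add: h a sum_divide_distrib)
    ultimately show "reg ?B h"
      unfolding reg_prod_iff[OF XL] by (intro exI[of _ k] exI[of _ b] exI[of _ "\<lambda>i y. c i y / f y ^ n"]) simp
  next
    assume "reg ?B h"
    then obtain k :: nat and a b where ab: "\<forall>i<k. reg X (a i) \<and> reg (loc Y f) (b i)"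
      and h: "\<And>x y. x \<in> pts X \<Longrightarrow> y \<in> pts Y \<Longrightarrow> f y \<noteq> 0 \<Longrightarrow> h (x, y) = (\<Sum>i<k. a i x * b i y)"
      unfolding reg_prod_iff[OF XL] by auto
    have fA: "fun_alg ?A"
      by (intro fun_alg_loc fun_alg_prod X Y reg_prod_snd f)
    have 1: "reg ?A (\<lambda>z. b (snd z))" if "reg (loc Y f) b" for b
    proof -
      obtain c n where "reg Y c" "\<And>y. y \<in> pts Y \<Longrightarrow> f y \<noteq> 0 \<Longrightarrow> b y = c y / f y ^ n"
        using \<open>reg (loc Y f) b\<close> unfolding reg_loc_iff by blast
      then show ?thesis
        by (intro reg_loc_fracI[of _ "\<lambda>z. c (snd z)" _ _ n] reg_prod_snd X Y) auto
    qed
    have "reg ?A (\<lambda>z. \<Sum>i<k. a i (fst z) * b i (snd z))"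
    proof (intro reg_sum reg_mult fA)
      fix i assume "i \<in> {..<k}"
      then have ab': "reg X (a i)" "reg (loc Y f) (b i)" using ab by auto
      show "reg ?A (\<lambda>z. a i (fst z))" by (intro reg_locI reg_prod_fst X Y ab')
      show "reg ?A (\<lambda>z. b i (snd z))" by (rule 1[OF ab'(2)])
    qed
    then show "reg ?A h"
      by (rule iffD1[OF reg_cong, rotated]) (auto simp: h)
  qed
qed

subsection \<open>Affine algebras\<close>

text \<open>
  The algebra is generated by the countably many coordinates of \<open>\<phi>\<close>, and every point of the
  zero locus of the relations between them comes from a point of \<open>X\<close>.
\<close>

definition affine_alg :: "'a fun_space \<Rightarrow> bool" where
  "affine_alg X \<longleftrightarrow> (\<exists>\<phi> :: 'a \<Rightarrow> nat \<Rightarrow> complex.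
     regs X = {restrict (\<lambda>x. peval p (\<phi> x)) (pts X) | p. True} \<and>
     (\<forall>z. (\<forall>p. (\<forall>x\<in>pts X. peval p (\<phi> x) = 0) \<longrightarrow> peval p z = 0) \<longrightarrow> z \<in> \<phi> ` pts X))"

lemma affine_alg_fun_alg:
  assumes "affine_alg X" shows "fun_alg X"
proof -
  obtain \<phi> :: "'a \<Rightarrow> nat \<Rightarrow> complex" where
    R: "regs X = {restrict (\<lambda>x. peval p (\<phi> x)) (pts X) | p. True}"
    using assms unfolding affine_alg_def by blast
  have reg: "reg X h \<longleftrightarrow> (\<exists>p. \<forall>x\<in>pts X. h x = peval p (\<phi> x))" for h
    unfolding reg_def R by (auto simp: restrict_def fun_eq_iff)
  show ?thesis
  proof (rule fun_algI)
    show "regs X \<subseteq> extensional (pts X)" unfolding R by auto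
    show "reg X (\<lambda>x. c)" for c
      unfolding reg by (rule exI[of _ "pconst c"]) (simp add: peval_simps)
    fix f g assume "reg X f" "reg X g"
    then obtain p q where "\<forall>x\<in>pts X. f x = peval p (\<phi> x)" "\<forall>x\<in>pts X. g x = peval q (\<phi> x)"
      unfolding reg by blast
    then show "reg X (\<lambda>x. f x + g x)" "reg X (\<lambda>x. f x * g x)"
      unfolding reg by (auto intro: exI[of _ "p + q"] exI[of _ "p * q"] simp: peval_simps)
  qed
qed

text \<open>\<open>S\<close> collects the polynomials that induce an element of \<open>F\<close> or
  zero on \<open>X\<close>. A common zero of \<open>S\<close> satisfies all relations between the
  coordinates, hence comes from a point of \<open>X\<close>, where some element of \<open>F\<close>
  is nonzero; so there is none and the Nullstellensatz applies.\<close>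

lemma affine_alg_unit:
  assumes X: "affine_alg X" and F: "\<And>f. f \<in> F \<Longrightarrow> reg X f"
    and nz: "\<And>x. x \<in> pts X \<Longrightarrow> \<exists>f\<in>F. f x \<noteq> 0"
  shows "\<exists>(k::nat) c f. (\<forall>j<k. reg X (c j) \<and> f j \<in> F) \<and> (\<forall>x\<in>pts X. (\<Sum>j<k. c j x * f j x) = 1)"
proof -
  obtain \<phi> :: "'a \<Rightarrow> nat \<Rightarrow> complex" where
    R: "regs X = {restrict (\<lambda>x. peval p (\<phi> x)) (pts X) | p. True}"
    and Z: "\<And>z. (\<And>p. (\<forall>x\<in>pts X. peval p (\<phi> x) = 0) \<Longrightarrow> peval p z = 0) \<Longrightarrow> z \<in> \<phi> ` pts X"
    using X unfolding affine_alg_def by blast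
  have reg: "reg X h \<longleftrightarrow> (\<exists>p. \<forall>x\<in>pts X. h x = peval p (\<phi> x))" for h
    unfolding reg_def R by (auto simp: restrict_def fun_eq_iff)
  define S where "S = {p. (\<exists>f\<in>F. \<forall>x\<in>pts X. peval p (\<phi> x) = f x) \<or> (\<forall>x\<in>pts X. peval p (\<phi> x) = 0)}"
  have "\<exists>p\<in>S. peval p z \<noteq> 0" for z
  proof (rule ccontr)
    assume neg: "\<not> ?thesis"
    then have "z \<in> \<phi> ` pts X" by (intro Z) (auto simp: S_def)
    then obtain x where x: "x \<in> pts X" "z = \<phi> x" by blast
    obtain f where f: "f \<in> F" "f x \<noteq> 0" using nz x by blast
    obtain p where p: "\<forall>x\<in>pts X. f x = peval p (\<phi> x)" using F[OF f(1)] reg by blast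
    then have "p \<in> S" using f unfolding S_def by (intro CollectI disjI1 bexI[of _ f]) auto
    then show False using neg p f x by auto
  qed
  then have "1 \<in> idl.span S" by (rule nullstellensatz)
  moreover have "\<exists>(k::nat) c f. (\<forall>j<k. reg X (c j) \<and> f j \<in> F) \<and>
      (\<forall>x\<in>pts X. (\<Sum>j<k. c j x * f j x) = peval p (\<phi> x))" if "p \<in> idl.span S" for p
    using that
  proof (induction rule: idl.span_induct_alt)
    case base
    show ?case by (rule exI[of _ 0]) (simp add: peval_phom)
  next
    case (step r p q)
    then obtain k :: nat and c f where cf: "\<forall>j<k. reg X (c j) \<and> f j \<in> F"
      "\<forall>x\<in>pts X. (\<Sum>j<k. c j x * f j x) = peval q (\<phi> x)" by blast
    from step(1) consider g where "g \<in> F" "\<forall>x\<in>pts X. peval p (\<phi> x) = g x"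
      | "\<forall>x\<in>pts X. peval p (\<phi> x) = 0" unfolding S_def by blast
    then show ?case
    proof cases
      case 1
      have "reg X (\<lambda>x. peval r (\<phi> x))" unfolding reg by blast
      then show ?thesis
        using cf 1 by (intro exI[of _ "Suc k"] exI[of _ "c(k := \<lambda>x. peval r (\<phi> x))"] exI[of _ "f(k := g)"])
          (auto simp: peval_simps less_Suc_eq)
    next
      case 2
      then show ?thesis
        using cf by (intro exI[of _ k] exI[of _ c] exI[of _ f]) (auto simp: peval_simps)
    qed
  qed
  ultimately obtain k :: nat and c f where "\<forall>j<k. reg X (c j) \<and> f j \<in> F"
    "\<forall>x\<in>pts X. (\<Sum>j<k. c j x * f j x) = peval 1 (\<phi> x)" by blast
  then show ?thesis by (intro exI[of _ k] exI[of _ c] exI[of _ f]) (simp add: peval_simps)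
qed

lemma phom_phom:
  assumes c: "chom c" shows "phom c x (phom pconst s p) = phom c (\<lambda>v. phom c x (s v)) p"
  by (rule pring_induct[of p UNIV, OF pring_UNIV])
     (simp_all add: phom_simps[OF c] phom_simps[OF chom_pconst])

lemma peval_prename: "peval (prename s p) x = peval p (\<lambda>v. x (s v))"
  unfolding peval_phom prename_phom phom_phom[OF chom_id] by (simp add: phom_pvar[OF chom_id])

lemma affine_alg_loc:
  assumes X: "affine_alg X" and f: "reg X f"
  shows "affine_alg (loc X f)"
proof -
  obtain \<phi> :: "'a \<Rightarrow> nat \<Rightarrow> complex" where
    R: "regs X = {restrict (\<lambda>x. peval p (\<phi> x)) (pts X) | p. True}"
    and Z: "\<And>z. (\<And>p. (\<forall>x\<in>pts X. peval p (\<phi> x) = 0) \<Longrightarrow> peval p z = 0) \<Longrightarrow> z \<in> \<phi> ` pts X"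
    using X unfolding affine_alg_def by blast
  have reg: "reg X h \<longleftrightarrow> (\<exists>p. \<forall>x\<in>pts X. h x = peval p (\<phi> x))" for h
    unfolding reg_def R by (auto simp: restrict_def fun_eq_iff)
  have FX: "fun_alg X" by (rule affine_alg_fun_alg[OF X])
  have L: "fun_alg (loc X f)" by (rule fun_alg_loc[OF FX f])
  obtain q where q: "\<And>x. x \<in> pts X \<Longrightarrow> f x = peval q (\<phi> x)" using f reg by blast
  \<comment> \<open>The trick of Rabinowitsch: \<open>1 / f\<close> becomes the coordinate of index
    0, and the coordinates of \<open>X\<close> move up by one.\<close>
  define \<psi> where "\<psi> x = case_nat (1 / f x) (\<phi> x)" for x
  have \<psi>0: "\<psi> x 0 = 1 / f x" for x by (simp add: \<psi>_def)
  have sh: "peval (prename Suc p) (\<psi> x) = peval p (\<phi> x)" for p x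
    by (simp add: peval_prename \<psi>_def)
  have regp: "reg (loc X f) (\<lambda>x. peval p (\<psi> x))" for p
  proof (induction p rule: pring_induct[OF pring_UNIV])
    case (1 c)
    then show ?case by (simp add: peval_simps reg_const[OF L])
  next
    case (2 v)
    have "reg X (\<lambda>x. \<phi> x w)" for w
      unfolding reg by (rule exI[of _ "pvar w"]) (simp add: peval_simps)
    then have "reg (loc X f) (\<lambda>x. \<psi> x v)"
      by (cases v) (simp_all add: \<psi>_def reg_loc_inverse[OF FX] reg_locI)
    then show ?case by (simp add: peval_simps)
  qed (simp_all add: peval_simps reg_add[OF L] reg_mult[OF L])
  have "regs (loc X f) = {restrict (\<lambda>x. peval p (\<psi> x)) (pts (loc X f)) | p. True}"
  proof (intro equalityI subsetI)
    fix h assume h: "h \<in> regs (loc X f)"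
    then obtain a n where "reg X a" and ha: "\<And>x. x \<in> pts X \<Longrightarrow> f x \<noteq> 0 \<Longrightarrow> h x = a x / f x ^ n"
      using regs_reg[OF L h] unfolding reg_loc_iff by blast
    then obtain p where p: "\<And>x. x \<in> pts X \<Longrightarrow> a x = peval p (\<phi> x)" using reg by blast
    have "h = restrict (\<lambda>x. peval (prename Suc p * pvar 0 ^ n) (\<psi> x)) (pts (loc X f))"
      using fun_algD(1)[OF L h]
      by (intro extensionalityI[of h "pts (loc X f)"])
         (auto simp: ha peval_simps sh p \<psi>0 power_divide)
    then show "h \<in> {restrict (\<lambda>x. peval p (\<psi> x)) (pts (loc X f)) | p. True}" by blast
  qed (use regp in \<open>auto simp: reg_def\<close>)
  moreover have "z \<in> \<psi> ` pts (loc X f)"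
    if z: "\<forall>p. (\<forall>x\<in>pts (loc X f). peval p (\<psi> x) = 0) \<longrightarrow> peval p z = 0" for z
  proof -
    have "(\<lambda>i. z (Suc i)) \<in> \<phi> ` pts X"
    proof (rule Z)
      fix p assume "\<forall>x\<in>pts X. peval p (\<phi> x) = 0"
      then show "peval p (\<lambda>i. z (Suc i)) = 0"
        using z[rule_format, of "prename Suc p"] by (simp add: sh) (simp add: peval_prename)
    qed
    then obtain x where x: "x \<in> pts X" "\<phi> x = (\<lambda>i. z (Suc i))" by force
    \<comment> \<open>The relation that the new coordinate times \<open>f\<close> is 1 shows that
      \<open>f\<close> does not vanish at the point found, and it determines the coordinate of index
      0.\<close>
    have "peval (pvar 0 * prename Suc q - 1) z = 0"
      by (rule z[rule_format]) (auto simp: peval_simps sh \<psi>0 q[symmetric])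
    then have zf: "z 0 * f x = 1" by (simp add: peval_simps peval_prename q[OF x(1)] x(2))
    then have "f x \<noteq> 0" by auto
    moreover have "\<psi> x = z"
      using zf \<open>f x \<noteq> 0\<close> by (auto simp: \<psi>_def x(2) fun_eq_iff field_simps split: nat.split)
    ultimately show ?thesis using x(1) by force
  qed
  ultimately show ?thesis unfolding affine_alg_def by blast
qed

text \<open>The denominators \<open>b\<close> for which \<open>b * h\<close> is regular have no
  common zero where \<open>f\<close> is nonzero, so a combination of them is 1; multiplying it by
  \<open>h\<close> exhibits \<open>h\<close> as regular.\<close>

lemma locally_fraction_reg:
  assumes X: "affine_alg X" and f: "reg X f"
    and h: "\<And>x. x \<in> pts X \<Longrightarrow> f x \<noteq> 0 \<Longrightarrow> \<exists>a b. reg X a \<and> reg X b \<and> b x \<noteq> 0 \<and>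
              (\<forall>y\<in>pts X. f y \<noteq> 0 \<longrightarrow> b y \<noteq> 0 \<longrightarrow> h y = a y / b y)"
  shows "reg (loc X f) h"
proof -
  note FX = affine_alg_fun_alg[OF X]
  note L = fun_alg_loc[OF FX f]
  define F where "F = {b. reg X b \<and> (\<exists>a. reg X a \<and> (\<forall>y\<in>pts X. f y \<noteq> 0 \<longrightarrow> b y * h y = a y))}"
  have F1: "reg (loc X f) b" if "b \<in> F" for b using that by (auto simp: F_def reg_locI)
  have F2: "\<exists>b\<in>F. b x \<noteq> 0" if x: "x \<in> pts (loc X f)" for x
    proof -
      obtain a b where ab: "reg X a" "reg X b" "b x \<noteq> 0"
        "\<And>y. y \<in> pts X \<Longrightarrow> f y \<noteq> 0 \<Longrightarrow> b y \<noteq> 0 \<Longrightarrow> h y = a y / b y"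
      proof -
        have "x \<in> pts X" "f x \<noteq> 0" using x by simp_all
        from h[OF this] show ?thesis by (elim exE conjE) (rule that, auto)
      qed
      \<comment> \<open>Where \<open>b\<close> vanishes, nothing is known about \<open>a\<close>.
        Squaring helps: \<open>b * b * h = b * a\<close> holds there too, both sides being
        zero.\<close>
      have "(\<lambda>y. b y * b y) \<in> F"
        unfolding F_def
      proof (intro CollectI conjI exI[of _ "\<lambda>y. b y * a y"] reg_mult FX ab(1,2) ballI impI)
        fix y assume "y \<in> pts X" "f y \<noteq> 0"
        then show "b y * b y * h y = b y * a y" using ab(4)[of y] by (cases "b y = 0") auto
      qed
      then show ?thesis using ab(3) by (intro bexI[of _ "\<lambda>y. b y * b y"]) simp_all
    qed
  obtain k :: nat and c g where c: "\<And>j. j < k \<Longrightarrow> reg (loc X f) (c j)" and g: "\<And>j. j < k \<Longrightarrow> g j \<in> F"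
    and one: "\<And>x. x \<in> pts (loc X f) \<Longrightarrow> (\<Sum>j<k. c j x * g j x) = 1"
    using affine_alg_unit[OF affine_alg_loc[OF X f] F1 F2] by blast
  have "\<forall>j<k. \<exists>a. reg X a \<and> (\<forall>y\<in>pts X. f y \<noteq> 0 \<longrightarrow> g j y * h y = a y)"
    using g by (auto simp: F_def)
  then obtain a where a: "\<And>j. j < k \<Longrightarrow> reg X (a j)"
    and ah: "\<And>j y. j < k \<Longrightarrow> y \<in> pts X \<Longrightarrow> f y \<noteq> 0 \<Longrightarrow> g j y * h y = a j y" by metis
  have "reg (loc X f) (\<lambda>x. \<Sum>j<k. c j x * a j x)"
    by (intro reg_sum reg_mult L c reg_locI a) auto
  moreover have "(\<Sum>j<k. c j x * a j x) = h x" if "x \<in> pts (loc X f)" for x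
  proof -
    have "(\<Sum>j<k. c j x * a j x) = (\<Sum>j<k. c j x * g j x) * h x"
      using that unfolding sum_distrib_right by (intro sum.cong) (auto simp: ah[symmetric])
    then show ?thesis using one[OF that] by simp
  qed
  ultimately show ?thesis by (rule iffD1[OF reg_cong, rotated])
qed

lemma affine_alg_prod:
  assumes X: "affine_alg X" and Y: "affine_alg Y"
  shows "affine_alg (prod_space X Y)"
proof -
  obtain \<phi> :: "'a \<Rightarrow> nat \<Rightarrow> complex" where
    RX: "regs X = {restrict (\<lambda>x. peval p (\<phi> x)) (pts X) | p. True}"
    and ZX: "\<And>z. (\<And>p. (\<forall>x\<in>pts X. peval p (\<phi> x) = 0) \<Longrightarrow> peval p z = 0) \<Longrightarrow> z \<in> \<phi> ` pts X"
    using X unfolding affine_alg_def by blast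
  obtain \<psi> :: "'b \<Rightarrow> nat \<Rightarrow> complex" where
    RY: "regs Y = {restrict (\<lambda>x. peval p (\<psi> x)) (pts Y) | p. True}"
    and ZY: "\<And>z. (\<And>p. (\<forall>x\<in>pts Y. peval p (\<psi> x) = 0) \<Longrightarrow> peval p z = 0) \<Longrightarrow> z \<in> \<psi> ` pts Y"
    using Y unfolding affine_alg_def by blast
  have regX: "reg X h \<longleftrightarrow> (\<exists>p. \<forall>x\<in>pts X. h x = peval p (\<phi> x))" for h
    unfolding reg_def RX by (auto simp: restrict_def fun_eq_iff)
  have regY: "reg Y h \<longleftrightarrow> (\<exists>p. \<forall>x\<in>pts Y. h x = peval p (\<psi> x))" for h
    unfolding reg_def RY by (auto simp: restrict_def fun_eq_iff)
  note F = affine_alg_fun_alg[OF X] affine_alg_fun_alg[OF Y]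
  note P = fun_alg_prod[OF F]
  \<comment> \<open>Coordinates of \<open>X\<close> sit at the even indices, those of
    \<open>Y\<close> at the odd ones.\<close>
  define \<theta> :: "'a \<times> 'b \<Rightarrow> nat \<Rightarrow> complex" where
    "\<theta> z i = (if even i then \<phi> (fst z) (i div 2) else \<psi> (snd z) (i div 2))" for z i
  have ev: "peval (prename (\<lambda>i. 2 * i) p) (\<theta> z) = peval p (\<phi> (fst z))"
    and od: "peval (prename (\<lambda>i. 2 * i + 1) p) (\<theta> z) = peval p (\<psi> (snd z))" for p z
    by (simp_all add: peval_prename \<theta>_def)
  have regp: "reg (prod_space X Y) (\<lambda>z. peval p (\<theta> z))" for p
  proof (induction p rule: pring_induct[OF pring_UNIV])
    case (1 c)
    then show ?case by (simp add: peval_simps reg_const[OF P])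
  next
    case (2 v)
    have "reg X (\<lambda>x. \<phi> x w)" "reg Y (\<lambda>x. \<psi> x w)" for w
      unfolding regX regY by (rule exI[of _ "pvar w"], simp add: peval_simps)+
    then have "reg (prod_space X Y) (\<lambda>z. \<phi> (fst z) (v div 2))"
      "reg (prod_space X Y) (\<lambda>z. \<psi> (snd z) (v div 2))"
      using reg_prod_fst[OF F, of "\<lambda>x. \<phi> x (v div 2)"] reg_prod_snd[OF F, of "\<lambda>x. \<psi> x (v div 2)"]
      by simp_all
    then have "reg (prod_space X Y) (\<lambda>z. \<theta> z v)" by (cases "even v") (simp_all add: \<theta>_def)
    then show ?case by (simp add: peval_simps)
  qed (simp_all add: peval_simps reg_add[OF P] reg_mult[OF P])
  have "regs (prod_space X Y) = {restrict (\<lambda>z. peval p (\<theta> z)) (pts (prod_space X Y)) | p. True}"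
  proof (intro equalityI subsetI)
    fix h assume h: "h \<in> regs (prod_space X Y)"
    obtain k :: nat and a b where ab: "\<forall>i<k. reg X (a i) \<and> reg Y (b i)"
      and hab: "\<And>x y. x \<in> pts X \<Longrightarrow> y \<in> pts Y \<Longrightarrow> h (x, y) = (\<Sum>i<k. a i x * b i y)"
      using regs_reg[OF P h] unfolding reg_prod_iff[OF F] by blast
    from ab obtain p q where pq: "\<And>i x. i < k \<Longrightarrow> x \<in> pts X \<Longrightarrow> a i x = peval (p i) (\<phi> x)"
      "\<And>i x. i < k \<Longrightarrow> x \<in> pts Y \<Longrightarrow> b i x = peval (q i) (\<psi> x)"
      unfolding regX regY by metis
    have "h = restrict (\<lambda>z. peval (\<Sum>i<k. prename (\<lambda>i. 2 * i) (p i) * prename (\<lambda>i. 2 * i + 1) (q i)) (\<theta> z))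
        (pts (prod_space X Y))"
      using fun_algD(1)[OF P h]
      by (intro extensionalityI[of h "pts (prod_space X Y)"])
         (auto simp: hab peval_simps ev od[simplified] pq)
    then show "h \<in> {restrict (\<lambda>z. peval p (\<theta> z)) (pts (prod_space X Y)) | p. True}" by blast
  qed (use regp in \<open>auto simp: reg_def\<close>)
  moreover have "z \<in> \<theta> ` pts (prod_space X Y)"
    if z: "\<forall>p. (\<forall>x\<in>pts (prod_space X Y). peval p (\<theta> x) = 0) \<longrightarrow> peval p z = 0" for z
  proof -
    have "(\<lambda>i. z (2 * i)) \<in> \<phi> ` pts X"
    proof (rule ZX)
      fix p assume "\<forall>x\<in>pts X. peval p (\<phi> x) = 0"
      then show "peval p (\<lambda>i. z (2 * i)) = 0"
        using z[rule_format, of "prename (\<lambda>i. 2 * i) p"] by (auto simp: ev) (simp add: peval_prename)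
    qed
    then obtain x where x: "x \<in> pts X" "\<phi> x = (\<lambda>i. z (2 * i))" by force
    have "(\<lambda>i. z (2 * i + 1)) \<in> \<psi> ` pts Y"
    proof (rule ZY)
      fix p assume "\<forall>x\<in>pts Y. peval p (\<psi> x) = 0"
      then show "peval p (\<lambda>i. z (2 * i + 1)) = 0"
        using z[rule_format, of "prename (\<lambda>i. 2 * i + 1) p"] unfolding od
        by (auto simp del: Suc_eq_plus1) (simp add: peval_prename)
    qed
    then obtain y where y: "y \<in> pts Y" "\<psi> y = (\<lambda>i. z (2 * i + 1))" by force
    have "\<theta> (x, y) = z"
      by (rule ext) (simp add: \<theta>_def x y)
    then show ?thesis using x(1) y(1) by force
  qed
  ultimately show ?thesis unfolding affine_alg_def by blast
qed

lemma affine_variety_affine_alg: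
  assumes "affine_variety X" shows "affine_alg X"
proof -
  obtain n Z \<phi> where Z: "zariski_closed (affine_space n) Z" and bij: "bij_betw \<phi> (pts X) Z"
    and R: "regs X = {(\<lambda>x\<in>pts X. h (\<phi> x)) | h. h \<in> regs (affine_space n)}"
    using assms unfolding affine_variety_def by blast
  obtain F where F: "F \<subseteq> regs (affine_space n)" "Z = {x \<in> carrier_vec n. \<forall>f\<in>F. f x = 0}"
    using Z unfolding zariski_closed_def by (auto simp: affine_space_def)
  have \<phi>: "\<phi> x \<in> Z" "\<phi> x \<in> carrier_vec n" if "x \<in> pts X" for x
    using bij that F(2) by (auto simp: bij_betw_def)
  \<comment> \<open>The finitely many coordinates are padded by zeros. The padding is enforced by
    the relations, because the variables of index at least \<open>n\<close> vanish on all of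
    \<open>X\<close>.\<close>
  define \<psi> where "\<psi> x i = (if i < n then \<phi> x $ i else 0)" for x i
  have p1: "peval p (\<lambda>i. \<phi> x $ i) = peval p (\<psi> x)" if "pvars p \<subseteq> {..<n}" for p x
    unfolding peval_phom using that by (intro phom_cong[OF chom_id, of "{..<n}"]) (auto simp: \<psi>_def pring_def)
  have "regs X = {restrict (\<lambda>x. peval p (\<psi> x)) (pts X) | p. True}"
  proof (intro equalityI subsetI)
    fix h assume "h \<in> regs X"
    then obtain p where "pvars p \<subseteq> {..<n}"
      "h = (\<lambda>x\<in>pts X. (\<lambda>w\<in>carrier_vec n. peval p (\<lambda>i. w $ i)) (\<phi> x))"
      unfolding R by (auto simp: affine_space_def)
    then have "h = restrict (\<lambda>x. peval p (\<psi> x)) (pts X)"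
      by (auto simp: p1 \<phi> intro!: restrict_ext)
    then show "h \<in> {restrict (\<lambda>x. peval p (\<psi> x)) (pts X) | p. True}" by blast
  next
    fix h assume "h \<in> {restrict (\<lambda>x. peval p (\<psi> x)) (pts X) | p. True}"
    then obtain p where h: "h = restrict (\<lambda>x. peval p (\<psi> x)) (pts X)" by blast
    \<comment> \<open>The padded coordinates are zero, so replacing the surplus variables by 0 does
      not change the induced function.\<close>
    define q where "q = phom pconst (\<lambda>i. if i < n then pvar i else 0) p"
    have q: "pvars q \<subseteq> {..<n}"
    proof -
      have "q \<in> pring {..<n}" unfolding q_def by (rule phom_in_pring[OF pring_UNIV]) auto
      then show ?thesis by (simp add: pring_def)
    qed
    have "peval q (\<psi> x) = peval p (\<psi> x)" for x
      unfolding q_def peval_phom phom_phom[OF chom_id]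
      by (rule phom_cong[OF chom_id, of UNIV]) (auto simp: \<psi>_def phom_pvar[OF chom_id])
    then have "h = (\<lambda>x\<in>pts X. (\<lambda>w\<in>carrier_vec n. peval q (\<lambda>i. w $ i)) (\<phi> x))"
      unfolding h by (auto simp: p1[OF q] \<phi> intro!: restrict_ext)
    moreover have "(\<lambda>w\<in>carrier_vec n. peval q (\<lambda>i. w $ i)) \<in> regs (affine_space n)"
      using q by (auto simp: affine_space_def)
    ultimately show "h \<in> regs X" unfolding R by blast
  qed
  moreover have "z \<in> \<psi> ` pts X"
    if z: "\<forall>p. (\<forall>x\<in>pts X. peval p (\<psi> x) = 0) \<longrightarrow> peval p z = 0" for z
  proof -
    have z0: "z i = 0" if "\<not> i < n" for i
      using z[rule_format, of "pvar i"] that by (simp add: peval_simps \<psi>_def)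
    have "vec n z \<in> Z"
      unfolding F(2)
    proof (intro CollectI conjI ballI)
      fix f assume f: "f \<in> F"
      then obtain p where p: "pvars p \<subseteq> {..<n}" "f = (\<lambda>w\<in>carrier_vec n. peval p (\<lambda>i. w $ i))"
        using F(1) by (auto simp: affine_space_def)
      have "peval p (\<psi> x) = 0" if "x \<in> pts X" for x
        using \<phi>[OF that] f unfolding p1[OF p(1), symmetric] F(2) p(2) by auto
      then have "peval p z = 0" using z by blast
      also have "peval p z = peval p (\<lambda>i. vec n z $ i)"
        unfolding peval_phom using p(1)
        by (intro phom_cong[OF chom_id, of "{..<n}"]) (auto simp: pring_def)
      finally show "f (vec n z) = 0" by (simp add: p(2))
    qed simp
    then obtain x where x: "x \<in> pts X" "\<phi> x = vec n z" using bij by (auto simp: bij_betw_def)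
    have "\<psi> x = z" by (rule ext) (simp add: \<psi>_def x(2) z0)
    then show ?thesis using x(1) by blast
  qed
  ultimately show ?thesis unfolding affine_alg_def by blast
qed

section \<open>Jets of an algebra of functions\<close>

definition idl_eq :: "'r::comm_ring_1 set \<Rightarrow> 'r \<Rightarrow> 'r \<Rightarrow> bool" where
  "idl_eq S p q \<longleftrightarrow> p - q \<in> idl.span S"

lemma idl_eq_refl [simp]: "idl_eq S p p"
  by (simp add: idl_eq_def idl.span_zero)

lemma idl_eq_sym: "idl_eq S p q \<Longrightarrow> idl_eq S q p"
  unfolding idl_eq_def using idl.span_neg by fastforce

lemma idl_eq_trans [trans]: "idl_eq S p q \<Longrightarrow> idl_eq S q r \<Longrightarrow> idl_eq S p r"
  unfolding idl_eq_def using idl.span_add[of "p - q" S "q - r"] by simp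

lemma idl_eq_add: "idl_eq S p q \<Longrightarrow> idl_eq S p' q' \<Longrightarrow> idl_eq S (p + p') (q + q')"
  unfolding idl_eq_def using idl.span_add[of "p - q" S "p' - q'"] by (simp add: algebra_simps)

lemma idl_eq_uminus: "idl_eq S p q \<Longrightarrow> idl_eq S (- p) (- q)"
  unfolding idl_eq_def using idl.span_neg[of "p - q" S] by simp

lemma idl_eq_diff: "idl_eq S p q \<Longrightarrow> idl_eq S p' q' \<Longrightarrow> idl_eq S (p - p') (q - q')"
  using idl_eq_add[of S p q "- p'" "- q'"] idl_eq_uminus[of S p' q'] by simp

lemma idl_eq_mult:
  assumes "idl_eq S p q" "idl_eq S p' q'" shows "idl_eq S (p * p') (q * q')"
proof -
  have "p * p' - q * q' = p' * (p - q) + q * (p' - q')" by (simp add: algebra_simps)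
  then show ?thesis using assms unfolding idl_eq_def by (metis idl.span_add idl_mult_left)
qed

lemma idl_eq_power: "idl_eq S p q \<Longrightarrow> idl_eq S (p ^ n) (q ^ n)"
  by (induction n) (simp_all add: idl_eq_mult)

lemma idl_eq_sum: "(\<And>i. i \<in> A \<Longrightarrow> idl_eq S (f i) (g i)) \<Longrightarrow> idl_eq S (sum f A) (sum g A)"
  by (induction A rule: infinite_finite_induct) (simp_all add: idl_eq_add)

lemma idl_eq_mono: "S \<subseteq> T \<Longrightarrow> idl_eq S p q \<Longrightarrow> idl_eq T p q"
  unfolding idl_eq_def using idl.span_mono by blast

lemma idl_eq_0: "idl_eq S p 0 \<longleftrightarrow> p \<in> idl.span S"
  by (simp add: idl_eq_def)

lemma idl_eq_span: "idl_eq S p q \<Longrightarrow> p \<in> idl.span S \<longleftrightarrow> q \<in> idl.span S"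
  using idl_eq_trans[of S p q 0] idl_eq_trans[of S q p 0] idl_eq_sym[of S p q] by (auto simp: idl_eq_0)

definition jrel :: "enat \<Rightarrow> 'a fun_space \<Rightarrow> 'a jet_var mpoly set" where
  "jrel m X = {(jet_derivation ^^ k) f | k f. enat k \<le> m \<and> f \<in> alg_relations X}"

text \<open>The ideal is formed in the polynomials in all jet variables, so that no membership
  conditions accompany congruences. That it induces the correct ideal on \<open>jpoly m X\<close> is
  shown in \<open>jet_ideal_eq\<close>.\<close>

abbreviation jid :: "enat \<Rightarrow> 'a fun_space \<Rightarrow> 'a jet_var mpoly set" where
  "jid m X \<equiv> idl.span (jrel m X)"

abbreviation jeq :: "enat \<Rightarrow> 'a fun_space \<Rightarrow> 'a jet_var mpoly \<Rightarrow> 'a jet_var mpoly \<Rightarrow> bool" where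
  "jeq m X \<equiv> idl_eq (jrel m X)"

definition jpoly :: "enat \<Rightarrow> 'a fun_space \<Rightarrow> 'a jet_var mpoly set" where
  "jpoly m X = pring (regs X \<times> {i. enat i \<le> m})"

text \<open>On representatives, this is the map of jet rings induced by an algebra homomorphism
  \<sigma>.\<close>

definition jren :: "(('a \<Rightarrow> complex) \<Rightarrow> ('b \<Rightarrow> complex)) \<Rightarrow> 'a jet_var mpoly \<Rightarrow> 'b jet_var mpoly" where
  "jren \<sigma> = prename (\<lambda>(r, i). (\<sigma> r, i))"

lemma jren_simps:
  "jren \<sigma> (p + q) = jren \<sigma> p + jren \<sigma> q" "jren \<sigma> (p * q) = jren \<sigma> p * jren \<sigma> q"
  "jren \<sigma> (pconst c) = pconst c" "jren \<sigma> 1 = 1" "jren \<sigma> (- p) = - jren \<sigma> p"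
  "jren \<sigma> (p - q) = jren \<sigma> p - jren \<sigma> q" "jren \<sigma> (p ^ k) = jren \<sigma> p ^ k"
  "jren \<sigma> (pvar (r, i)) = pvar (\<sigma> r, i)" "jren \<sigma> 0 = 0"
  "jren \<sigma> (sum g A) = (\<Sum>a\<in>A. jren \<sigma> (g a))"
  by (simp_all add: jren_def prename_simps) (simp add: prename_phom)

lemma jren_D: "jren \<sigma> (jet_derivation p) = jet_derivation (jren \<sigma> p)"
  unfolding jren_def prename_phom
  by (rule phom_der_commute[where V = UNIV, OF chom_pconst is_der_jet is_der_jet])
     (auto simp: phom_pvar[OF chom_pconst])

lemma jren_Dk: "jren \<sigma> ((jet_derivation ^^ k) p) = (jet_derivation ^^ k) (jren \<sigma> p)"
  by (induction k) (simp_all add: jren_D)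

lemma jren_jren: "jren \<sigma> (jren \<tau> p) = jren (\<lambda>r. \<sigma> (\<tau> r)) p"
  by (simp add: jren_def prename_prename case_prod_unfold)

lemma jren_cong:
  "(\<And>r. r \<in> regs X \<Longrightarrow> \<sigma> r = \<tau> r) \<Longrightarrow> p \<in> jpoly m X \<Longrightarrow> jren \<sigma> p = jren \<tau> p"
  unfolding jren_def jpoly_def by (rule prename_cong) auto

lemma jren_id: "(\<And>r. r \<in> regs X \<Longrightarrow> \<sigma> r = r) \<Longrightarrow> p \<in> jpoly m X \<Longrightarrow> jren \<sigma> p = p"
  unfolding jren_def jpoly_def by (rule prename_id) auto

lemmas jpoly_intros = pring_intros[where V = "regs X \<times> {i. enat i \<le> m}"
    for X :: "'a fun_space" and m, folded jpoly_def]

lemma jpoly_const [simp]: "pconst c \<in> jpoly m X" "1 \<in> jpoly m X" "0 \<in> jpoly m X"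
  by (simp_all add: jpoly_def)

lemma jpoly_pvar [simp]: "pvar (r, i) \<in> jpoly m X \<longleftrightarrow> r \<in> regs X \<and> enat i \<le> m"
  by (simp add: jpoly_def)

lemma jpoly_mono: "regs X \<subseteq> regs Y \<Longrightarrow> m \<le> k \<Longrightarrow> p \<in> jpoly m X \<Longrightarrow> p \<in> jpoly k Y"
  unfolding jpoly_def by (rule pring_mono) (auto intro: order_trans)

lemma jpoly_induct [consumes 1, case_names const var add mult]:
  assumes "p \<in> jpoly m X"
    and "\<And>c. P (pconst c)" "\<And>r i. r \<in> regs X \<Longrightarrow> enat i \<le> m \<Longrightarrow> P (pvar (r, i))"
    and "\<And>p q. p \<in> jpoly m X \<Longrightarrow> q \<in> jpoly m X \<Longrightarrow> P p \<Longrightarrow> P q \<Longrightarrow> P (p + q)"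
    and "\<And>p q. p \<in> jpoly m X \<Longrightarrow> q \<in> jpoly m X \<Longrightarrow> P p \<Longrightarrow> P q \<Longrightarrow> P (p * q)"
  shows "P p"
  using assms(1) unfolding jpoly_def
  by (rule pring_induct) (use assms(2-) in \<open>auto simp: jpoly_def\<close>)

lemma jpoly_jren:
  "p \<in> jpoly m X \<Longrightarrow> (\<And>r. r \<in> regs X \<Longrightarrow> \<sigma> r \<in> regs Y) \<Longrightarrow> jren \<sigma> p \<in> jpoly m Y"
  by (induction p rule: jpoly_induct) (auto simp: jren_simps intro: jpoly_intros)

lemma jpoly_D: "p \<in> jpoly m X \<Longrightarrow> jet_derivation p \<in> jpoly (eSuc m) X"
proof (induction p rule: jpoly_induct)
  case (add p q)
  then show ?case by (auto simp: is_derD[OF is_der_jet] intro: jpoly_intros)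
next
  case (mult p q)
  then have "p \<in> jpoly (eSuc m) X" "q \<in> jpoly (eSuc m) X"
    by (auto intro: jpoly_mono[OF order_refl ile_eSuc])
  with mult show ?case by (auto simp: is_derD[OF is_der_jet] intro: jpoly_intros)
qed (auto simp flip: eSuc_enat)

lemma jrel_mono: "m \<le> k \<Longrightarrow> jrel m X \<subseteq> jrel k X"
  unfolding jrel_def using order_trans by blast

text \<open>The derivative of a relation of order \<open>k\<close> has order \<open>k + 1\<close>.
  As \<open>eSuc \<infinity> = \<infinity>\<close>, the ideal of the arc space is stable under the
  derivation.\<close>

lemma jid_D:
  assumes "p \<in> jid m X" shows "jet_derivation p \<in> jid (eSuc m) X"
proof (rule is_der_span[OF is_der_jet _ _ assms])
  show "jrel m X \<subseteq> jrel (eSuc m) X" by (rule jrel_mono[OF ile_eSuc])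
  show "jet_derivation ` jrel m X \<subseteq> jid (eSuc m) X"
  proof safe
    fix p assume "p \<in> jrel m X"
    then obtain k f where "p = (jet_derivation ^^ k) f" "enat k \<le> m" "f \<in> alg_relations X"
      by (auto simp: jrel_def)
    then have "jet_derivation p = (jet_derivation ^^ Suc k) f" "enat (Suc k) \<le> eSuc m"
      by (simp_all flip: eSuc_enat)
    with \<open>f \<in> alg_relations X\<close> have "jet_derivation p \<in> jrel (eSuc m) X"
      unfolding jrel_def by blast
    then show "jet_derivation p \<in> jid (eSuc m) X" by (rule idl.span_base)
  qed
qed

lemma jeq_D: "jeq m X p q \<Longrightarrow> jeq (eSuc m) X (jet_derivation p) (jet_derivation q)"
  unfolding idl_eq_def using jid_D[of "p - q"] by (simp add: is_derD[OF is_der_jet])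

lemma jeq_mono: "m \<le> k \<Longrightarrow> jeq m X p q \<Longrightarrow> jeq k X p q"
  by (rule idl_eq_mono[OF jrel_mono])

lemma alg_relations_jrel: "r \<in> alg_relations X \<Longrightarrow> r \<in> jrel m X"
  unfolding jrel_def by (intro CollectI exI[of _ "0::nat"] exI[of _ r]) (simp add: zero_enat_def[symmetric])

lemma alg_relations_jpoly:
  assumes "fun_alg X" "r \<in> alg_relations X" shows "r \<in> jpoly 0 X"
  using assms(2) fun_algD[OF assms(1)]
  by (auto simp: alg_relations_def zero_enat_def intro!: jpoly_intros)

lemma jrel_jpoly:
  assumes "fun_alg X" "p \<in> jrel m X" shows "p \<in> jpoly m X"
proof -
  obtain k f where k: "p = (jet_derivation ^^ k) f" "enat k \<le> m" "f \<in> alg_relations X"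
    using assms(2) by (auto simp: jrel_def)
  have "(jet_derivation ^^ k) f \<in> jpoly (enat k) X" for k
    by (induction k)
       (use jpoly_D alg_relations_jpoly[OF assms(1) k(3)] in \<open>auto simp: zero_enat_def simp flip: eSuc_enat\<close>)
  then show ?thesis using k jpoly_mono[OF order_refl k(2)] by blast
qed

section \<open>Functoriality of jets in the algebra of functions\<close>

definition fun_alg_hom :: "'a fun_space \<Rightarrow> 'b fun_space \<Rightarrow> (('a \<Rightarrow> complex) \<Rightarrow> ('b \<Rightarrow> complex)) \<Rightarrow> bool" where
  "fun_alg_hom X Y \<sigma> \<longleftrightarrow> (\<forall>f\<in>regs X. \<sigma> f \<in> regs Y) \<and> (\<forall>c. \<sigma> (cfun (pts X) c) = cfun (pts Y) c) \<and>
     (\<forall>f\<in>regs X. \<forall>g\<in>regs X. \<sigma> (addf (pts X) f g) = addf (pts Y) (\<sigma> f) (\<sigma> g) \<and>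
        \<sigma> (mulf (pts X) f g) = mulf (pts Y) (\<sigma> f) (\<sigma> g))"

lemma jren_alg_relations:
  assumes "fun_alg_hom X Y \<sigma>" "p \<in> alg_relations X" shows "jren \<sigma> p \<in> alg_relations Y"
proof -
  note s = assms(1)[unfolded fun_alg_hom_def]
  from assms(2) consider c where "p = pvar (cfun (pts X) c, 0) - pconst c"
    | f g where "f \<in> regs X" "g \<in> regs X" "p = pvar (addf (pts X) f g, 0) - (pvar (f, 0) + pvar (g, 0))"
    | f g where "f \<in> regs X" "g \<in> regs X" "p = pvar (mulf (pts X) f g, 0) - pvar (f, 0) * pvar (g, 0)"
    unfolding alg_relations_def by blast
  then show ?thesis
  proof cases
    case (1 c)
    then have "jren \<sigma> p = pvar (cfun (pts Y) c, 0) - pconst c" using s by (simp add: jren_simps)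
    then show ?thesis unfolding alg_relations_def by blast
  next
    case (2 f g)
    then have "jren \<sigma> p = pvar (addf (pts Y) (\<sigma> f) (\<sigma> g), 0) - (pvar (\<sigma> f, 0) + pvar (\<sigma> g, 0))"
      "\<sigma> f \<in> regs Y" "\<sigma> g \<in> regs Y" using s by (simp_all add: jren_simps)
    then show ?thesis unfolding alg_relations_def by blast
  next
    case (3 f g)
    then have "jren \<sigma> p = pvar (mulf (pts Y) (\<sigma> f) (\<sigma> g), 0) - pvar (\<sigma> f, 0) * pvar (\<sigma> g, 0)"
      "\<sigma> f \<in> regs Y" "\<sigma> g \<in> regs Y" using s by (simp_all add: jren_simps)
    then show ?thesis unfolding alg_relations_def by blast
  qed
qed

lemma jren_jid:
  assumes s: "fun_alg_hom X Y \<sigma>" and "p \<in> jid m X" shows "jren \<sigma> p \<in> jid m Y"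
  using assms(2)
proof (induction rule: idl.span_induct_alt)
  case base
  then show ?case by (simp add: jren_simps idl.span_zero)
next
  case (step c x y)
  then obtain k f where "x = (jet_derivation ^^ k) f" "enat k \<le> m" "f \<in> alg_relations X"
    by (auto simp: jrel_def)
  then have "jren \<sigma> x \<in> jrel m Y"
    using jren_alg_relations[OF s] unfolding jrel_def by (auto simp: jren_Dk)
  then show ?case
    using step(2) by (auto simp: jren_simps intro!: idl.span_add idl_mult_left intro: idl.span_base)
qed

lemma jren_jeq: "fun_alg_hom X Y \<sigma> \<Longrightarrow> jeq m X p q \<Longrightarrow> jeq m Y (jren \<sigma> p) (jren \<sigma> q)"
  unfolding idl_eq_def using jren_jid[of X Y \<sigma> "p - q"] by (simp add: jren_simps)

subsection \<open>Calculus of order zero\<close>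

text \<open>Restricting to \<open>pts X\<close> makes the variable depend only on the values there,
  so functions can be written as lambda terms on the whole type.\<close>

definition jfun :: "'a fun_space \<Rightarrow> ('a \<Rightarrow> complex) \<Rightarrow> 'a jet_var mpoly" where
  "jfun X f = pvar (restrict f (pts X), 0)"

lemma jfun_jpoly: "reg X f \<Longrightarrow> jfun X f \<in> jpoly m X"
  by (simp add: jfun_def reg_def flip: zero_enat_def)

lemma jfun_cong: "(\<And>x. x \<in> pts X \<Longrightarrow> f x = g x) \<Longrightarrow> jfun X f = jfun X g"
  by (simp add: jfun_def cong: restrict_cong)

lemma jfun_regs: "fun_alg X \<Longrightarrow> f \<in> regs X \<Longrightarrow> jfun X f = pvar (f, 0)"
  by (simp add: jfun_def extensional_restrict fun_algD)

lemma jeqI_rel: "p - q \<in> alg_relations X \<Longrightarrow> jeq m X p q"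
  unfolding idl_eq_def by (intro idl.span_base alg_relations_jrel)

lemma jfun_const: "jeq m X (jfun X (\<lambda>x. c)) (pconst c)"
  by (rule jeqI_rel) (auto simp: alg_relations_def jfun_def cfun_def)

lemma jfun_add:
  assumes "reg X f" "reg X g" shows "jeq m X (jfun X (\<lambda>x. f x + g x)) (jfun X f + jfun X g)"
proof (rule jeqI_rel)
  have "restrict (\<lambda>x. f x + g x) (pts X) = addf (pts X) (restrict f (pts X)) (restrict g (pts X))"
    by (auto simp: addf_def)
  then show "jfun X (\<lambda>x. f x + g x) - (jfun X f + jfun X g) \<in> alg_relations X"
    using assms unfolding alg_relations_def jfun_def reg_def by auto
qed

lemma jfun_mult:
  assumes "reg X f" "reg X g" shows "jeq m X (jfun X (\<lambda>x. f x * g x)) (jfun X f * jfun X g)"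
proof (rule jeqI_rel)
  have "restrict (\<lambda>x. f x * g x) (pts X) = mulf (pts X) (restrict f (pts X)) (restrict g (pts X))"
    by (auto simp: mulf_def)
  then show "jfun X (\<lambda>x. f x * g x) - jfun X f * jfun X g \<in> alg_relations X"
    using assms unfolding alg_relations_def jfun_def reg_def by auto
qed

lemma jfun_one: "jeq m X (jfun X (\<lambda>x. 1)) 1"
  using jfun_const[of m X 1] by simp

lemma jfun_power:
  assumes "fun_alg X" "reg X f" shows "jeq m X (jfun X (\<lambda>x. f x ^ n)) (jfun X f ^ n)"
proof (induction n)
  case (Suc n)
  have "jeq m X (jfun X (\<lambda>x. f x * f x ^ n)) (jfun X f * jfun X (\<lambda>x. f x ^ n))"
    by (intro jfun_mult assms reg_power)
  also have "jeq m X (jfun X f * jfun X (\<lambda>x. f x ^ n)) (jfun X f * jfun X f ^ n)"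
    by (intro idl_eq_mult Suc idl_eq_refl)
  finally show ?case by simp
qed (simp add: jfun_one)

lemma jfun_sum:
  assumes "fun_alg X" "\<And>i. i \<in> A \<Longrightarrow> reg X (f i)"
  shows "jeq m X (jfun X (\<lambda>x. \<Sum>i\<in>A. f i x)) (\<Sum>i\<in>A. jfun X (f i))"
  using assms(2)
proof (induction A rule: infinite_finite_induct)
  case (insert i A)
  have "jeq m X (jfun X (\<lambda>x. f i x + (\<Sum>i\<in>A. f i x))) (jfun X (f i) + jfun X (\<lambda>x. \<Sum>i\<in>A. f i x))"
    using insert by (intro jfun_add reg_sum assms(1)) auto
  also have "jeq m X (jfun X (f i) + jfun X (\<lambda>x. \<Sum>i\<in>A. f i x)) (jfun X (f i) + (\<Sum>i\<in>A. jfun X (f i)))"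
    using insert by (intro idl_eq_add) auto
  finally show ?case using insert by simp
qed (use jfun_const[of m X 0] in simp_all)

section \<open>Jets and localization\<close>

text \<open>Additivity extends \<delta> from monomials to their sums, and both sides of the Leibniz
  rule are biadditive, so it may be checked on monomials.\<close>

lemma is_der_of_monomials:
  fixes \<delta> :: "nat \<Rightarrow> 'r::comm_ring_1 \<Rightarrow> 'r poly"
  assumes add: "\<And>n a b. \<delta> n (a + b) = \<delta> n a + \<delta> n b"
    and mult: "\<And>n k a b. \<delta> (n + k) (a * b) = \<delta> n a * monom b k + monom a n * \<delta> k b"
  shows "\<exists>D. is_der D \<and> (\<forall>n a. D (monom a n) = \<delta> n a)"
proof -
  have z: "\<delta> n 0 = 0" for n using add[of n 0 0] by simp
  define D where "D q = (\<Sum>n\<le>degree q. \<delta> n (coeff q n))" for q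
  have D: "D q = (\<Sum>n\<le>N. \<delta> n (coeff q n))" if "degree q \<le> N" for q N
    unfolding D_def by (rule sum.mono_neutral_left) (use that in \<open>auto simp: z coeff_eq_0\<close>)
  have Dadd: "D (p + q) = D p + D q" for p q
  proof -
    let ?N = "max (degree p) (degree q)"
    have "degree (p + q) \<le> ?N" by (rule degree_add_le_max)
    then show ?thesis by (simp add: D[of _ ?N] add sum.distrib)
  qed
  have Dmonom: "D (monom a n) = \<delta> n a" for a n
  proof -
    have "D (monom a n) = (\<Sum>k\<le>n. \<delta> k (coeff (monom a n) k))" by (rule D) (rule degree_monom_le)
    also have "\<dots> = (\<Sum>k\<in>{n}. \<delta> k (coeff (monom a n) k))"
      by (rule sum.mono_neutral_right) (auto simp: z)
    finally show ?thesis by simp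
  qed
  have D0: "D 0 = 0" by (simp add: D_def z)
  have Dsum: "D (sum f A) = (\<Sum>a\<in>A. D (f a))" for f and A :: "nat set"
    by (induction A rule: infinite_finite_induct) (auto simp: Dadd D0)
  have mm: "D (monom a n * monom b k) = D (monom a n) * monom b k + monom a n * D (monom b k)" for a b n k
    by (simp add: mult_monom Dmonom mult)
  have "D (p * q) = D p * q + p * D q" for p q
  proof -
    let ?s = "\<lambda>p. \<Sum>n\<le>degree p. monom (coeff p n) n"
    have "D (?s p * ?s q) = D (?s p) * ?s q + ?s p * D (?s q)"
      by (simp only: sum_product Dsum mm sum.distrib)
    then show ?thesis by (simp add: poly_as_sum_of_monoms)
  qed
  then show ?thesis using Dadd Dmonom unfolding is_der_def by blast
qed

text \<open>The derivation is extended by \<open>y \<mapsto> - y\<^sup>2 D F\<close>, the derivative of \<open>1 / F\<close>.\<close>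

lemma ex_localized_derivation:
  fixes D :: "'r::comm_ring_1 \<Rightarrow> 'r"
  assumes D: "is_der D"
  obtains D' where "is_der D'" "\<And>a. D' [:a:] = [:D a:]" "D' [:0, 1:] = - [:0, 0, D F:]"
proof -
  \<comment> \<open>The value on \<open>a * y^n\<close> forced by the Leibniz rule: the derivative
    of \<open>y^n\<close> has to be \<open>- n * D F * y^(n+1)\<close>.\<close>
  let ?\<delta> = "\<lambda>n a. monom (D a) n - monom (of_nat n * D F * a) (Suc n)"
  have "\<exists>D'. is_der D' \<and> (\<forall>n a. D' (monom a n) = ?\<delta> n a)"
  proof (rule is_der_of_monomials)
    show "?\<delta> n (a + b) = ?\<delta> n a + ?\<delta> n b" for n a b
      by (simp add: is_derD[OF D] add_monom[symmetric] algebra_simps)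
    show "?\<delta> (n + k) (a * b) = ?\<delta> n a * monom b k + monom a n * ?\<delta> k b" for n k a b
      by (simp add: is_derD[OF D] mult_monom add_monom[symmetric] algebra_simps)
  qed
  then obtain D' where D': "is_der D'" "\<And>n a. D' (monom a n) = ?\<delta> n a" by blast
  have "D' [:a:] = [:D a:]" for a
    using D'(2)[of a 0] by (simp add: monom_0)
  moreover have "D' [:0, 1:] = - [:0, 0, D F:]"
    using D'(2)[of 1 1] by (simp add: monom_Suc monom_0 is_derD[OF D])
  ultimately show ?thesis using that D'(1) by blast
qed

lemma coeff_in_span_const:
  "q \<in> idl.span ((\<lambda>p. [:p:]) ` T) \<Longrightarrow> coeff q n \<in> idl.span T"
proof (induction rule: idl.span_induct_alt)
  case (step c x y)
  then obtain t where "t \<in> T" "x = [:t:]" by blast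
  then have "coeff (c * x + y) n = coeff c n * t + coeff y n" by (simp add: mult.commute)
  then show ?case using step(2) \<open>t \<in> T\<close>
    by (auto simp only: intro!: idl.span_add idl_mult_left intro: idl.span_base)
qed (simp add: idl.span_zero)

text \<open>Writing \<open>p = h * (y * F - 1)\<close> modulo \<open>T\<close> and comparing
  coefficients gives \<open>h_0 = - p\<close> and \<open>h_(n+1) = F * h_n\<close>, so
  \<open>h_n = - F^n * p\<close>. Beyond the degree of \<open>h\<close> this is zero.\<close>

lemma localization_kernel:
  fixes p :: "'r::comm_ring_1"
  assumes "[:p:] \<in> idl.span (insert ([:0, 1:] * [:F:] - 1) ((\<lambda>p. [:p:]) ` T))"
  shows "\<exists>N. F ^ N * p \<in> idl.span T"
proof -
  obtain h where h: "[:p:] - h * ([:0, 1:] * [:F:] - 1) \<in> idl.span ((\<lambda>p. [:p:]) ` T)"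
    using assms unfolding idl.span_breakdown_eq by blast
  have eq: "[:p:] - h * ([:0, 1:] * [:F:] - 1) = [:p:] + h - pCons 0 (smult F h)"
    by (simp add: algebra_simps)
  have c: "coeff ([:p:] + h - pCons 0 (smult F h)) n \<in> idl.span T" for n
    using coeff_in_span_const[OF h] unfolding eq .
  have "F ^ n * p + coeff h n \<in> idl.span T" for n
  proof (induction n)
    case 0
    show ?case using c[of 0] by simp
  next
    case (Suc n)
    have "F * (F ^ n * p + coeff h n) + (coeff h (Suc n) - F * coeff h n) \<in> idl.span T"
      by (rule idl.span_add[OF idl_mult_left[OF Suc]]) (use c[of "Suc n"] in simp)
    then show ?case by (simp add: algebra_simps)
  qed
  from this[of "Suc (degree h)"] show ?thesis
    by (intro exI[of _ "Suc (degree h)"]) (simp add: coeff_eq_0)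
qed

lemma loc_numerator:
  assumes X: "fun_alg X" and r: "r \<in> regs (loc X f)"
  shows "\<exists>a n. a \<in> regs X \<and> (\<forall>x\<in>pts X. f x \<noteq> 0 \<longrightarrow> r x = a x / f x ^ n)"
proof -
  obtain a n where "reg X a" "\<forall>x\<in>pts X. f x \<noteq> 0 \<longrightarrow> r x = a x / f x ^ n"
    using r by (auto simp: loc_def)
  then show ?thesis
    by (intro exI[of _ "restrict a (pts X)"] exI[of _ n]) (simp add: reg_def)
qed

definition to_loc :: "'a fun_space \<Rightarrow> ('a \<Rightarrow> complex) \<Rightarrow> ('a \<Rightarrow> complex) \<Rightarrow> 'a \<Rightarrow> complex" where
  "to_loc X f r = restrict r (pts (loc X f))"

lemma fun_alg_hom_to_loc:
  assumes "fun_alg X" shows "fun_alg_hom X (loc X f) (to_loc X f)"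
  unfolding fun_alg_hom_def to_loc_def reg_def[symmetric]
  using regs_reg[OF assms]
  by (auto simp: cfun_def addf_def mulf_def intro!: reg_locI restrict_ext)

lemma jren_to_loc_jfun: "jren (to_loc X f) (jfun X g) = jfun (loc X f) g"
  by (simp add: jfun_def jren_simps to_loc_def restrict_def fun_eq_iff Collect_conj_eq)
     (auto intro!: arg_cong[where f = pvar])

text \<open>Modulo the ideals, a left inverse \<sigma> of \<open>jren (to_loc X f)\<close> is
  constructed, with values in polynomials in \<open>y\<close> over the jet polynomials of
  \<open>X\<close>, modulo \<open>y * F = 1\<close>. A function \<open>a / f^n\<close> goes to
  \<open>a * y^n\<close>, and its higher jets go to the iterated derivatives. Then
  \<open>[:p:]\<close> lies in the ideal of \<open>S m\<close>, and
  \<open>localization_kernel\<close> applies.\<close>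

theorem jet_localization_kernel:
  assumes X: "fun_alg X" and f: "f \<in> regs X" and p: "p \<in> jpoly m X"
    and ker: "jren (to_loc X f) p \<in> jid m (loc X f)"
  shows "\<exists>N. pvar (f, 0) ^ N * p \<in> jid m X"
proof -
  let ?L = "loc X f"
  define F where "F = pvar (f, 0 :: nat)"
  define y :: "'a jet_var mpoly poly" where "y = [:0, 1:]"
  define S where "S k = insert (y * [:F:] - 1) ((\<lambda>p. [:p:]) ` jrel k X)" for k
  obtain D' where D': "is_der D'" and Dc: "\<And>a. D' [:a:] = [:jet_derivation a:]"
    and Dy: "D' y = - [:0, 0, jet_derivation F:]"
    unfolding y_def using ex_localized_derivation[OF is_der_jet, of F] by blast
  have S_mono: "S k \<subseteq> S l" if "k \<le> l" for k l using jrel_mono[OF that] by (auto simp: S_def)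
  have const: "[:q:] \<in> idl.span (S k)" if "q \<in> jid k X" for q k
    using that
  proof (induction rule: idl.span_induct_alt)
    case (step c x z)
    have "[:c * x + z:] = [:c:] * [:x:] + [:z:]" by simp
    then show ?case using step
      by (auto simp del: mult_pCons_left mult_pCons_right intro!: idl.span_add idl_mult_left intro: idl.span_base simp: S_def)
  qed (simp add: idl.span_zero)
  have const_eq: "idl_eq (S k) [:p:] [:q:]" if "jeq k X p q" for p q k
    using const[of "p - q" k] that by (simp add: idl_eq_def)
  have yF: "idl_eq (S k) (y * [:F:]) 1" for k
    unfolding idl_eq_def by (rule idl.span_base) (simp add: S_def)
  have D_step: "D' u \<in> idl.span (S (eSuc k))" if "u \<in> idl.span (S k)" for u k
  proof (rule is_der_span[OF D' S_mono[OF ile_eSuc] _ that])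
    \<comment> \<open>\<open>y * F - 1\<close> divides its own derivative, so the additional
      relation yields no new ones when differentiated.\<close>
    have "D' (y * [:F:] - 1) = - (y * [:jet_derivation F:]) * (y * [:F:] - 1)"
      unfolding is_derD[OF D'] Dc Dy by (simp add: y_def algebra_simps)
    then have "D' (y * [:F:] - 1) \<in> idl.span (S (eSuc k))"
      by (simp only:) (intro idl_mult_left idl.span_base, simp add: S_def)
    moreover have "D' [:q:] \<in> idl.span (S (eSuc k))" if "q \<in> jrel k X" for q
      unfolding Dc by (intro const jid_D idl.span_base that)
    ultimately show "D' ` S k \<subseteq> idl.span (S (eSuc k))" by (auto simp: S_def)
  qed
  \<comment> \<open>Orders are counted because for finite \<open>m\<close> only relations of order
    at most \<open>m\<close> are available: \<open>i\<close> derivatives of an element of the ideal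
    of order zero stay within order \<open>i\<close>.\<close>
  have D_pow: "(D' ^^ i) u \<in> idl.span (S (enat i))" if "u \<in> idl.span (S 0)" for u i
    by (induction i) (use that D_step in \<open>auto simp: zero_enat_def simp flip: eSuc_enat\<close>)
  have D_pow_m: "(D' ^^ i) u \<in> idl.span (S m)" if "u \<in> idl.span (S 0)" "enat i \<le> m" for u i
    using D_pow[OF that(1)] idl.span_mono[OF S_mono[OF that(2)]] by blast
  have D'_diff: "(D' ^^ i) (u - v) = (D' ^^ i) u - (D' ^^ i) v" for u v i
    by (induction i) (simp_all add: is_derD[OF D'])
  \<comment> \<open>Equal fractions satisfy \<open>a * f^(l+1) = b * f^(k+1)\<close> on all of
    \<open>X\<close>: the extra factor \<open>f\<close> covers the points where \<open>f\<close>
    vanishes. Multiplied by the same power of \<open>y\<close>, both sides reduce to the two given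
    products.\<close>
  have frac: "idl_eq (S 0) ([:jfun X a:] * y ^ k) ([:jfun X b:] * y ^ l)"
    if ab: "reg X a" "reg X b" and eq: "\<And>x. x \<in> pts X \<Longrightarrow> f x \<noteq> 0 \<Longrightarrow> a x / f x ^ k = b x / f x ^ l"
    for a b k l
  proof -
    have rf: "reg X f" by (rule regs_reg[OF X f])
    have JF: "jfun X f = F" by (simp add: F_def jfun_regs[OF X f])
    have 1: "idl_eq (S 0) ([:jfun X a:] * y ^ k) ([:jfun X (\<lambda>x. a x * f x ^ Suc l):] * y ^ (k + Suc l))"
      if "reg X a" for a k l
    proof -
      have "jeq 0 X (jfun X (\<lambda>x. a x * f x ^ Suc l)) (jfun X a * jfun X (\<lambda>x. f x ^ Suc l))"
        by (intro jfun_mult that reg_power X rf)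
      also have "jeq 0 X \<dots> (jfun X a * F ^ Suc l)"
        unfolding JF[symmetric] by (intro idl_eq_mult jfun_power X rf idl_eq_refl)
      finally have "idl_eq (S 0) [:jfun X (\<lambda>x. a x * f x ^ Suc l):] [:jfun X a * F ^ Suc l:]"
        by (rule const_eq)
      also have "[:jfun X a * F ^ Suc l:] = [:jfun X a:] * [:F:] ^ Suc l"
        by (simp add: poly_const_pow del: power_Suc)
      finally have "idl_eq (S 0) ([:jfun X (\<lambda>x. a x * f x ^ Suc l):] * y ^ (k + Suc l))
          ([:jfun X a:] * [:F:] ^ Suc l * y ^ (k + Suc l))"
        by (rule idl_eq_mult) (rule idl_eq_refl)
      also have "[:jfun X a:] * [:F:] ^ Suc l * y ^ (k + Suc l) =
          [:jfun X a:] * y ^ k * (y * [:F:]) ^ Suc l"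
        by (simp only: power_add power_mult_distrib mult_ac)
      also have "idl_eq (S 0) \<dots> ([:jfun X a:] * y ^ k * 1 ^ Suc l)"
        by (intro idl_eq_mult idl_eq_power yF idl_eq_refl)
      finally show ?thesis using idl_eq_sym by simp
    qed
    have "jfun X (\<lambda>x. a x * f x ^ Suc l) = jfun X (\<lambda>x. b x * f x ^ Suc k)"
    proof (rule jfun_cong)
      fix x assume x: "x \<in> pts X"
      show "a x * f x ^ Suc l = b x * f x ^ Suc k"
        using eq[OF x] by (cases "f x = 0") (simp_all add: field_simps)
    qed
    with 1[OF ab(1), of k l]
    have "idl_eq (S 0) ([:jfun X a:] * y ^ k) ([:jfun X (\<lambda>x. b x * f x ^ Suc k):] * y ^ (l + Suc k))"
      by (simp only: add_Suc_right add.commute[of k l])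
    then show ?thesis
      using 1[OF ab(2), of l k] by (blast intro: idl_eq_trans idl_eq_sym)
  qed
  have "\<forall>r\<in>regs ?L. \<exists>a n. a \<in> regs X \<and> (\<forall>x\<in>pts X. f x \<noteq> 0 \<longrightarrow> r x = a x / f x ^ n)"
    using loc_numerator[OF X] by blast
  \<comment> \<open>Numerators and exponents are chosen arbitrarily; by \<open>frac\<close> the
    class of \<open>w r\<close> does not depend on the choice.\<close>
  then obtain num ex where num: "\<And>r. r \<in> regs ?L \<Longrightarrow> num r \<in> regs X"
    and nex: "\<And>r x. r \<in> regs ?L \<Longrightarrow> x \<in> pts X \<Longrightarrow> f x \<noteq> 0 \<Longrightarrow> r x = num r x / f x ^ ex r"
    by metis
  define w where "w r = [:jfun X (num r):] * y ^ ex r" for r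
  define \<sigma> where "\<sigma> = phom (\<lambda>c. [:pconst c:]) (\<lambda>(r, i). (D' ^^ i) (w r))"
  have ch: "chom (\<lambda>c. [:pconst c :: 'a jet_var mpoly:])"
    by (simp add: chom_def pconst_add pconst_mult one_pCons)
  note \<sigma>s = phom_simps[OF ch, where x = "\<lambda>(r, i). (D' ^^ i) (w r)", folded \<sigma>_def]
  have \<sigma>D: "\<sigma> (jet_derivation q) = D' (\<sigma> q)" for q
    unfolding \<sigma>_def
    by (rule phom_der_commute[where V = UNIV, OF ch is_der_jet D']) (auto simp: Dc phom_pvar[OF ch])
  have \<sigma>Dk: "\<sigma> ((jet_derivation ^^ k) q) = (D' ^^ k) (\<sigma> q)" for k q
    by (induction k) (simp_all add: \<sigma>D)
  have rn: "reg X (num r)" if "r \<in> regs ?L" for r using num[OF that] regs_reg[OF X] by blast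
  have rf: "reg X f" by (rule regs_reg[OF X f])
  note LA = fun_alg_loc[OF X rf]
  have w_frac: "idl_eq (S 0) (w r) ([:jfun X a:] * y ^ n)"
    if "r \<in> regs ?L" "reg X a" "\<And>x. x \<in> pts X \<Longrightarrow> f x \<noteq> 0 \<Longrightarrow> r x = a x / f x ^ n" for r a n
    unfolding w_def by (rule frac) (use that rn nex in auto)
  have rel: "\<sigma> u \<in> idl.span (S 0)" if u: "u \<in> alg_relations ?L" for u
  proof -
    from u consider c where "u = pvar (cfun (pts ?L) c, 0) - pconst c"
      | g h where "g \<in> regs ?L" "h \<in> regs ?L" "u = pvar (addf (pts ?L) g h, 0) - (pvar (g, 0) + pvar (h, 0))"
      | g h where "g \<in> regs ?L" "h \<in> regs ?L" "u = pvar (mulf (pts ?L) g h, 0) - pvar (g, 0) * pvar (h, 0)"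
      unfolding alg_relations_def by blast
    then show ?thesis
    proof cases
      case (1 c)
      have "idl_eq (S 0) (w (cfun (pts ?L) c)) ([:jfun X (\<lambda>x. c):] * y ^ 0)"
        by (rule w_frac) (auto simp: cfun_def reg_const[OF X] intro: fun_algD(2)[OF LA, unfolded cfun_def, simplified])
      also have "idl_eq (S 0) \<dots> ([:pconst c:] * y ^ 0)"
        by (intro idl_eq_mult const_eq jfun_const idl_eq_refl)
      finally show ?thesis unfolding 1 by (simp add: \<sigma>s idl_eq_def)
    next
      case (2 g h)
      let ?a = "\<lambda>x. num g x * f x ^ ex h" and ?b = "\<lambda>x. num h x * f x ^ ex g"
      note r = rn[OF 2(1)] rn[OF 2(2)]
      have "idl_eq (S 0) (w (addf (pts ?L) g h)) ([:jfun X (\<lambda>x. ?a x + ?b x):] * y ^ (ex g + ex h))"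
      proof (rule w_frac)
        show "addf (pts ?L) g h \<in> regs ?L" by (rule fun_algD(3)[OF LA 2(1,2)])
        show "reg X (\<lambda>x. ?a x + ?b x)" by (intro reg_add reg_mult reg_power X rf r)
        show "addf (pts ?L) g h x = (?a x + ?b x) / f x ^ (ex g + ex h)" if "x \<in> pts X" "f x \<noteq> 0" for x
          using that by (simp add: addf_def nex[OF 2(1)] nex[OF 2(2)] field_simps power_add)
      qed
      also have "idl_eq (S 0) \<dots> ([:jfun X ?a + jfun X ?b:] * y ^ (ex g + ex h))"
        by (intro idl_eq_mult const_eq jfun_add reg_mult reg_power X rf r idl_eq_refl)
      also have "[:jfun X ?a + jfun X ?b:] * y ^ (ex g + ex h) =
          [:jfun X ?a:] * y ^ (ex g + ex h) + [:jfun X ?b:] * y ^ (ex g + ex h)"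
        by (simp add: smult_add_left)
      also have "idl_eq (S 0) \<dots> (w g + w h)"
      proof (rule idl_eq_add)
        show "idl_eq (S 0) ([:jfun X ?a:] * y ^ (ex g + ex h)) (w g)"
          unfolding w_def by (rule frac) (use r in \<open>auto intro!: reg_mult reg_power X rf simp: power_add\<close>)
        show "idl_eq (S 0) ([:jfun X ?b:] * y ^ (ex g + ex h)) (w h)"
          unfolding w_def by (rule frac) (use r in \<open>auto intro!: reg_mult reg_power X rf simp: power_add\<close>)
      qed
      finally show ?thesis unfolding 2 by (simp add: \<sigma>s idl_eq_def)
    next
      case (3 g h)
      note r = rn[OF 3(1)] rn[OF 3(2)]
      have "idl_eq (S 0) (w (mulf (pts ?L) g h)) ([:jfun X (\<lambda>x. num g x * num h x):] * y ^ (ex g + ex h))"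
      proof (rule w_frac)
        show "mulf (pts ?L) g h \<in> regs ?L" by (rule fun_algD(4)[OF LA 3(1,2)])
        show "reg X (\<lambda>x. num g x * num h x)" by (intro reg_mult X r)
        show "mulf (pts ?L) g h x = num g x * num h x / f x ^ (ex g + ex h)" if "x \<in> pts X" "f x \<noteq> 0" for x
          using that by (simp add: mulf_def nex[OF 3(1)] nex[OF 3(2)] power_add)
      qed
      also have "idl_eq (S 0) \<dots> ([:jfun X (num g) * jfun X (num h):] * y ^ (ex g + ex h))"
        by (intro idl_eq_mult const_eq jfun_mult r idl_eq_refl)
      also have "[:jfun X (num g) * jfun X (num h):] * y ^ (ex g + ex h) = w g * w h"
        by (simp add: w_def power_add algebra_simps)
      finally show ?thesis unfolding 3 by (simp add: \<sigma>s idl_eq_def)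
    qed
  qed
  have \<sigma>id: "\<sigma> q \<in> idl.span (S m)" if "q \<in> jid m ?L" for q
    using that
  proof (induction rule: idl.span_induct_alt)
    case base
    then show ?case by (simp add: \<sigma>_def idl.span_zero)
  next
    case (step c x z)
    then obtain k u where "x = (jet_derivation ^^ k) u" "enat k \<le> m" "u \<in> alg_relations ?L"
      by (auto simp: jrel_def)
    then have "\<sigma> x \<in> idl.span (S m)" using D_pow_m rel by (simp add: \<sigma>Dk)
    then show ?case using step(2) by (auto simp: \<sigma>s intro!: idl.span_add idl_mult_left)
  qed
  \<comment> \<open>A function on \<open>X\<close> is a fraction with exponent 0, so \<sigma> undoes
    the localization map.\<close>
  have "idl_eq (S m) (\<sigma> (jren (to_loc X f) p)) [:p:]"
    using p
  proof (induction p rule: jpoly_induct)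
    case (const c)
    then show ?case by (simp add: jren_simps \<sigma>s)
  next
    case (var r i)
    have "idl_eq (S 0) (w (to_loc X f r)) ([:jfun X r:] * y ^ 0)"
      using fun_alg_hom_to_loc[OF X, of f] var regs_reg[OF X var(1)]
      by (intro w_frac) (auto simp: fun_alg_hom_def to_loc_def)
    then have "(D' ^^ i) (w (to_loc X f r) - [:pvar (r, 0):]) \<in> idl.span (S m)"
      using var by (intro D_pow_m) (simp_all add: idl_eq_def jfun_regs[OF X])
    moreover have "(D' ^^ i) [:pvar (r, 0):] = [:pvar (r, i):]"
      by (induction i) (simp_all add: Dc)
    ultimately show ?case by (simp add: jren_simps \<sigma>s D'_diff idl_eq_def)
  next
    case (add p q)
    then show ?case using idl_eq_add[OF add(3,4)] by (simp add: jren_simps \<sigma>s)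
  next
    case (mult p q)
    then show ?case using idl_eq_mult[OF mult(3,4)] by (simp add: jren_simps \<sigma>s mult.commute[of q p])
  qed
  then have "[:p:] \<in> idl.span (S m)" using \<sigma>id[OF ker] idl_eq_span by blast
  then show ?thesis unfolding S_def y_def F_def[symmetric] by (rule localization_kernel)
qed

lemma pconst_of_nat: "pconst (of_nat n) = of_nat n"
  by (simp add: pconst_def)

lemma jren_of_nat [simp]: "jren \<sigma> (of_nat n) = of_nat n"
  by (metis jren_simps(3) pconst_of_nat)

lemma jpoly_of_nat [simp]: "of_nat n \<in> jpoly m X"
  by (metis jpoly_const(1) pconst_of_nat)

text \<open>The quotient rule with denominators cleared: if \<open>u = v / G^N\<close>, then
  \<open>D u = (G * D v - N * D G * v) / G^(N+1)\<close>. The order of the congruence grows by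
  one.\<close>

lemma clear_denominator_D:
  assumes "jeq k Y (G ^ N * u) v"
  shows "jeq (eSuc k) Y (G ^ Suc N * jet_derivation u)
           (G * jet_derivation v - of_nat N * jet_derivation G * v)"
proof -
  have "jeq (eSuc k) Y (jet_derivation (G ^ N * u)) (jet_derivation v)"
    by (rule jeq_D[OF assms])
  then have "jeq (eSuc k) Y (G * jet_derivation (G ^ N * u)) (G * jet_derivation v)"
    by (intro idl_eq_mult idl_eq_refl)
  moreover have "jeq (eSuc k) Y (of_nat N * jet_derivation G * (G ^ N * u)) (of_nat N * jet_derivation G * v)"
    by (intro idl_eq_mult idl_eq_refl jeq_mono[OF ile_eSuc assms])
  ultimately have "jeq (eSuc k) Y
      (G * jet_derivation (G ^ N * u) - of_nat N * jet_derivation G * (G ^ N * u))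
      (G * jet_derivation v - of_nat N * jet_derivation G * v)"
    by (rule idl_eq_diff)
  moreover have "G * jet_derivation (G ^ N) = of_nat N * jet_derivation G * G ^ N"
    by (induction N) (simp_all add: is_derD[OF is_der_jet] algebra_simps)
  moreover have "G * jet_derivation (G ^ N * u) = (G * jet_derivation (G ^ N)) * u + G ^ Suc N * jet_derivation u"
    by (simp add: is_derD[OF is_der_jet] algebra_simps)
  ultimately show ?thesis by (simp add: mult.assoc)
qed

text \<open>A function has a numerator after multiplication by a power of \<open>f\<close>, and each
  further derivative is treated by the quotient rule at the cost of one more power of
  \<open>F\<close>.\<close>

theorem jet_localization_surj:
  assumes X: "fun_alg X" and f: "f \<in> regs X" and q: "q \<in> jpoly m (loc X f)"
  shows "\<exists>N p. p \<in> jpoly m X \<and>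
    jeq m (loc X f) (jren (to_loc X f) (pvar (f, 0)) ^ N * q) (jren (to_loc X f) p)"
proof -
  let ?L = "loc X f" and ?T = "jren (to_loc X f)"
  let ?F = "pvar (f, 0) :: 'a jet_var mpoly"
  note rf = regs_reg[OF X f]
  note L = fun_alg_loc[OF X rf]
  have jet_var: "\<exists>N p. p \<in> jpoly (enat i) X \<and> jeq (enat i) ?L (?T ?F ^ N * pvar (r, i)) (?T p)"
    if r: "r \<in> regs ?L" for r i
  proof (induction i)
    case 0
    obtain a n where a: "a \<in> regs X" "\<And>x. x \<in> pts X \<Longrightarrow> f x \<noteq> 0 \<Longrightarrow> r x = a x / f x ^ n"
      using loc_numerator[OF X r] by blast
    have T: "?T ?F = jfun ?L f"
      using jren_to_loc_jfun[of X f f] by (simp add: jfun_regs[OF X f])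
    have "jeq 0 ?L (jfun ?L (\<lambda>x. f x ^ n * r x)) (jfun ?L (\<lambda>x. f x ^ n) * jfun ?L r)"
      by (intro jfun_mult reg_power L reg_locI rf regs_reg[OF L r])
    also have "jeq 0 ?L \<dots> (jfun ?L f ^ n * jfun ?L r)"
      by (intro idl_eq_mult idl_eq_refl jfun_power L reg_locI rf)
    also have "jfun ?L f ^ n * jfun ?L r = ?T ?F ^ n * pvar (r, 0)"
      by (simp add: T jfun_regs[OF L r])
    also have "jfun ?L (\<lambda>x. f x ^ n * r x) = jfun ?L a"
      by (rule jfun_cong) (simp add: a(2))
    also have "jfun ?L a = ?T (pvar (a, 0))"
      using jren_to_loc_jfun[of X f a] by (simp add: jfun_regs[OF X a(1)])
    finally have "jeq 0 ?L (?T ?F ^ n * pvar (r, 0)) (?T (pvar (a, 0)))" by (rule idl_eq_sym)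
    then show ?case using a(1) unfolding zero_enat_def
      by (intro exI[of _ n] exI[of _ "pvar (a, 0)"]) simp
  next
    case (Suc i)
    then obtain N p where p: "p \<in> jpoly (enat i) X"
      and e: "jeq (enat i) ?L (?T ?F ^ N * pvar (r, i)) (?T p)" by blast
    let ?p = "?F * jet_derivation p - of_nat N * jet_derivation ?F * p"
    have "jet_derivation p \<in> jpoly (enat (Suc i)) X" using jpoly_D[OF p] by (simp add: eSuc_enat)
    moreover have "p \<in> jpoly (enat (Suc i)) X" by (rule jpoly_mono[OF order_refl _ p]) simp
    ultimately have "?p \<in> jpoly (enat (Suc i)) X"
      using f by (intro jpoly_intros) simp_all
    moreover have "jeq (enat (Suc i)) ?L (?T ?F ^ Suc N * pvar (r, Suc i)) (?T ?p)"
      using clear_denominator_D[OF e] by (simp add: jren_simps eSuc_enat flip: jren_D)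
    ultimately show ?case by blast
  qed
  show ?thesis using q
  proof (induction q rule: jpoly_induct)
    case (const c)
    show ?case by (intro exI[of _ 0] exI[of _ "pconst c"]) (simp add: jren_simps)
  next
    case (var r i)
    then obtain N p where "p \<in> jpoly (enat i) X" "jeq (enat i) ?L (?T ?F ^ N * pvar (r, i)) (?T p)"
      using jet_var by blast
    then show ?case using jeq_mono[OF var(2)] jpoly_mono[OF order_refl var(2)] by blast
  next
    case (add q q')
    then obtain N p N' p' where p: "p \<in> jpoly m X" "jeq m ?L (?T ?F ^ N * q) (?T p)"
      "p' \<in> jpoly m X" "jeq m ?L (?T ?F ^ N' * q') (?T p')" by blast
    have "jeq m ?L (?T ?F ^ N' * (?T ?F ^ N * q) + ?T ?F ^ N * (?T ?F ^ N' * q'))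
        (?T ?F ^ N' * ?T p + ?T ?F ^ N * ?T p')"
      by (intro idl_eq_add idl_eq_mult idl_eq_refl p)
    moreover have "?F ^ N' * p + ?F ^ N * p' \<in> jpoly m X"
      using p f by (intro jpoly_intros) (simp_all flip: zero_enat_def)
    ultimately show ?case
      by (intro exI[of _ "N + N'"] exI[of _ "?F ^ N' * p + ?F ^ N * p'"])
         (simp add: jren_simps power_add algebra_simps)
  next
    case (mult q q')
    then obtain N p N' p' where p: "p \<in> jpoly m X" "jeq m ?L (?T ?F ^ N * q) (?T p)"
      "p' \<in> jpoly m X" "jeq m ?L (?T ?F ^ N' * q') (?T p')" by blast
    have "jeq m ?L ((?T ?F ^ N * q) * (?T ?F ^ N' * q')) (?T p * ?T p')"
      by (intro idl_eq_mult p)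
    moreover have "p * p' \<in> jpoly m X" using p by (intro jpoly_intros)
    ultimately show ?case
      by (intro exI[of _ "N + N'"] exI[of _ "p * p'"]) (simp add: jren_simps power_add algebra_simps)
  qed
qed

section \<open>Invariants as an equalizer\<close>

text \<open>
  \<open>X\<close> stands for the variety, \<open>Y\<close> for \<open>G \<times> X\<close>, and \<open>\<alpha>\<close>, \<open>\<beta>\<close> for the comorphisms of the
  action and of the projection; \<open>eq_space\<close> is then the algebra of invariants.
\<close>

definition fun_pair ::
  "'a fun_space \<Rightarrow> 'b fun_space \<Rightarrow> (('a \<Rightarrow> complex) \<Rightarrow> 'b \<Rightarrow> complex) \<Rightarrow> (('a \<Rightarrow> complex) \<Rightarrow> 'b \<Rightarrow> complex) \<Rightarrow> bool" where
  "fun_pair X Y \<alpha> \<beta> \<longleftrightarrow> fun_alg X \<and> fun_alg Y \<and> fun_alg_hom X Y \<alpha> \<and> fun_alg_hom X Y \<beta>"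

text \<open>Keeping the points of \<open>X\<close> makes the jet variables of the invariants a
  subset of those of \<open>X\<close>, so that the pullback \<open>p_m^*\<close> becomes an
  inclusion of polynomials.\<close>

definition eq_space ::
  "'a fun_space \<Rightarrow> (('a \<Rightarrow> complex) \<Rightarrow> 'b \<Rightarrow> complex) \<Rightarrow> (('a \<Rightarrow> complex) \<Rightarrow> 'b \<Rightarrow> complex) \<Rightarrow> 'a fun_space" where
  "eq_space X \<alpha> \<beta> = \<lparr>pts = pts X, regs = {h \<in> regs X. \<alpha> h = \<beta> h}\<rparr>"

definition jinv ::
  "enat \<Rightarrow> 'a fun_space \<Rightarrow> 'b fun_space \<Rightarrow> (('a \<Rightarrow> complex) \<Rightarrow> 'b \<Rightarrow> complex) \<Rightarrow> (('a \<Rightarrow> complex) \<Rightarrow> 'b \<Rightarrow> complex) \<Rightarrow>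
     'a jet_var mpoly set" where
  "jinv m X Y \<alpha> \<beta> = {q \<in> jpoly m X. jeq m Y (jren \<alpha> q) (jren \<beta> q)}"

text \<open>With \<open>jsurj\<close> and \<open>jdfin\<close>, this expresses on representatives
  the injectivity and the surjectivity of the pullback \<open>p_m^*\<close> and differential finite
  generation. The link to the definitions is \<open>very_good_iff\<close>, \<open>good_iff\<close>
  and \<open>D_finite_iff\<close>.\<close>

definition jinj ::
  "enat \<Rightarrow> 'a fun_space \<Rightarrow> (('a \<Rightarrow> complex) \<Rightarrow> 'b \<Rightarrow> complex) \<Rightarrow> (('a \<Rightarrow> complex) \<Rightarrow> 'b \<Rightarrow> complex) \<Rightarrow> bool" where
  "jinj m X \<alpha> \<beta> \<longleftrightarrow>
     (\<forall>p\<in>jpoly m (eq_space X \<alpha> \<beta>). p \<in> jid m X \<longrightarrow> p \<in> jid m (eq_space X \<alpha> \<beta>))"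

definition jsurj ::
  "enat \<Rightarrow> 'a fun_space \<Rightarrow> 'b fun_space \<Rightarrow> (('a \<Rightarrow> complex) \<Rightarrow> 'b \<Rightarrow> complex) \<Rightarrow> (('a \<Rightarrow> complex) \<Rightarrow> 'b \<Rightarrow> complex) \<Rightarrow> bool" where
  "jsurj m X Y \<alpha> \<beta> \<longleftrightarrow> (\<forall>q\<in>jinv m X Y \<alpha> \<beta>. \<exists>p\<in>jpoly m (eq_space X \<alpha> \<beta>). jeq m X q p)"

inductive_set jdiff :: "'a jet_var mpoly set \<Rightarrow> 'a jet_var mpoly set" for F where
  gen: "p \<in> F \<Longrightarrow> p \<in> jdiff F"
| const: "pconst c \<in> jdiff F"
| add: "p \<in> jdiff F \<Longrightarrow> q \<in> jdiff F \<Longrightarrow> p + q \<in> jdiff F"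
| mult: "p \<in> jdiff F \<Longrightarrow> q \<in> jdiff F \<Longrightarrow> p * q \<in> jdiff F"
| deriv: "p \<in> jdiff F \<Longrightarrow> jet_derivation p \<in> jdiff F"

definition jdfin ::
  "'a fun_space \<Rightarrow> 'b fun_space \<Rightarrow> (('a \<Rightarrow> complex) \<Rightarrow> 'b \<Rightarrow> complex) \<Rightarrow> (('a \<Rightarrow> complex) \<Rightarrow> 'b \<Rightarrow> complex) \<Rightarrow> bool" where
  "jdfin X Y \<alpha> \<beta> \<longleftrightarrow> (\<exists>F. finite F \<and> F \<subseteq> jinv \<infinity> X Y \<alpha> \<beta> \<and>
     (\<forall>q\<in>jinv \<infinity> X Y \<alpha> \<beta>. \<exists>p\<in>jdiff F. jeq \<infinity> X q p))"

lemma jdiff_mono: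
  assumes "F \<subseteq> F'" "p \<in> jdiff F" shows "p \<in> jdiff F'"
  using assms(2) by (induction rule: jdiff.induct) (use assms(1) in \<open>auto intro: jdiff.intros\<close>)

lemma jdiff_power: "p \<in> jdiff F \<Longrightarrow> p ^ n \<in> jdiff F"
  using jdiff.const[of 1 F] by (induction n) (auto intro: jdiff.intros)

lemma jdiff_of_nat: "of_nat n \<in> jdiff F"
  using jdiff.const[of "of_nat n" F] by (simp add: pconst_of_nat)

lemma pconst_uminus: "pconst (- c) = - pconst c"
  by (simp add: pconst_def single_uminus)

lemma jdiff_uminus: "p \<in> jdiff F \<Longrightarrow> - p \<in> jdiff F"
  using jdiff.mult[OF jdiff.const[of "-1" F], of p] by (simp add: pconst_uminus)

lemma jdiff_diff: "p \<in> jdiff F \<Longrightarrow> q \<in> jdiff F \<Longrightarrow> p - q \<in> jdiff F"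
  using jdiff.add[OF _ jdiff_uminus, of p F q] by simp

lemma alg_relations_sub:
  "pts X = pts Y \<Longrightarrow> regs X \<subseteq> regs Y \<Longrightarrow> alg_relations X \<subseteq> alg_relations Y"
  unfolding alg_relations_def by simp blast

lemma jrel_sub: "pts X = pts Y \<Longrightarrow> regs X \<subseteq> regs Y \<Longrightarrow> jrel m X \<subseteq> jrel m Y"
  using alg_relations_sub[of X Y] unfolding jrel_def by blast

lemma eq_space_simps [simp]:
  "pts (eq_space X \<alpha> \<beta>) = pts X" "regs (eq_space X \<alpha> \<beta>) = {h \<in> regs X. \<alpha> h = \<beta> h}"
  by (simp_all add: eq_space_def)

lemma jeq_eq_space: "jeq m (eq_space X \<alpha> \<beta>) p q \<Longrightarrow> jeq m X p q"
  by (rule idl_eq_mono[OF jrel_sub]) auto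

lemma jid_eq_space: "p \<in> jid m (eq_space X \<alpha> \<beta>) \<Longrightarrow> p \<in> jid m X"
  using jeq_eq_space[of m X \<alpha> \<beta> p 0] by (simp add: idl_eq_0)

lemma jpoly_eq_space: "p \<in> jpoly m (eq_space X \<alpha> \<beta>) \<Longrightarrow> p \<in> jpoly m X"
  by (rule jpoly_mono) auto

lemma fun_alg_eq_space:
  assumes "fun_pair X Y \<alpha> \<beta>" shows "fun_alg (eq_space X \<alpha> \<beta>)"
proof -
  have X: "fun_alg X" and s: "fun_alg_hom X Y \<alpha>" "fun_alg_hom X Y \<beta>"
    using assms by (simp_all add: fun_pair_def)
  show ?thesis
    using fun_algD[OF X] s unfolding fun_alg_def[of "eq_space X \<alpha> \<beta>"] fun_alg_hom_def by auto
qed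

lemma jren_eq_space:
  "p \<in> jpoly m (eq_space X \<alpha> \<beta>) \<Longrightarrow> jren \<alpha> p = jren \<beta> p"
  by (rule jren_cong) auto

lemma jpoly_jinv: "p \<in> jpoly m (eq_space X \<alpha> \<beta>) \<Longrightarrow> p \<in> jinv m X Y \<alpha> \<beta>"
  by (simp add: jinv_def jpoly_eq_space jren_eq_space)

lemma jinv_add: "p \<in> jinv m X Y \<alpha> \<beta> \<Longrightarrow> q \<in> jinv m X Y \<alpha> \<beta> \<Longrightarrow> p + q \<in> jinv m X Y \<alpha> \<beta>"
  by (auto simp: jinv_def jren_simps intro: jpoly_intros idl_eq_add)

lemma jinv_mult: "p \<in> jinv m X Y \<alpha> \<beta> \<Longrightarrow> q \<in> jinv m X Y \<alpha> \<beta> \<Longrightarrow> p * q \<in> jinv m X Y \<alpha> \<beta>"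
  by (auto simp: jinv_def jren_simps intro: jpoly_intros idl_eq_mult)

lemma jinv_const: "pconst c \<in> jinv m X Y \<alpha> \<beta>"
  by (simp add: jinv_def jren_simps)

lemma jinv_D: "p \<in> jinv \<infinity> X Y \<alpha> \<beta> \<Longrightarrow> jet_derivation p \<in> jinv \<infinity> X Y \<alpha> \<beta>"
  using jpoly_D[of p \<infinity> X] jeq_D[of \<infinity> Y "jren \<alpha> p" "jren \<beta> p"] by (simp add: jinv_def jren_D)

lemma jdiff_jinv: "p \<in> jdiff F \<Longrightarrow> F \<subseteq> jinv \<infinity> X Y \<alpha> \<beta> \<Longrightarrow> p \<in> jinv \<infinity> X Y \<alpha> \<beta>"
  by (induction rule: jdiff.induct) (auto intro: jinv_add jinv_mult jinv_const jinv_D)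

text \<open>The elements some power of which lies in \<open>J\<close> form an ideal of the subring \<open>S\<close>.\<close>

lemma unit_from_powers:
  fixes S J :: "'r::comm_ring_1 set"
  assumes S: "1 \<in> S" "\<And>x y. x \<in> S \<Longrightarrow> y \<in> S \<Longrightarrow> x + y \<in> S" "\<And>x y. x \<in> S \<Longrightarrow> y \<in> S \<Longrightarrow> x * y \<in> S"
    and Sm: "\<And>x. x \<in> S \<Longrightarrow> - x \<in> S"
    and J: "0 \<in> J" "\<And>x y. x \<in> J \<Longrightarrow> y \<in> J \<Longrightarrow> x + y \<in> J" "\<And>x y. x \<in> S \<Longrightarrow> y \<in> J \<Longrightarrow> x * y \<in> J"
    and cf: "\<And>j. j < (k::nat) \<Longrightarrow> c j \<in> S" "\<And>j. j < k \<Longrightarrow> f j \<in> S"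
    and pow: "\<And>j. j < k \<Longrightarrow> \<exists>n. f j ^ n \<in> J" and one: "1 - (\<Sum>j<k. c j * f j) \<in> J"
  shows "1 \<in> J"
proof -
  have Spow: "x ^ n \<in> S" if "x \<in> S" for x n by (induction n) (use that S in auto)
  define R where "R x \<longleftrightarrow> x \<in> S \<and> (\<exists>n. x ^ n \<in> J)" for x
  have J_sum: "sum g A \<in> J" if "\<And>i. i \<in> A \<Longrightarrow> g i \<in> J" for g and A :: "nat set"
    using that by (induction A rule: infinite_finite_induct) (simp_all add: J)
  have S_nat: "of_nat n * x \<in> J" if "x \<in> J" for n x
    by (induction n) (use that in \<open>simp_all add: J distrib_right\<close>)
  have R_add: "R (x + y)" if xy: "R x" "R y" for x y
  proof -
    obtain n l where n: "x ^ n \<in> J" "y ^ l \<in> J" and S': "x \<in> S" "y \<in> S" using xy by (auto simp: R_def)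
    \<comment> \<open>In every binomial term one of the two exponents reaches its bound
      \<open>n\<close> or \<open>l\<close>.\<close>
    have "x ^ i * y ^ (n + l - i) \<in> J" for i
    proof (cases "n \<le> i")
      case True
      then have "x ^ i = x ^ (i - n) * x ^ n" by (simp flip: power_add)
      then have "x ^ i * y ^ (n + l - i) = (x ^ (i - n) * y ^ (n + l - i)) * x ^ n"
        by (simp add: mult_ac)
      then show ?thesis using n S' by (metis J(3) S(3) Spow)
    next
      case False
      then have "n + l - i = (n - i) + l" by simp
      then have "x ^ i * y ^ (n + l - i) = (x ^ i * y ^ (n - i)) * y ^ l"
        by (simp add: power_add mult_ac)
      then show ?thesis using n S' by (metis J(3) S(3) Spow)
    qed
    then have "(x + y) ^ (n + l) \<in> J"
      unfolding binomial_ring mult.assoc by (intro J_sum S_nat)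
    then show ?thesis using S' S(2) unfolding R_def by blast
  qed
  have R_mult: "R (x * y)" if "x \<in> S" "R y" for x y
    using that S(3) J(3) Spow unfolding R_def by (metis power_mult_distrib)
  have "R (\<Sum>j<l. c j * f j)" if "l \<le> k" for l
    using that
  proof (induction l)
    case 0
    have "0 \<in> S" using S(2)[OF S(1) Sm[OF S(1)]] by simp
    then show ?case unfolding R_def by (intro conjI exI[of _ 1]) (simp_all add: J(1))
  next
    case (Suc l)
    have "R (f l)" unfolding R_def using cf(2)[of l] pow[of l] Suc.prems by simp
    then have "R (c l * f l)" using cf(1)[of l] Suc.prems by (intro R_mult) simp_all
    then show ?case using Suc by (simp add: R_add)
  qed
  then have sum: "R (\<Sum>j<k. c j * f j)" by blast
  then have "1 - (\<Sum>j<k. c j * f j) \<in> S"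
    using S(2)[OF S(1) Sm, of "\<Sum>j<k. c j * f j"] by (simp add: R_def)
  then have "R (1 - (\<Sum>j<k. c j * f j))"
    using one unfolding R_def by (intro conjI exI[of _ 1]) simp_all
  then have "R ((\<Sum>j<k. c j * f j) + (1 - (\<Sum>j<k. c j * f j)))" by (rule R_add[OF sum])
  then show ?thesis by (simp add: R_def)
qed

subsection \<open>Localization of the equalizer\<close>

lemma enat_0_le [simp]: "enat 0 \<le> m"
  by (simp flip: zero_enat_def)

definition fpow :: "'a fun_space \<Rightarrow> ('a \<Rightarrow> complex) \<Rightarrow> nat \<Rightarrow> 'a \<Rightarrow> complex" where
  "fpow X f n = restrict (\<lambda>x. f x ^ n) (pts X)"

lemma fpow_regs: "fun_alg X \<Longrightarrow> f \<in> regs X \<Longrightarrow> fpow X f n \<in> regs X"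
  unfolding fpow_def using reg_power[OF _ regs_reg, of X f n] by (simp add: reg_def)

lemma fun_alg_hom_fpow:
  assumes X: "fun_alg X" and s: "fun_alg_hom X Y \<sigma>" and f: "f \<in> regs X"
  shows "\<sigma> (fpow X f n) = fpow Y (\<sigma> f) n"
proof (induction n)
  case 0
  have "fpow X f 0 = cfun (pts X) 1" "fpow Y (\<sigma> f) 0 = cfun (pts Y) 1"
    by (simp_all add: fpow_def cfun_def)
  then show ?case using s by (simp add: fun_alg_hom_def)
next
  case (Suc n)
  have "fpow X f (Suc n) = mulf (pts X) f (fpow X f n)"
    "fpow Y (\<sigma> f) (Suc n) = mulf (pts Y) (\<sigma> f) (fpow Y (\<sigma> f) n)"
    by (auto simp: fpow_def mulf_def)
  then show ?case using s f fpow_regs[OF X f] Suc by (simp add: fun_alg_hom_def)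
qed

text \<open>Here \<open>f\<close> is an invariant, so \<alpha> and \<beta> send it to the same
  function and both pass to the localizations. The extensions \<open>\<alpha>'\<close> and
  \<open>\<beta>'\<close> are parameters, since in the application they are given by the restricted
  action and by the projection of the smaller product.\<close>

locale loc_pair =
  fixes X :: "'a fun_space" and Y :: "'b fun_space" and \<alpha> \<beta> \<alpha>' \<beta>' :: "('a \<Rightarrow> complex) \<Rightarrow> 'b \<Rightarrow> complex"
    and f :: "'a \<Rightarrow> complex"
  assumes pair: "fun_pair X Y \<alpha> \<beta>" and f: "f \<in> regs X" "\<alpha> f = \<beta> f"
    and pair': "fun_pair (loc X f) (loc Y (\<alpha> f)) \<alpha>' \<beta>'"
    and \<alpha>': "\<And>r. r \<in> regs X \<Longrightarrow> \<alpha>' (to_loc X f r) = to_loc Y (\<alpha> f) (\<alpha> r)"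
    and \<beta>': "\<And>r. r \<in> regs X \<Longrightarrow> \<beta>' (to_loc X f r) = to_loc Y (\<alpha> f) (\<beta> r)"
begin

abbreviation "E \<equiv> eq_space X \<alpha> \<beta>"
abbreviation "E' \<equiv> eq_space (loc X f) \<alpha>' \<beta>'"
abbreviation "L \<equiv> loc X f"
abbreviation "LY \<equiv> loc Y (\<alpha> f)"
abbreviation "T \<equiv> jren (to_loc X f)"
abbreviation "TY \<equiv> jren (to_loc Y (\<alpha> f))"
abbreviation "F \<equiv> pvar (f, 0 :: nat) :: 'a jet_var mpoly"
abbreviation "G \<equiv> T F"

lemma X: "fun_alg X" and Y: "fun_alg Y" and \<alpha>: "fun_alg_hom X Y \<alpha>" and \<beta>: "fun_alg_hom X Y \<beta>"
  and L: "fun_alg L" and LY: "fun_alg LY"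
  and \<alpha>h: "fun_alg_hom L LY \<alpha>'" and \<beta>h: "fun_alg_hom L LY \<beta>'"
  using pair pair' by (auto simp: fun_pair_def)

lemma fE: "f \<in> regs E" and F_jpoly: "F \<in> jpoly m X" and F_jpolyE: "F \<in> jpoly m E"
  using f by (simp_all flip: zero_enat_def)

lemma EA: "fun_alg E" by (rule fun_alg_eq_space[OF pair])

lemma \<alpha>f: "\<alpha> f \<in> regs Y" using \<alpha> f(1) by (simp add: fun_alg_hom_def)

lemma to_loc_E: "to_loc E f = to_loc X f"
  by (simp add: to_loc_def fun_eq_iff)

text \<open>Apply \<open>s'\<close> to the equation \<open>h * f^n = a\<close> on the localization.
  It serves for \<alpha> and for \<beta>, which have the same value at \<open>f\<close>.\<close>

lemma numerator_eq:
  assumes "h \<in> regs L" "a \<in> regs X" and ha: "\<And>x. x \<in> pts X \<Longrightarrow> f x \<noteq> 0 \<Longrightarrow> h x = a x / f x ^ n"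
    and s: "fun_alg_hom X Y s" "s f = \<alpha> f" and s': "fun_alg_hom L LY s'"
    and c: "\<And>r. r \<in> regs X \<Longrightarrow> s' (to_loc X f r) = to_loc Y (\<alpha> f) (s r)"
    and y: "y \<in> pts Y" "\<alpha> f y \<noteq> 0"
  shows "s' h y * \<alpha> f y ^ n = s a y"
proof -
  have 1: "mulf (pts L) h (to_loc X f (fpow X f n)) = to_loc X f a"
    by (auto simp: mulf_def to_loc_def fpow_def ha)
  have fp: "fpow X f n \<in> regs X" by (rule fpow_regs[OF X f(1)])
  then have "to_loc X f (fpow X f n) \<in> regs L"
    using fun_alg_hom_to_loc[OF X] by (simp add: fun_alg_hom_def)
  then have "s' (mulf (pts L) h (to_loc X f (fpow X f n))) =
      mulf (pts LY) (s' h) (s' (to_loc X f (fpow X f n)))"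
    using s' assms(1) by (simp add: fun_alg_hom_def)
  also have "s' (to_loc X f (fpow X f n)) = to_loc Y (\<alpha> f) (fpow Y (\<alpha> f) n)"
    using c[OF fp] fun_alg_hom_fpow[OF X s(1) f(1)] s(2) by simp
  finally have "mulf (pts LY) (s' h) (to_loc Y (\<alpha> f) (fpow Y (\<alpha> f) n)) = to_loc Y (\<alpha> f) (s a)"
    unfolding 1 c[OF assms(2)] by simp
  from fun_cong[OF this, of y] y show ?thesis
    by (simp add: mulf_def to_loc_def fpow_def)
qed

text \<open>Invariants commute with localization at an invariant. For the numerator \<open>a\<close>
  of an invariant fraction, \<open>\<alpha> a = \<beta> a\<close> is known only where
  \<open>\<alpha> f\<close> is nonzero; for \<open>f * a\<close> the equality holds everywhere, at
  the cost of the exponent \<open>Suc n\<close>.\<close>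

lemma E'_eq: "E' = loc E f"
proof -
  have "regs E' = regs (loc E f)"
  proof (intro equalityI subsetI)
    fix h assume "h \<in> regs E'"
    then have h: "h \<in> regs L" "\<alpha>' h = \<beta>' h" by simp_all
    obtain a n where a: "a \<in> regs X" and ha: "\<And>x. x \<in> pts X \<Longrightarrow> f x \<noteq> 0 \<Longrightarrow> h x = a x / f x ^ n"
      using loc_numerator[OF X h(1)] by blast
    have "\<alpha> a y = \<beta> a y" if "y \<in> pts Y" "\<alpha> f y \<noteq> 0" for y
      using numerator_eq[OF h(1) a ha \<alpha> refl \<alpha>h \<alpha>' that]
        numerator_eq[OF h(1) a ha \<beta> f(2)[symmetric] \<beta>h \<beta>' that] h(2) by simp
    then have "mulf (pts Y) (\<alpha> f) (\<alpha> a) = mulf (pts Y) (\<alpha> f) (\<beta> a)"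
      unfolding mulf_def by (intro restrict_ext) auto
    then have "\<alpha> (mulf (pts X) f a) = \<beta> (mulf (pts X) f a)"
      using \<alpha> \<beta> f a by (simp add: fun_alg_hom_def)
    then have "mulf (pts X) f a \<in> regs E" using fun_algD(4)[OF X f(1) a] by simp
    then have "reg E (mulf (pts X) f a)" using EA regs_reg by blast
    then have "reg (loc E f) h"
      by (rule reg_loc_fracI[of _ _ _ _ "Suc n"]) (simp add: mulf_def ha)
    then show "h \<in> regs (loc E f)"
      using fun_algD(1)[OF L h(1)] by (intro reg_regs) simp_all
  next
    fix h assume h: "h \<in> regs (loc E f)"
    obtain a n where a: "a \<in> regs E" and ha: "\<And>x. x \<in> pts X \<Longrightarrow> f x \<noteq> 0 \<Longrightarrow> h x = a x / f x ^ n"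
      using loc_numerator[OF EA h] by auto
    have aX: "a \<in> regs X" "\<alpha> a = \<beta> a" using a by simp_all
    have "reg L h" by (rule reg_loc_fracI[OF regs_reg[OF X aX(1)] ha])
    then have hL: "h \<in> regs L"
      using h by (intro reg_regs) (auto simp: loc_def)
    have "\<alpha>' h = \<beta>' h"
    proof (rule extensionalityI[of _ "pts LY"])
      show "\<alpha>' h \<in> extensional (pts LY)" "\<beta>' h \<in> extensional (pts LY)"
        using \<alpha>h \<beta>h hL fun_algD(1)[OF LY] by (auto simp: fun_alg_hom_def)
      fix y assume "y \<in> pts LY"
      then have y: "y \<in> pts Y" "\<alpha> f y \<noteq> 0" by simp_all
      show "\<alpha>' h y = \<beta>' h y"
        using numerator_eq[OF hL aX(1) ha \<alpha> refl \<alpha>h \<alpha>' y]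
          numerator_eq[OF hL aX(1) ha \<beta> f(2)[symmetric] \<beta>h \<beta>' y] aX(2) y(2)
        by (metis mult_right_cancel power_not_zero)
    qed
    then show "h \<in> regs E'" using hL by simp
  qed
  then show ?thesis by simp
qed

lemma T_hom: "fun_alg_hom X L (to_loc X f)" by (rule fun_alg_hom_to_loc[OF X])

lemma T_homE: "fun_alg_hom E E' (to_loc X f)"
  unfolding E'_eq using fun_alg_hom_to_loc[OF EA, of f] by (simp add: to_loc_E)

lemma T_jpoly: "p \<in> jpoly m X \<Longrightarrow> T p \<in> jpoly m L"
  using jpoly_jren T_hom unfolding fun_alg_hom_def by blast

lemma T_jpolyE: "p \<in> jpoly m E \<Longrightarrow> T p \<in> jpoly m E'"
  using jpoly_jren T_homE unfolding fun_alg_hom_def by blast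

lemma T_\<alpha>: "p \<in> jpoly m X \<Longrightarrow> jren \<alpha>' (T p) = TY (jren \<alpha> p)"
  and T_\<beta>: "p \<in> jpoly m X \<Longrightarrow> jren \<beta>' (T p) = TY (jren \<beta> p)"
  unfolding jren_jren by (auto intro!: jren_cong simp: \<alpha>' \<beta>')

lemma T_jinv: "q \<in> jinv m X Y \<alpha> \<beta> \<Longrightarrow> T q \<in> jinv m L LY \<alpha>' \<beta>'"
  using jren_jeq[OF fun_alg_hom_to_loc[OF Y]] T_jpoly by (auto simp: jinv_def T_\<alpha> T_\<beta>)

text \<open>\<open>L1\<close> gives the kernel and \<open>L2\<close> the denominators of jet
  localization, each for \<open>X\<close> and for the algebra \<open>E\<close> of invariants, whose
  localization is \<open>E'\<close> by \<open>E'_eq\<close>.\<close>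

lemma L1X: "p \<in> jpoly m X \<Longrightarrow> T p \<in> jid m L \<Longrightarrow> \<exists>N. F ^ N * p \<in> jid m X"
  by (rule jet_localization_kernel[OF X f(1)])

lemma L1E: "p \<in> jpoly m E \<Longrightarrow> T p \<in> jid m E' \<Longrightarrow> \<exists>N. F ^ N * p \<in> jid m E"
  using jet_localization_kernel[OF EA fE, of p m] by (simp add: to_loc_E E'_eq)

lemma L2X: "q \<in> jpoly m L \<Longrightarrow> \<exists>N p. p \<in> jpoly m X \<and> jeq m L (G ^ N * q) (T p)"
  by (rule jet_localization_surj[OF X f(1)])

lemma L2E: "q \<in> jpoly m E' \<Longrightarrow> \<exists>N p. p \<in> jpoly m E \<and> jeq m E' (G ^ N * q) (T p)"
  using jet_localization_surj[OF EA fE, of q m] by (simp add: to_loc_E E'_eq)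

text \<open>The inverse \<open>1 / f\<close> is again invariant, and the relation involves no
  derivatives, so one \<open>u\<close> serves for every order \<open>m\<close>.\<close>

lemma unit: "\<exists>u\<in>jpoly m E'. \<forall>m. jeq m E' (u * G) 1"
proof
  have E'A: "fun_alg E'" by (rule fun_alg_eq_space[OF pair'])
  have ri: "reg E' (\<lambda>x. 1 / f x)" unfolding E'_eq by (rule reg_loc_inverse[OF EA])
  have rf: "reg E' f" unfolding E'_eq by (rule reg_locI[OF regs_reg[OF EA fE]])
  show "jfun E' (\<lambda>x. 1 / f x) \<in> jpoly m E'" by (rule jfun_jpoly[OF ri])
  show "\<forall>m. jeq m E' (jfun E' (\<lambda>x. 1 / f x) * G) 1"
  proof
    fix m
    have "jeq m E' (jfun E' (\<lambda>x. 1 / f x) * jfun E' f) (jfun E' (\<lambda>x. 1 / f x * f x))"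
      by (rule idl_eq_sym[OF jfun_mult[OF ri rf]])
    also have "jfun E' (\<lambda>x. 1 / f x * f x) = jfun E' (\<lambda>x. 1)" by (rule jfun_cong) simp
    also have "jeq m E' (jfun E' (\<lambda>x. 1)) 1" by (rule jfun_one)
    also have "jfun E' f = G"
      using jren_to_loc_jfun[of X f f] jfun_regs[OF X f(1)] by (simp add: jfun_def)
    finally show "jeq m E' (jfun E' (\<lambda>x. 1 / f x) * G) 1" .
  qed
qed

lemma clear_unit:
  assumes "\<forall>m. jeq m E' (u * G) 1" "jeq m L (G ^ N * q) p"
  shows "jeq m L q (u ^ N * p)"
proof -
  have "jeq m L (u * G) 1" by (rule jeq_eq_space) (use assms(1) in blast)
  then have "jeq m L ((u * G) ^ N * q) (1 ^ N * q)" by (intro idl_eq_mult idl_eq_power idl_eq_refl)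
  then have 1: "jeq m L q (u ^ N * (G ^ N * q))"
    using idl_eq_sym by (simp add: power_mult_distrib mult.assoc)
  also have "jeq m L (u ^ N * (G ^ N * q)) (u ^ N * p)" by (intro idl_eq_mult idl_eq_refl assms(2))
  finally show ?thesis .
qed

text \<open>Once denominators are cleared, the numerator is invariant only after localizing
  \<open>Y\<close>. The kernel theorem for \<open>Y\<close> turns this into invariance up to a power
  of \<open>\<alpha> f\<close>, and that power is absorbed by multiplying with a power of
  \<open>f\<close>.\<close>

lemma jinv_lift:
  assumes q: "q \<in> jinv m L LY \<alpha>' \<beta>'"
  shows "\<exists>N. \<exists>q'\<in>jinv m X Y \<alpha> \<beta>. jeq m L (G ^ N * q) (T q')"
proof -
  have qL: "q \<in> jpoly m L" "jeq m LY (jren \<alpha>' q) (jren \<beta>' q)" using q by (simp_all add: jinv_def)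
  obtain N p where p: "p \<in> jpoly m X" "jeq m L (G ^ N * q) (T p)" using L2X[OF qL(1)] by blast
  have GG: "jren \<alpha>' G = jren \<beta>' G" 
    unfolding T_\<alpha>[OF F_jpoly] T_\<beta>[OF F_jpoly] by (simp add: jren_simps f(2))
  have "jeq m LY (jren \<alpha>' (T p)) (jren \<alpha>' (G ^ N * q))"
    by (rule idl_eq_sym[OF jren_jeq[OF \<alpha>h p(2)]])
  also have "jeq m LY (jren \<alpha>' (G ^ N * q)) (jren \<beta>' (G ^ N * q))"
    unfolding jren_simps(2,7) GG by (intro idl_eq_mult idl_eq_refl qL(2))
  also have "jeq m LY (jren \<beta>' (G ^ N * q)) (jren \<beta>' (T p))"
    by (rule jren_jeq[OF \<beta>h p(2)])
  finally have "TY (jren \<alpha> p - jren \<beta> p) \<in> jid m LY"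
    using p(1) by (simp add: T_\<alpha> T_\<beta> jren_simps idl_eq_def)
  moreover have "jren \<alpha> p - jren \<beta> p \<in> jpoly m Y"
    using p(1) \<alpha> \<beta> by (intro jpoly_intros) (auto intro!: jpoly_jren simp: fun_alg_hom_def)
  ultimately obtain K where K: "pvar (\<alpha> f, 0) ^ K * (jren \<alpha> p - jren \<beta> p) \<in> jid m Y"
    using jet_localization_kernel[OF Y \<alpha>f] by blast
  have "jeq m Y (jren \<alpha> (F ^ K * p)) (jren \<beta> (F ^ K * p))"
    using K by (simp add: jren_simps idl_eq_def f(2) algebra_simps)
  moreover have "F ^ K * p \<in> jpoly m X" using p(1) F_jpoly by (intro jpoly_intros)
  ultimately have "F ^ K * p \<in> jinv m X Y \<alpha> \<beta>" by (simp add: jinv_def)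
  moreover have "jeq m L (G ^ (K + N) * q) (T (F ^ K * p))"
    unfolding power_add mult.assoc jren_simps(2,7) by (intro idl_eq_mult idl_eq_refl p(2))
  ultimately show ?thesis by blast
qed

text \<open>Denominators are cleared twice: to replace \<open>p\<close> by a polynomial in jets of
  \<open>E\<close>, and to make that polynomial vanish in the jets of \<open>X\<close>. There
  injectivity applies, and the powers of \<open>G\<close> are undone with the inverse
  \<open>u\<close>.\<close>

theorem jinj_loc:
  assumes "jinj m X \<alpha> \<beta>" shows "jinj m L \<alpha>' \<beta>'"
  unfolding jinj_def
proof (intro ballI impI)
  fix p assume p: "p \<in> jpoly m E'" "p \<in> jid m L"
  obtain N p' where p': "p' \<in> jpoly m E" "jeq m E' (G ^ N * p) (T p')" using L2E[OF p(1)] by blast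
  have "T p' \<in> jid m L"
    using idl_eq_span[OF jeq_eq_space[OF p'(2)]] idl_mult_left[OF p(2)] by blast
  then obtain K where "F ^ K * p' \<in> jid m X" using L1X[OF jpoly_eq_space[OF p'(1)]] by blast
  moreover have "F ^ K * p' \<in> jpoly m E" using p'(1) F_jpolyE by (intro jpoly_intros)
  ultimately have "F ^ K * p' \<in> jid m E" using assms by (simp add: jinj_def)
  then have TF: "T (F ^ K * p') \<in> jid m E'" by (rule jren_jid[OF T_homE])
  have "jeq m E' (G ^ (K + N) * p) (T (F ^ K * p'))"
    unfolding power_add mult.assoc jren_simps(2,7) by (intro idl_eq_mult idl_eq_refl p'(2))
  with TF have Gp: "G ^ (K + N) * p \<in> jid m E'" using idl_eq_span by blast
  obtain u where u: "\<forall>m. jeq m E' (u * G) 1" using unit[of m] by blast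
  have "jeq m E' ((u * G) ^ (K + N) * p) (1 ^ (K + N) * p)"
    using u by (intro idl_eq_mult idl_eq_power idl_eq_refl) blast
  moreover have "(u * G) ^ (K + N) * p = u ^ (K + N) * (G ^ (K + N) * p)"
    by (simp add: power_mult_distrib mult.assoc)
  ultimately show "p \<in> jid m E'"
    using idl_mult_left[OF Gp, of "u ^ (K + N)"] idl_eq_span by fastforce
qed

theorem jsurj_loc:
  assumes "jsurj m X Y \<alpha> \<beta>" shows "jsurj m L LY \<alpha>' \<beta>'"
  unfolding jsurj_def
proof
  fix q assume "q \<in> jinv m L LY \<alpha>' \<beta>'"
  then obtain N q' where q': "q' \<in> jinv m X Y \<alpha> \<beta>" "jeq m L (G ^ N * q) (T q')"
    using jinv_lift by blast
  then obtain p where p: "p \<in> jpoly m E" "jeq m X q' p" using assms by (auto simp: jsurj_def)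
  obtain u where u: "u \<in> jpoly m E'" "\<forall>m. jeq m E' (u * G) 1" using unit[of m] by blast
  have "jeq m L (G ^ N * q) (T p)"
    using q'(2) jren_jeq[OF T_hom p(2)] by (rule idl_eq_trans)
  then have "jeq m L q (u ^ N * T p)" by (rule clear_unit[OF u(2)])
  moreover have "u ^ N * T p \<in> jpoly m E'" using u(1) T_jpolyE[OF p(1)] by (intro jpoly_intros)
  ultimately show "\<exists>p\<in>jpoly m E'. jeq m L q p" by blast
qed

lemma jdiff_T: "p \<in> jdiff A \<Longrightarrow> T p \<in> jdiff (T ` A)"
  by (induction rule: jdiff.induct) (auto simp: jren_simps jren_D intro: jdiff.intros)

text \<open>The inverse of \<open>f\<close> joins the images of the generators; it divides out the
  power of \<open>G\<close> left by \<open>jinv_lift\<close>.\<close>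

theorem jdfin_loc:
  assumes "jdfin X Y \<alpha> \<beta>" shows "jdfin L LY \<alpha>' \<beta>'"
proof -
  obtain A where A: "finite A" "A \<subseteq> jinv \<infinity> X Y \<alpha> \<beta>"
    and gen: "\<And>q. q \<in> jinv \<infinity> X Y \<alpha> \<beta> \<Longrightarrow> \<exists>p\<in>jdiff A. jeq \<infinity> X q p"
    using assms unfolding jdfin_def by blast
  obtain u where u: "u \<in> jpoly \<infinity> E'" "\<forall>m. jeq m E' (u * G) 1" using unit[of \<infinity>] by blast
  let ?B = "insert u (T ` A)"
  have "\<exists>p\<in>jdiff ?B. jeq \<infinity> L q p" if q: "q \<in> jinv \<infinity> L LY \<alpha>' \<beta>'" for q
  proof -
    obtain N q' where q': "q' \<in> jinv \<infinity> X Y \<alpha> \<beta>" "jeq \<infinity> L (G ^ N * q) (T q')"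
      using jinv_lift[OF q] by blast
    then obtain p where p: "p \<in> jdiff A" "jeq \<infinity> X q' p" using gen by blast
    have "jeq \<infinity> L (G ^ N * q) (T p)"
      using q'(2) jren_jeq[OF T_hom p(2)] by (rule idl_eq_trans)
    then have "jeq \<infinity> L q (u ^ N * T p)" by (rule clear_unit[OF u(2)])
    moreover have "u ^ N * T p \<in> jdiff ?B"
      by (intro jdiff.mult jdiff_power jdiff.gen jdiff_mono[OF _ jdiff_T[OF p(1)]]) auto
    ultimately show ?thesis by blast
  qed
  moreover have "?B \<subseteq> jinv \<infinity> L LY \<alpha>' \<beta>'" using A(2) T_jinv jpoly_jinv[OF u(1)] by auto
  ultimately show ?thesis unfolding jdfin_def using A(1) by (intro exI[of _ ?B]) simp
qed

text \<open>On the way back to \<open>X\<close>, statements survive only up to a power of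
  \<open>f\<close> that depends on the element. These powers are removed for a whole cover in
  \<open>cover_pair\<close>.\<close>

lemma jinj_descend:
  assumes "jinj m L \<alpha>' \<beta>'" "p \<in> jpoly m E" "p \<in> jid m X"
  shows "\<exists>N. F ^ N * p \<in> jid m E"
proof -
  have "T p \<in> jid m L" by (rule jren_jid[OF T_hom assms(3)])
  then have "T p \<in> jid m E'" using assms(1) T_jpolyE[OF assms(2)] by (simp add: jinj_def)
  then show ?thesis by (rule L1E[OF assms(2)])
qed

lemma descend_eq:
  assumes "q \<in> jpoly m X" "p \<in> jpoly m X" "jeq m L (G ^ N * T q) (T p)"
  shows "\<exists>K. jeq m X (F ^ (K + N) * q) (F ^ K * p)"
proof -
  have "T (F ^ N * q - p) \<in> jid m L" using assms(3) by (simp add: idl_eq_def jren_simps)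
  moreover have "F ^ N * q - p \<in> jpoly m X" using assms F_jpoly by (intro jpoly_intros)
  ultimately obtain K where "F ^ K * (F ^ N * q - p) \<in> jid m X" using L1X by blast
  then show ?thesis unfolding idl_eq_def by (intro exI[of _ K]) (simp add: algebra_simps power_add)
qed

lemma jsurj_descend:
  assumes "jsurj m L LY \<alpha>' \<beta>'" "q \<in> jinv m X Y \<alpha> \<beta>"
  shows "\<exists>N. \<exists>p\<in>jpoly m E. jeq m X (F ^ N * q) p"
proof -
  obtain p where p: "p \<in> jpoly m E'" "jeq m L (T q) p"
    using assms(1) T_jinv[OF assms(2)] by (auto simp: jsurj_def)
  obtain N p' where p': "p' \<in> jpoly m E" "jeq m E' (G ^ N * p) (T p')" using L2E[OF p(1)] by blast
  have "jeq m L (G ^ N * T q) (G ^ N * p)" by (intro idl_eq_mult idl_eq_refl p(2))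
  also have "jeq m L (G ^ N * p) (T p')" by (rule jeq_eq_space[OF p'(2)])
  finally obtain K where "jeq m X (F ^ (K + N) * q) (F ^ K * p')"
    using descend_eq[of q m p'] assms(2) jpoly_eq_space[OF p'(1)] by (auto simp: jinv_def)
  moreover have "F ^ K * p' \<in> jpoly m E" using p'(1) F_jpolyE by (intro jpoly_intros)
  ultimately show ?thesis by blast
qed

text \<open>Denominators are cleared along the construction of a differential polynomial: sums need
  powers of \<open>F\<close> for a common denominator, and derivatives need the quotient rule with
  the derivative of \<open>F\<close>. So \<open>F\<close> has to be among the generators.\<close>

lemma jdiff_lift:
  assumes "s \<in> jdiff B" and B: "\<And>b. b \<in> B \<Longrightarrow> \<exists>N. \<exists>p\<in>A. jeq \<infinity> L (G ^ N * b) (T p)"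
  shows "\<exists>N. \<exists>p\<in>jdiff (insert F A). jeq \<infinity> L (G ^ N * s) (T p)"
  using assms(1)
proof (induction rule: jdiff.induct)
  case (gen p)
  then show ?case using B by (meson insertI2 jdiff.gen)
next
  case (const c)
  show ?case by (intro exI[of _ 0] bexI[of _ "pconst c"] jdiff.const) (simp add: jren_simps)
next
  case (add q q')
  then obtain N p N' p' where p: "p \<in> jdiff (insert F A)" "jeq \<infinity> L (G ^ N * q) (T p)"
    "p' \<in> jdiff (insert F A)" "jeq \<infinity> L (G ^ N' * q') (T p')" by blast
  have "jeq \<infinity> L (G ^ N' * (G ^ N * q) + G ^ N * (G ^ N' * q')) (G ^ N' * T p + G ^ N * T p')"
    by (intro idl_eq_add idl_eq_mult idl_eq_refl p)
  moreover have "F ^ N' * p + F ^ N * p' \<in> jdiff (insert F A)"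
    by (intro jdiff.add jdiff.mult jdiff_power p) (auto intro: jdiff.gen)
  ultimately show ?case
    by (intro exI[of _ "N + N'"] bexI[of _ "F ^ N' * p + F ^ N * p'"])
       (simp_all add: jren_simps power_add algebra_simps)
next
  case (mult q q')
  then obtain N p N' p' where p: "p \<in> jdiff (insert F A)" "jeq \<infinity> L (G ^ N * q) (T p)"
    "p' \<in> jdiff (insert F A)" "jeq \<infinity> L (G ^ N' * q') (T p')" by blast
  have "jeq \<infinity> L ((G ^ N * q) * (G ^ N' * q')) (T p * T p')"
    by (intro idl_eq_mult p)
  moreover have "p * p' \<in> jdiff (insert F A)" by (intro jdiff.mult p)
  ultimately show ?case
    by (intro exI[of _ "N + N'"] bexI[of _ "p * p'"]) (simp_all add: jren_simps power_add algebra_simps)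
next
  case (deriv q)
  then obtain N p where p: "p \<in> jdiff (insert F A)" "jeq \<infinity> L (G ^ N * q) (T p)" by blast
  let ?p = "F * jet_derivation p - of_nat N * jet_derivation F * p"
  have "F \<in> jdiff (insert F A)" by (auto intro: jdiff.gen)
  then have "?p \<in> jdiff (insert F A)"
    by (intro jdiff_diff jdiff.mult jdiff.deriv jdiff_of_nat p(1))
  moreover have "jeq \<infinity> L (G ^ Suc N * jet_derivation q) (T ?p)"
    using clear_denominator_D[OF p(2)] by (simp add: jren_simps flip: jren_D)
  ultimately show ?case by blast
qed

lemma jdfin_descend:
  assumes "jdfin L LY \<alpha>' \<beta>'"
  shows "\<exists>A. finite A \<and> A \<subseteq> jinv \<infinity> X Y \<alpha> \<beta> \<and>
    (\<forall>q\<in>jinv \<infinity> X Y \<alpha> \<beta>. \<exists>N. \<exists>p\<in>jdiff A. jeq \<infinity> X (F ^ N * q) p)"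
proof -
  obtain B where B: "finite B" "B \<subseteq> jinv \<infinity> L LY \<alpha>' \<beta>'"
    and gen: "\<And>q. q \<in> jinv \<infinity> L LY \<alpha>' \<beta>' \<Longrightarrow> \<exists>p\<in>jdiff B. jeq \<infinity> L q p"
    using assms unfolding jdfin_def by blast
  have "\<forall>b\<in>B. \<exists>N. \<exists>q'\<in>jinv \<infinity> X Y \<alpha> \<beta>. jeq \<infinity> L (G ^ N * b) (T q')" using jinv_lift B(2) by blast
  then obtain g where g: "\<And>b. b \<in> B \<Longrightarrow> g b \<in> jinv \<infinity> X Y \<alpha> \<beta>"
    "\<And>b. b \<in> B \<Longrightarrow> \<exists>N. jeq \<infinity> L (G ^ N * b) (T (g b))" by metis
  let ?A = "insert F (g ` B)"
  have A: "?A \<subseteq> jinv \<infinity> X Y \<alpha> \<beta>" using g(1) jpoly_jinv[OF F_jpolyE] by auto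
  have "\<exists>N. \<exists>p\<in>jdiff ?A. jeq \<infinity> X (F ^ N * q) p" if q: "q \<in> jinv \<infinity> X Y \<alpha> \<beta>" for q
  proof -
    obtain s where s: "s \<in> jdiff B" "jeq \<infinity> L (T q) s" using gen[OF T_jinv[OF q]] by blast
    obtain N p where p: "p \<in> jdiff ?A" "jeq \<infinity> L (G ^ N * s) (T p)"
      using jdiff_lift[OF s(1), of "g ` B"] g(2) by blast
    have "jeq \<infinity> L (G ^ N * T q) (G ^ N * s)" by (intro idl_eq_mult idl_eq_refl s(2))
    also note p(2)
    finally obtain K where "jeq \<infinity> X (F ^ (K + N) * q) (F ^ K * p)"
      using descend_eq[of q \<infinity> p] q jdiff_jinv[OF p(1) A] by (auto simp: jinv_def)
    moreover have "F ^ K * p \<in> jdiff ?A"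
      by (intro jdiff.mult jdiff_power p(1)) (auto intro: jdiff.gen)
    ultimately show ?thesis by blast
  qed
  then show ?thesis using A B(1) by (intro exI[of _ ?A]) simp
qed

end

subsection \<open>Descent from a cover\<close>

text \<open>The coefficients \<open>c j\<close> are invariant along with the \<open>f j\<close>, so
  the partition of unity is a relation between jets of invariants (\<open>one_jeq\<close>) and can
  be used to descend statements about these.\<close>

locale cover_pair =
  fixes X :: "'a fun_space" and Y :: "'b fun_space" and \<alpha> \<beta> :: "('a \<Rightarrow> complex) \<Rightarrow> 'b \<Rightarrow> complex"
    and k :: nat and c f :: "nat \<Rightarrow> 'a \<Rightarrow> complex"
    and \<alpha>' \<beta>' :: "nat \<Rightarrow> ('a \<Rightarrow> complex) \<Rightarrow> 'b \<Rightarrow> complex"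
  assumes pair: "fun_pair X Y \<alpha> \<beta>"
    and lp: "\<And>j. j < k \<Longrightarrow> loc_pair X Y \<alpha> \<beta> (\<alpha>' j) (\<beta>' j) (f j)"
    and c: "\<And>j. j < k \<Longrightarrow> c j \<in> regs (eq_space X \<alpha> \<beta>)"
    and one: "\<And>x. x \<in> pts X \<Longrightarrow> (\<Sum>j<k. c j x * f j x) = 1"
begin

abbreviation "E \<equiv> eq_space X \<alpha> \<beta>"
abbreviation "C j \<equiv> pvar (c j, 0 :: nat) :: 'a jet_var mpoly"
abbreviation "F j \<equiv> pvar (f j, 0 :: nat) :: 'a jet_var mpoly"

lemma EA: "fun_alg E" by (rule fun_alg_eq_space[OF pair])

lemma fE: "j < k \<Longrightarrow> f j \<in> regs E" by (rule loc_pair.fE[OF lp])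

lemma CF_jpoly: "j < k \<Longrightarrow> C j \<in> jpoly m E" "j < k \<Longrightarrow> F j \<in> jpoly m E"
  using c fE by (auto simp flip: zero_enat_def)

lemma one_jeq: "jeq m E 1 (\<Sum>j<k. C j * F j)"
proof -
  have r: "reg E (c j)" "reg E (f j)" if "j < k" for j using that c fE regs_reg[OF EA] by blast+
  have "jeq m E 1 (jfun E (\<lambda>x. 1))" by (rule idl_eq_sym[OF jfun_one])
  also have "jfun E (\<lambda>x. 1) = jfun E (\<lambda>x. \<Sum>j<k. c j x * f j x)"
    by (rule jfun_cong) (simp add: one)
  also have "jeq m E \<dots> (\<Sum>j<k. jfun E (\<lambda>x. c j x * f j x))"
    by (rule jfun_sum[OF EA]) (use r in \<open>auto intro: reg_mult EA\<close>)
  also have "jeq m E \<dots> (\<Sum>j<k. jfun E (c j) * jfun E (f j))"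
    by (rule idl_eq_sum) (use r in \<open>auto intro: jfun_mult\<close>)
  also have "(\<Sum>j<k. jfun E (c j) * jfun E (f j)) = (\<Sum>j<k. C j * F j)"
    by (rule sum.cong) (use c fE in \<open>auto simp: jfun_regs[OF EA]\<close>)
  finally show ?thesis .
qed

lemma one_jid: "1 - (\<Sum>j<k. C j * F j) \<in> jid m E"
  using one_jeq by (simp add: idl_eq_def)

text \<open>The multipliers \<open>e\<close> in \<open>S\<close> for which \<open>e * q\<close> is
  represented in \<open>S\<close> form an ideal of \<open>S\<close> containing a power of every
  \<open>F j\<close>, hence 1. In the applications \<open>S\<close> is the ring of jets of
  invariants or a differential algebra.\<close>

lemma local_to_global:
  assumes S: "S \<subseteq> jpoly m X" "\<And>c. pconst c \<in> S" "\<And>x y. x \<in> S \<Longrightarrow> y \<in> S \<Longrightarrow> x + y \<in> S"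
      "\<And>x y. x \<in> S \<Longrightarrow> y \<in> S \<Longrightarrow> x * y \<in> S"
    and CF: "\<And>j. j < k \<Longrightarrow> C j \<in> S" "\<And>j. j < k \<Longrightarrow> F j \<in> S"
    and loc: "\<And>j. j < k \<Longrightarrow> \<exists>N. \<exists>p\<in>S. jeq m X (F j ^ N * q) p"
  shows "\<exists>p\<in>S. jeq m X q p"
proof -
  have S0: "0 \<in> S" "1 \<in> S" using S(2)[of 0] S(2)[of 1] by simp_all
  have Sm: "- x \<in> S" if "x \<in> S" for x using S(4)[OF S(2)[of "-1"] that] by (simp add: pconst_uminus)
  have Sp: "x ^ n \<in> S" if "x \<in> S" for x n by (induction n) (simp_all add: S0 S that)
  have Ssum: "sum g A \<in> S" if "\<And>i. i \<in> A \<Longrightarrow> g i \<in> S" for g and A :: "nat set"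
    using that by (induction A rule: infinite_finite_induct) (simp_all add: S0 S)
  define J where "J = {e \<in> S. \<exists>p\<in>S. jeq m X (e * q) p}"
  have "1 \<in> J"
  proof (rule unit_from_powers[where S = S and c = C and f = F and k = k])
    show "0 \<in> J" using S0 unfolding J_def by (auto intro!: bexI[of _ 0])
    show "x + y \<in> J" if xy: "x \<in> J" "y \<in> J" for x y
    proof -
      obtain p p' where p: "p \<in> S" "jeq m X (x * q) p" "p' \<in> S" "jeq m X (y * q) p'" "x \<in> S" "y \<in> S"
        using xy unfolding J_def by blast
      have "jeq m X ((x + y) * q) (p + p')" unfolding distrib_right by (intro idl_eq_add p)
      then show ?thesis unfolding J_def using p S by blast
    qed
    show "x * y \<in> J" if x: "x \<in> S" "y \<in> J" for x y
    proof -
      obtain p where p: "p \<in> S" "jeq m X (y * q) p" "y \<in> S" using x unfolding J_def by blast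
      have "jeq m X (x * y * q) (x * p)" unfolding mult.assoc by (intro idl_eq_mult idl_eq_refl p)
      then show ?thesis unfolding J_def using p S x by blast
    qed
    show "\<exists>n. F j ^ n \<in> J" if "j < k" for j
      using loc[OF that] Sp[OF CF(2)[OF that]] unfolding J_def by blast
    have "1 + - (\<Sum>j<k. C j * F j) \<in> S" by (intro S Sm Ssum S0 CF) auto
    moreover have "jeq m X ((1 - (\<Sum>j<k. C j * F j)) * q) 0"
      unfolding idl_eq_0 by (intro idl_mult_right jid_eq_space[OF one_jid])
    ultimately show "1 - (\<Sum>j<k. C j * F j) \<in> J" using S0 unfolding J_def by auto
  qed (auto intro: S S0 Sm CF)
  then show ?thesis by (simp add: J_def)
qed

text \<open>The multipliers that carry \<open>p\<close> into the relations between jets of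
  invariants form an ideal; local injectivity puts a power of each \<open>F j\<close> into
  it.\<close>

theorem jinj_cover:
  assumes "\<And>j. j < k \<Longrightarrow> jinj m (loc X (f j)) (\<alpha>' j) (\<beta>' j)"
  shows "jinj m X \<alpha> \<beta>"
  unfolding jinj_def
proof (intro ballI impI)
  fix p assume p: "p \<in> jpoly m E" "p \<in> jid m X"
  have "1 \<in> {e \<in> jpoly m E. e * p \<in> jid m E}"
  proof (rule unit_from_powers[where S = "jpoly m E" and c = C and f = F and k = k])
    show "\<exists>n. F j ^ n \<in> {e \<in> jpoly m E. e * p \<in> jid m E}" if "j < k" for j
      using loc_pair.jinj_descend[OF lp[OF that] assms[OF that] p]
        jpoly_intros(5)[OF CF_jpoly(2)[OF that, of m]] by blast
    show "1 - (\<Sum>j<k. C j * F j) \<in> {e \<in> jpoly m E. e * p \<in> jid m E}"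
      by (auto intro!: jpoly_intros CF_jpoly idl_mult_right[OF one_jid])
  qed (use c fE in \<open>auto simp: distrib_right mult.assoc idl.span_zero
        intro: jpoly_intros idl.span_add idl_mult_left\<close>)
  then show "p \<in> jid m E" by simp
qed

theorem jsurj_cover:
  assumes "\<And>j. j < k \<Longrightarrow> jsurj m (loc X (f j)) (loc Y (\<alpha> (f j))) (\<alpha>' j) (\<beta>' j)"
  shows "jsurj m X Y \<alpha> \<beta>"
  unfolding jsurj_def
proof
  fix q assume q: "q \<in> jinv m X Y \<alpha> \<beta>"
  show "\<exists>p\<in>jpoly m E. jeq m X q p"
  proof (rule local_to_global)
    show "jpoly m E \<subseteq> jpoly m X" using jpoly_eq_space by blast
    show "\<exists>N. \<exists>p\<in>jpoly m E. jeq m X (F j ^ N * q) p" if "j < k" for j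
      by (rule loc_pair.jsurj_descend[OF lp[OF that] assms[OF that] q])
  qed (use c fE in \<open>auto intro: jpoly_intros\<close>)
qed

theorem jdfin_cover:
  assumes "\<And>j. j < k \<Longrightarrow> jdfin (loc X (f j)) (loc Y (\<alpha> (f j))) (\<alpha>' j) (\<beta>' j)"
  shows "jdfin X Y \<alpha> \<beta>"
proof -
  have "\<forall>j<k. \<exists>A. finite A \<and> A \<subseteq> jinv \<infinity> X Y \<alpha> \<beta> \<and>
      (\<forall>q\<in>jinv \<infinity> X Y \<alpha> \<beta>. \<exists>N. \<exists>p\<in>jdiff A. jeq \<infinity> X (F j ^ N * q) p)"
    using loc_pair.jdfin_descend[OF lp assms] by blast
  then obtain A where A: "\<And>j. j < k \<Longrightarrow> finite (A j)" "\<And>j. j < k \<Longrightarrow> A j \<subseteq> jinv \<infinity> X Y \<alpha> \<beta>"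
    "\<And>j q. j < k \<Longrightarrow> q \<in> jinv \<infinity> X Y \<alpha> \<beta> \<Longrightarrow> \<exists>N. \<exists>p\<in>jdiff (A j). jeq \<infinity> X (F j ^ N * q) p"
    by metis
  \<comment> \<open>The local generators together with the partition of unity, which must lie in the
    differential algebra for \<open>local_to_global\<close>.\<close>
  define B where "B = (\<Union>j<k. A j) \<union> C ` {..<k} \<union> F ` {..<k}"
  have "finite B" using A(1) by (auto simp: B_def)
  moreover have B: "B \<subseteq> jinv \<infinity> X Y \<alpha> \<beta>"
    using A(2) jpoly_jinv[OF CF_jpoly(1)] jpoly_jinv[OF CF_jpoly(2)] unfolding B_def by blast
  moreover have "\<exists>p\<in>jdiff B. jeq \<infinity> X q p" if q: "q \<in> jinv \<infinity> X Y \<alpha> \<beta>" for q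
  proof (rule local_to_global)
    show "jdiff B \<subseteq> jpoly \<infinity> X" using jdiff_jinv[OF _ B] by (auto simp: jinv_def)
    show "C j \<in> jdiff B" "F j \<in> jdiff B" if "j < k" for j
      using that by (auto simp: B_def intro!: jdiff.gen)
    show "\<exists>N. \<exists>p\<in>jdiff B. jeq \<infinity> X (F j ^ N * q) p" if j: "j < k" for j
    proof -
      have "A j \<subseteq> B" using j by (auto simp: B_def)
      then show ?thesis using A(3)[OF j q] jdiff_mono by blast
    qed
  qed (auto intro: jdiff.intros)
  ultimately show ?thesis unfolding jdfin_def by blast
qed

end

section \<open>Jet rings as quotients\<close>

lemma jet_poly_ring_simps [simp]:
  "carrier (jet_poly_ring m X) = jpoly m X" "x \<otimes>\<^bsub>jet_poly_ring m X\<^esub> y = x * y"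
  "x \<oplus>\<^bsub>jet_poly_ring m X\<^esub> y = x + y" "\<one>\<^bsub>jet_poly_ring m X\<^esub> = 1" "\<zero>\<^bsub>jet_poly_ring m X\<^esub> = 0"
  by (simp_all add: jet_poly_ring_def jpoly_def pring_def)

lemma cring_jet_poly_ring: "cring (jet_poly_ring m X)"
proof (rule cringI)
  show "abelian_group (jet_poly_ring m X)"
  proof (rule abelian_groupI)
    show "\<exists>y\<in>carrier (jet_poly_ring m X). y \<oplus>\<^bsub>jet_poly_ring m X\<^esub> x = \<zero>\<^bsub>jet_poly_ring m X\<^esub>"
      if "x \<in> carrier (jet_poly_ring m X)" for x
      using that jpoly_intros(3)[of x m X] by (intro bexI[of _ "- x"]) simp_all
  qed (auto intro: jpoly_intros simp: add_ac)
  show "Group.comm_monoid (jet_poly_ring m X)"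
    by (rule comm_monoidI) (auto intro: jpoly_intros simp: mult_ac)
qed (simp add: distrib_right)

definition jproj :: "enat \<Rightarrow> 'a fun_space \<Rightarrow> 'a jet_var mpoly \<Rightarrow> 'a jet_var mpoly" where
  "jproj m X = phom pconst (\<lambda>v. if v \<in> regs X \<times> {i. enat i \<le> m} then pvar v else 0)"

lemma jproj_jpoly: "jproj m X p \<in> jpoly m X"
  unfolding jproj_def jpoly_def by (rule phom_in_pring[OF pring_UNIV]) auto

lemma jproj_id: "p \<in> jpoly m X \<Longrightarrow> jproj m X p = p"
  unfolding jproj_def jpoly_def
  using phom_cong[OF chom_pconst, of "regs X \<times> {i. enat i \<le> m}" _ pvar p] by (simp add: phom_pvar_id)

text \<open>
  \<open>jid\<close> is an ideal of the polynomials in all variables; \<open>jproj\<close> retracts it to the ideal of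
  \<open>jet_poly_ring\<close> that has the same generators.
\<close>

lemma jet_ideal_eq:
  assumes X: "fun_alg X"
  shows "jet_ideal m X = jid m X \<inter> jpoly m X"
proof -
  interpret R: cring "jet_poly_ring m X" by (rule cring_jet_poly_ring)
  have gen: "{(jet_derivation ^^ k) f | k f. enat k \<le> m \<and> f \<in> alg_relations X} = jrel m X"
    by (simp add: jrel_def)
  have sub: "jrel m X \<subseteq> jpoly m X" using jrel_jpoly[OF X] by blast
  interpret I: ideal "jet_ideal m X" "jet_poly_ring m X"
    unfolding jet_ideal_def gen by (rule R.genideal_ideal) (simp add: sub)
  have self: "jrel m X \<subseteq> jet_ideal m X"
    unfolding jet_ideal_def gen using R.genideal_self[of "jrel m X"] sub by simp
  have "ideal (jid m X \<inter> jpoly m X) (jet_poly_ring m X)"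
  proof (rule idealI)
    show "ring (jet_poly_ring m X)" by (rule R.ring_axioms)
    show "subgroup (jid m X \<inter> jpoly m X) (add_monoid (jet_poly_ring m X))"
    proof (rule group.subgroupI)
      show "Group.group (add_monoid (jet_poly_ring m X))" by (rule R.a_group)
      show "jid m X \<inter> jpoly m X \<noteq> {}" using idl.span_zero jpoly_const(3) by blast
      fix a assume a: "a \<in> jid m X \<inter> jpoly m X"
      have "- a \<in> jid m X \<inter> jpoly m X" using a by (auto intro: idl.span_neg jpoly_intros)
      moreover have "inv\<^bsub>add_monoid (jet_poly_ring m X)\<^esub> a = - a"
        using R.minus_equality[of "- a" a] a calculation unfolding a_inv_def by simp
      ultimately show "inv\<^bsub>add_monoid (jet_poly_ring m X)\<^esub> a \<in> jid m X \<inter> jpoly m X" by simp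
    qed (auto intro: idl.span_add jpoly_intros(1))
  qed (auto intro: idl_mult_left idl_mult_right jpoly_intros(2))
  then have 1: "jet_ideal m X \<subseteq> jid m X \<inter> jpoly m X"
    unfolding jet_ideal_def gen using sub by (intro R.genideal_minimal) (auto intro: idl.span_base)
  have "jproj m X p \<in> jet_ideal m X" if "p \<in> jid m X" for p
    using that
  proof (induction rule: idl.span_induct_alt)
    case base
    then show ?case using I.zero_closed by (simp add: jproj_def)
  next
    case (step c x y)
    have "jproj m X (c * x + y) = jproj m X c * x + jproj m X y"
      using jproj_id[of x m X] sub step(1) by (auto simp: jproj_def phom_simps[OF chom_pconst])
    moreover have "jproj m X c * x \<in> jet_ideal m X"
      using I.I_l_closed[of x "jproj m X c"] self step(1) jproj_jpoly by auto
    ultimately show ?case using I.a_closed step(2) by fastforce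
  qed
  then have "jid m X \<inter> jpoly m X \<subseteq> jet_ideal m X" using jproj_id by fastforce
  with 1 show ?thesis by blast
qed

lemma jet_class_eq:
  assumes X: "fun_alg X" and p: "p \<in> jpoly m X"
  shows "jet_class m X p = {q \<in> jpoly m X. jeq m X q p}"
proof -
  have "jet_class m X p = {i + p | i. i \<in> jid m X \<inter> jpoly m X}"
    unfolding jet_class_def a_r_coset_def' jet_ideal_eq[OF X] by auto
  also have "\<dots> = {q \<in> jpoly m X. jeq m X q p}"
  proof (intro equalityI subsetI)
    fix q assume "q \<in> {q \<in> jpoly m X. jeq m X q p}"
    then have "q - p \<in> jid m X \<inter> jpoly m X"
      using p by (simp add: idl_eq_def jpoly_intros(4))
    then show "q \<in> {i + p | i. i \<in> jid m X \<inter> jpoly m X}"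
      by (intro CollectI exI[of _ "q - p"]) simp
  qed (use p in \<open>auto simp: idl_eq_def intro: jpoly_intros(1)\<close>)
  finally show ?thesis .
qed

lemma jet_class_eq_iff:
  assumes X: "fun_alg X" and "p \<in> jpoly m X" "q \<in> jpoly m X"
  shows "jet_class m X p = jet_class m X q \<longleftrightarrow> jeq m X p q"
  unfolding jet_class_eq[OF X assms(2)] jet_class_eq[OF X assms(3)]
  using assms(2) by (auto intro: idl_eq_trans idl_eq_sym)

lemma carrier_jet_ring: "carrier (jet_ring m X) = jet_class m X ` jpoly m X"
  unfolding jet_ring_def FactRing_def A_RCOSETS_def' jet_class_def by auto

lemma ideal_jet_ideal:
  assumes X: "fun_alg X" shows "ideal (jet_ideal m X) (jet_poly_ring m X)"
proof -
  interpret R: cring "jet_poly_ring m X" by (rule cring_jet_poly_ring)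
  show ?thesis unfolding jet_ideal_def
    by (rule R.genideal_ideal) (use jrel_jpoly[OF X] in \<open>auto simp: jrel_def\<close>)
qed

lemma jet_ring_ops:
  assumes X: "fun_alg X" and "p \<in> jpoly m X" "q \<in> jpoly m X"
  shows "jet_class m X p \<oplus>\<^bsub>jet_ring m X\<^esub> jet_class m X q = jet_class m X (p + q)"
    "jet_class m X p \<otimes>\<^bsub>jet_ring m X\<^esub> jet_class m X q = jet_class m X (p * q)"
    "\<one>\<^bsub>jet_ring m X\<^esub> = jet_class m X 1"
proof -
  interpret R: cring "jet_poly_ring m X" by (rule cring_jet_poly_ring)
  interpret I: ideal "jet_ideal m X" "jet_poly_ring m X" by (rule ideal_jet_ideal[OF X])
  show "jet_class m X p \<oplus>\<^bsub>jet_ring m X\<^esub> jet_class m X q = jet_class m X (p + q)"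
    using assms I.a_rcos_sum[of p q] by (simp add: jet_ring_def FactRing_def jet_class_def)
  show "jet_class m X p \<otimes>\<^bsub>jet_ring m X\<^esub> jet_class m X q = jet_class m X (p * q)"
    using assms I.rcoset_mult_add[of p q] by (simp add: jet_ring_def FactRing_def jet_class_def)
  show "\<one>\<^bsub>jet_ring m X\<^esub> = jet_class m X 1"
    by (simp add: jet_ring_def FactRing_def jet_class_def)
qed

text \<open>Renaming along an algebra homomorphism preserves the relations, so the union in the
  definition is over a constant family.\<close>

lemma jet_comorphism_class:
  assumes X: "fun_alg X" and Y: "fun_alg Y" and h: "fun_alg_hom Y X (pullback X \<phi>)"
    and p: "p \<in> jpoly m Y"
  shows "jet_comorphism m X \<phi> (jet_class m Y p) = jet_class m X (jren (pullback X \<phi>) p)"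
proof -
  have jp: "jren (pullback X \<phi>) q \<in> jpoly m X" if "q \<in> jpoly m Y" for q
    using h by (intro jpoly_jren[OF that]) (auto simp: fun_alg_hom_def)
  have all: "jet_class m X (jren (pullback X \<phi>) q) = jet_class m X (jren (pullback X \<phi>) p)"
    if "q \<in> jet_class m Y p" for q
    using that p jp jren_jeq[OF h] by (auto simp: jet_class_eq[OF Y p] jet_class_eq_iff[OF X])
  have "p \<in> jet_class m Y p" using p by (simp add: jet_class_eq[OF Y p])
  then show ?thesis
    unfolding jet_comorphism_def jren_def[symmetric] by (rule UN_constant_eq) (intro ballI all)
qed

lemma jet_D_class:
  assumes X: "fun_alg X" and p: "p \<in> jpoly \<infinity> X"
  shows "jet_D X (jet_class \<infinity> X p) = jet_class \<infinity> X (jet_derivation p)"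
proof -
  have jp: "jet_derivation q \<in> jpoly \<infinity> X" if "q \<in> jpoly \<infinity> X" for q using jpoly_D[OF that] by simp
  have all: "jet_class \<infinity> X (jet_derivation q) = jet_class \<infinity> X (jet_derivation p)"
    if "q \<in> jet_class \<infinity> X p" for q
    using that p jp jeq_D[of \<infinity> X q p] by (auto simp: jet_class_eq[OF X p] jet_class_eq_iff[OF X])
  have "p \<in> jet_class \<infinity> X p" using p by (simp add: jet_class_eq[OF X p])
  then show ?thesis unfolding jet_D_def by (rule UN_constant_eq) (intro ballI all)
qed

lemma diff_alg_gen_class:
  assumes X: "fun_alg X" and F: "F \<subseteq> jpoly \<infinity> X"
  shows "diff_alg_gen X (jet_class \<infinity> X ` F) = jet_class \<infinity> X ` jdiff F"
proof -
  have jp: "p \<in> jpoly \<infinity> X" if "p \<in> jdiff F" for p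
    using that
  proof (induction rule: jdiff.induct)
    case (deriv p)
    then show ?case using jpoly_D[of p \<infinity> X] by simp
  qed (use F in \<open>auto intro: jpoly_intros\<close>)
  show ?thesis
  proof (intro equalityI subsetI)
    fix P assume "P \<in> diff_alg_gen X (jet_class \<infinity> X ` F)"
    then show "P \<in> jet_class \<infinity> X ` jdiff F"
    proof (induction rule: diff_alg_gen.induct)
      case (add P Q)
      then obtain p q where "p \<in> jdiff F" "q \<in> jdiff F" "P = jet_class \<infinity> X p" "Q = jet_class \<infinity> X q" by blast
      then show ?case using jdiff.add by (auto simp: jp jet_ring_ops[OF X])
    next
      case (mult P Q)
      then obtain p q where "p \<in> jdiff F" "q \<in> jdiff F" "P = jet_class \<infinity> X p" "Q = jet_class \<infinity> X q" by blast
      then show ?case using jdiff.mult by (auto simp: jp jet_ring_ops[OF X])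
    next
      case (deriv P)
      then obtain p where "p \<in> jdiff F" "P = jet_class \<infinity> X p" by blast
      then show ?case using jdiff.deriv by (auto simp: jp jet_D_class[OF X])
    qed (auto intro: jdiff.gen jdiff.const)
  next
    fix P assume "P \<in> jet_class \<infinity> X ` jdiff F"
    then obtain p where p: "p \<in> jdiff F" "P = jet_class \<infinity> X p" by blast
    from p(1) have "jet_class \<infinity> X p \<in> diff_alg_gen X (jet_class \<infinity> X ` F)"
    proof (induction rule: jdiff.induct)
      case (add p q)
      then show ?case
        using diff_alg_gen.add[OF add(3,4)] by (simp add: jp jet_ring_ops[OF X])
    next
      case (mult p q)
      then show ?case
        using diff_alg_gen.mult[OF mult(3,4)] by (simp add: jp jet_ring_ops[OF X])
    next
      case (deriv p)
      then show ?case using diff_alg_gen.deriv[OF deriv(2)] by (simp add: jp jet_D_class[OF X])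
    qed (auto intro: diff_alg_gen.gen diff_alg_gen.const)
    then show "P \<in> diff_alg_gen X (jet_class \<infinity> X ` F)" using p(2) by simp
  qed
qed

section \<open>Spaces with a group action\<close>

definition gprod :: "'g alg_group \<Rightarrow> 'a fun_space \<Rightarrow> ('g \<times> 'a) fun_space" where
  "gprod G X = prod_space (group_space G) X"

definition act_pull :: "'g alg_group \<Rightarrow> 'a fun_space \<Rightarrow> ('g \<Rightarrow> 'a \<Rightarrow> 'a) \<Rightarrow> ('a \<Rightarrow> complex) \<Rightarrow> 'g \<times> 'a \<Rightarrow> complex" where
  "act_pull G X act = pullback (gprod G X) (\<lambda>(g, x). act g x)"

definition snd_pull :: "'g alg_group \<Rightarrow> 'a fun_space \<Rightarrow> ('a \<Rightarrow> complex) \<Rightarrow> 'g \<times> 'a \<Rightarrow> complex" where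
  "snd_pull G X = pullback (gprod G X) snd"

text \<open>An action by regular maps on an algebra of functions. Affineness is carried separately
  by \<open>affine_alg\<close>, so that localizations and open subspaces can be handled through
  their functions alone.\<close>

definition gspace :: "'g alg_group \<Rightarrow> 'a fun_space \<Rightarrow> ('g \<Rightarrow> 'a \<Rightarrow> 'a) \<Rightarrow> bool" where
  "gspace G X act \<longleftrightarrow> Group.group G \<and> fun_alg (group_space G) \<and> fun_alg X \<and>
     (\<forall>g\<in>carrier G. \<forall>x\<in>pts X. act g x \<in> pts X) \<and>
     (\<forall>x\<in>pts X. act \<one>\<^bsub>G\<^esub> x = x) \<and>
     (\<forall>g\<in>carrier G. \<forall>h\<in>carrier G. \<forall>x\<in>pts X. act (g \<otimes>\<^bsub>G\<^esub> h) x = act g (act h x)) \<and>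
     (\<forall>h\<in>regs X. act_pull G X act h \<in> regs (gprod G X))"

lemma pts_group_space [simp]: "pts (group_space G) = carrier G" "regs (group_space G) = gregs G"
  by (simp_all add: group_space_def)

lemma pts_gprod [simp]: "pts (gprod G X) = carrier G \<times> pts X"
  by (simp add: gprod_def)

lemma fun_alg_hom_pullback:
  assumes "\<And>x. x \<in> pts X \<Longrightarrow> \<phi> x \<in> pts Y" "\<And>h. h \<in> regs Y \<Longrightarrow> pullback X \<phi> h \<in> regs X"
  shows "fun_alg_hom Y X (pullback X \<phi>)"
  using assms by (auto simp: fun_alg_hom_def pullback_def cfun_def addf_def mulf_def)

locale gsp =
  fixes G :: "'g alg_group" and X :: "'a fun_space" and act :: "'g \<Rightarrow> 'a \<Rightarrow> 'a"
  assumes gs: "gspace G X act"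
begin

lemma GA: "fun_alg (group_space G)" and X: "fun_alg X"
  and act_pts: "g \<in> carrier G \<Longrightarrow> x \<in> pts X \<Longrightarrow> act g x \<in> pts X"
  and grp: "Group.group G"
  and act_one: "x \<in> pts X \<Longrightarrow> act \<one>\<^bsub>G\<^esub> x = x"
  and act_mult: "g \<in> carrier G \<Longrightarrow> h \<in> carrier G \<Longrightarrow> x \<in> pts X \<Longrightarrow> act (g \<otimes>\<^bsub>G\<^esub> h) x = act g (act h x)"
  using gs by (auto simp: gspace_def)

abbreviation "Y \<equiv> gprod G X"
abbreviation "\<alpha> \<equiv> act_pull G X act"
abbreviation "\<beta> \<equiv> snd_pull G X"
abbreviation "E \<equiv> eq_space X \<alpha> \<beta>"
abbreviation "Inv \<equiv> inv_functions G X act"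

lemma Y: "fun_alg Y" unfolding gprod_def by (rule fun_alg_prod[OF GA X])

lemma \<alpha>: "fun_alg_hom X Y \<alpha>"
  unfolding act_pull_def
  by (rule fun_alg_hom_pullback) (use gs in \<open>auto simp: gspace_def act_pull_def\<close>)

lemma \<beta>: "fun_alg_hom X Y \<beta>"
  unfolding snd_pull_def
proof (rule fun_alg_hom_pullback)
  fix h assume "h \<in> regs X"
  then have "reg Y (\<lambda>z. h (snd z))"
    unfolding gprod_def by (intro reg_prod_snd GA X regs_reg)
  then show "pullback Y snd h \<in> regs Y" by (simp add: reg_def pullback_def)
qed auto

lemma pair: "fun_pair X Y \<alpha> \<beta>" using X Y \<alpha> \<beta> by (simp add: fun_pair_def)

lemma \<alpha>_eq_iff: "\<alpha> h = \<beta> h \<longleftrightarrow> (\<forall>g\<in>carrier G. \<forall>x\<in>pts X. h (act g x) = h x)"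
  by (auto simp: act_pull_def snd_pull_def pullback_def restrict_def fun_eq_iff)

lemma regs_E: "{h \<in> regs X. \<alpha> h = \<beta> h} = Inv"
  by (simp add: \<alpha>_eq_iff inv_functions_def)

lemma regs_E': "regs E = Inv" by (simp add: regs_E)

lemma EA: "fun_alg E" by (rule fun_alg_eq_space[OF pair])

section \<open>The spectrum of the invariants and the algebra \<open>E\<close>\<close>

abbreviation "Q \<equiv> quot_space G X act"
abbreviation "\<pi> \<equiv> pullback X (quot_map G X act)"

text \<open>On the invariants this is inverse to the pullback \<pi> along the quotient map. Through
  \<tau> and \<pi>, the jets of the spectrum and the jets of \<open>E\<close> differ only by the
  names of the variables.\<close>

definition \<tau> :: "('a \<Rightarrow> complex) \<Rightarrow> (('a \<Rightarrow> complex) \<Rightarrow> complex) \<Rightarrow> complex" where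
  "\<tau> h = (\<lambda>\<chi>\<in>quot_pts G X act. \<chi> h)"

lemma pts_Q: "pts Q = quot_pts G X act" and regs_Q: "regs Q = \<tau> ` Inv"
  by (auto simp: quot_space_def \<tau>_def)

lemma Inv_closed: "cfun (pts X) c \<in> Inv" "f \<in> Inv \<Longrightarrow> h \<in> Inv \<Longrightarrow> addf (pts X) f h \<in> Inv"
  "f \<in> Inv \<Longrightarrow> h \<in> Inv \<Longrightarrow> mulf (pts X) f h \<in> Inv"
  using fun_algD(2-4)[OF EA] unfolding regs_E' by simp_all

lemma quot_map_pts: "x \<in> pts X \<Longrightarrow> quot_map G X act x \<in> pts Q"
  unfolding pts_Q quot_pts_def quot_map_def
  by (auto simp: Inv_closed) (simp_all add: cfun_def addf_def mulf_def)

lemma \<pi>\<tau>: "h \<in> Inv \<Longrightarrow> \<pi> (\<tau> h) = h"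
proof -
  assume h: "h \<in> Inv"
  then have "h \<in> extensional (pts X)" using fun_algD(1)[OF X] by (simp add: inv_functions_def)
  then show ?thesis
    using h quot_map_pts
    by (intro extensionalityI[of _ "pts X"]) (auto simp: pullback_def \<tau>_def quot_map_def pts_Q)
qed

lemma \<tau>\<pi>: "r \<in> regs Q \<Longrightarrow> \<tau> (\<pi> r) = r"
  by (auto simp: regs_Q \<pi>\<tau>)

lemma \<tau>_hom: "fun_alg_hom E Q \<tau>"
proof -
  have qp: "\<chi> (cfun (pts X) c) = c" "f \<in> Inv \<Longrightarrow> h \<in> Inv \<Longrightarrow> \<chi> (addf (pts X) f h) = \<chi> f + \<chi> h"
    "f \<in> Inv \<Longrightarrow> h \<in> Inv \<Longrightarrow> \<chi> (mulf (pts X) f h) = \<chi> f * \<chi> h"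
    if "\<chi> \<in> quot_pts G X act" for \<chi> c f h
    using that by (auto simp: quot_pts_def)
  show ?thesis
    unfolding fun_alg_hom_def regs_E' regs_Q pts_Q eq_space_simps(1)
    by (auto simp: \<tau>_def cfun_def[of "quot_pts G X act"] addf_def[of "quot_pts G X act"]
        mulf_def[of "quot_pts G X act"] qp intro!: restrict_ext)
qed

lemma Q: "fun_alg Q"
proof -
  note h = \<tau>_hom[unfolded fun_alg_hom_def regs_E' eq_space_simps(1), THEN conjunct2]
  have "cfun (pts Q) c \<in> regs Q" for c
    using h Inv_closed(1) by (metis imageI regs_Q)
  moreover have "addf (pts Q) u v \<in> regs Q" "mulf (pts Q) u v \<in> regs Q"
    if uv: "u \<in> regs Q" "v \<in> regs Q" for u v
  proof -
    obtain a b where ab: "a \<in> Inv" "b \<in> Inv" "u = \<tau> a" "v = \<tau> b" using uv unfolding regs_Q by blast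
    then have "addf (pts Q) u v = \<tau> (addf (pts X) a b)" "mulf (pts Q) u v = \<tau> (mulf (pts X) a b)"
      using h by simp_all
    then show "addf (pts Q) u v \<in> regs Q" "mulf (pts Q) u v \<in> regs Q"
      using Inv_closed(2,3)[OF ab(1,2)] unfolding regs_Q by auto
  qed
  ultimately show ?thesis unfolding fun_alg_def by (auto simp: quot_space_def)
qed

lemma \<pi>_regs: "r \<in> regs Q \<Longrightarrow> \<pi> r \<in> Inv"
  by (auto simp: regs_Q \<pi>\<tau>)

lemma \<pi>_homX: "fun_alg_hom Q X \<pi>"
  by (rule fun_alg_hom_pullback[OF quot_map_pts]) (use \<pi>_regs in \<open>auto simp: inv_functions_def\<close>)

lemma jren_\<tau>_jpoly: "p \<in> jpoly m E \<Longrightarrow> jren \<tau> p \<in> jpoly m Q"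
  by (rule jpoly_jren) (auto simp: regs_Q regs_E)

lemma jren_\<pi>_jpoly: "p \<in> jpoly m Q \<Longrightarrow> jren \<pi> p \<in> jpoly m E"
  by (erule jpoly_jren) (use \<pi>_regs in \<open>simp add: regs_E\<close>)

lemma jren_\<pi>\<tau>: "p \<in> jpoly m E \<Longrightarrow> jren \<pi> (jren \<tau> p) = p"
  unfolding jren_jren by (rule jren_id) (auto simp: regs_E \<pi>\<tau>)

lemma jren_\<tau>\<pi>: "p \<in> jpoly m Q \<Longrightarrow> jren \<tau> (jren \<pi> p) = p"
  unfolding jren_jren by (rule jren_id) (auto simp: \<tau>\<pi>)

lemma quot_comorphism_class:
  "p \<in> jpoly m Q \<Longrightarrow> quot_comorphism m G X act (jet_class m Q p) = jet_class m X (jren \<pi> p)"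
  unfolding quot_comorphism_def by (rule jet_comorphism_class[OF X Q \<pi>_homX])

lemma jet_invariants_eq: "jet_invariants m G X act = jet_class m X ` jinv m X Y \<alpha> \<beta>"
proof -
  have "jet_comorphism m Y (\<lambda>(g, x). act g x) (jet_class m X p) = jet_comorphism m Y snd (jet_class m X p)
      \<longleftrightarrow> jeq m Y (jren \<alpha> p) (jren \<beta> p)" if p: "p \<in> jpoly m X" for p
  proof -
    have "jren \<alpha> p \<in> jpoly m Y" "jren \<beta> p \<in> jpoly m Y"
      using \<alpha> \<beta> by (auto intro!: jpoly_jren[OF p] simp: fun_alg_hom_def)
    then show ?thesis
      using jet_comorphism_class[OF Y X \<alpha>[unfolded act_pull_def] p]
        jet_comorphism_class[OF Y X \<beta>[unfolded snd_pull_def] p] jet_class_eq_iff[OF Y]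
      by (simp flip: act_pull_def snd_pull_def)
  qed
  then show ?thesis
    unfolding jet_invariants_def carrier_jet_ring gprod_def[symmetric] jinv_def by auto
qed

lemma jinv_jpolyX: "q \<in> jinv m X Y \<alpha> \<beta> \<Longrightarrow> q \<in> jpoly m X"
  by (simp add: jinv_def)

lemma image_quot_comorphism:
  "quot_comorphism m G X act ` carrier (jet_ring m Q) = jet_class m X ` jpoly m E"
proof -
  have "quot_comorphism m G X act ` carrier (jet_ring m Q) = jet_class m X ` jren \<pi> ` jpoly m Q"
    unfolding carrier_jet_ring image_image using quot_comorphism_class by (rule image_cong[OF refl])
  also have "jren \<pi> ` jpoly m Q = jpoly m E"
  proof (intro equalityI subsetI)
    fix p assume p: "p \<in> jpoly m E"
    then show "p \<in> jren \<pi> ` jpoly m Q"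
      using jren_\<tau>_jpoly by (intro image_eqI[of _ _ "jren \<tau> p"]) (simp_all add: jren_\<pi>\<tau>[OF p])
  qed (use jren_\<pi>_jpoly in blast)
  finally show ?thesis .
qed

theorem good_iff: "good m G X act \<longleftrightarrow> jsurj m X Y \<alpha> \<beta>"
proof -
  have "jet_class m X ` jpoly m E \<subseteq> jet_class m X ` jinv m X Y \<alpha> \<beta>" using jpoly_jinv by blast
  then have "good m G X act \<longleftrightarrow> jet_class m X ` jinv m X Y \<alpha> \<beta> \<subseteq> jet_class m X ` jpoly m E"
    unfolding good_def image_quot_comorphism jet_invariants_eq by auto
  also have "\<dots> \<longleftrightarrow> (\<forall>q\<in>jinv m X Y \<alpha> \<beta>. \<exists>p\<in>jpoly m E. jet_class m X q = jet_class m X p)"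
    by blast
  also have "\<dots> \<longleftrightarrow> jsurj m X Y \<alpha> \<beta>"
    unfolding jsurj_def
    by (intro ball_cong bex_cong refl) (simp add: jet_class_eq_iff[OF X jinv_jpolyX jpoly_eq_space])
  finally show ?thesis .
qed

text \<open>Surjectivity is \<open>good_iff\<close>. For injectivity, kernel elements are moved
  between the quotient and \<open>E\<close> by \<tau> and \<pi>, which carry relations to
  relations.\<close>

theorem very_good_iff: "very_good m G X act \<longleftrightarrow> jinj m X \<alpha> \<beta> \<and> jsurj m X Y \<alpha> \<beta>"
proof -
  let ?q = "quot_comorphism m G X act" and ?R = "(jet_ring m X)\<lparr>carrier := jet_invariants m G X act\<rparr>"
  have jX: "jren \<pi> p \<in> jpoly m X" if "p \<in> jpoly m Q" for p
    using jren_\<pi>_jpoly[OF that] jpoly_eq_space by blast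
  have hom: "?q \<in> Ring.ring_hom (jet_ring m Q) ?R"
  proof (rule ring_hom_memI)
    fix P assume "P \<in> carrier (jet_ring m Q)"
    then have "?q P \<in> jet_class m X ` jpoly m E" using image_quot_comorphism[of m] by blast
    moreover have "jpoly m E \<subseteq> jinv m X Y \<alpha> \<beta>" using jpoly_jinv by blast
    ultimately show "?q P \<in> carrier ?R" unfolding jet_invariants_eq by (simp add: subset_iff image_iff) blast
  next
    fix P R assume "P \<in> carrier (jet_ring m Q)" "R \<in> carrier (jet_ring m Q)"
    then obtain p r where p: "p \<in> jpoly m Q" "r \<in> jpoly m Q" "P = jet_class m Q p" "R = jet_class m Q r"
      unfolding carrier_jet_ring by blast
    note ops = p(3,4) jet_ring_ops(1,2)[OF Q p(1,2)] jet_ring_ops(1,2)[OF X jX[OF p(1)] jX[OF p(2)]]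
      quot_comorphism_class[OF p(1)] quot_comorphism_class[OF p(2)]
      quot_comorphism_class[OF jpoly_intros(1)[OF p(1,2)]] quot_comorphism_class[OF jpoly_intros(2)[OF p(1,2)]]
    show "?q (P \<otimes>\<^bsub>jet_ring m Q\<^esub> R) = ?q P \<otimes>\<^bsub>?R\<^esub> ?q R" "?q (P \<oplus>\<^bsub>jet_ring m Q\<^esub> R) = ?q P \<oplus>\<^bsub>?R\<^esub> ?q R"
      by (simp_all add: ops jren_simps)
  next
    show "?q \<one>\<^bsub>jet_ring m Q\<^esub> = \<one>\<^bsub>?R\<^esub>"
      using jet_ring_ops(3)[OF Q, of 1 m 1] jet_ring_ops(3)[OF X, of 1 m 1]
      by (simp add: quot_comorphism_class jren_simps)
  qed
  have "inj_on ?q (carrier (jet_ring m Q)) \<longleftrightarrow> (\<forall>p\<in>jpoly m Q. \<forall>r\<in>jpoly m Q.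
      ?q (jet_class m Q p) = ?q (jet_class m Q r) \<longrightarrow> jet_class m Q p = jet_class m Q r)"
    unfolding carrier_jet_ring inj_on_def by blast
  also have "\<dots> \<longleftrightarrow> (\<forall>p\<in>jpoly m Q. \<forall>r\<in>jpoly m Q. jeq m X (jren \<pi> p) (jren \<pi> r) \<longrightarrow> jeq m Q p r)"
    by (intro ball_cong refl)
       (simp add: quot_comorphism_class jet_class_eq_iff[OF X jX jX] jet_class_eq_iff[OF Q])
  also have "\<dots> \<longleftrightarrow> jinj m X \<alpha> \<beta>"
  proof
    assume inj: "\<forall>p\<in>jpoly m Q. \<forall>r\<in>jpoly m Q. jeq m X (jren \<pi> p) (jren \<pi> r) \<longrightarrow> jeq m Q p r"
    show "jinj m X \<alpha> \<beta>"
      unfolding jinj_def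
    proof (intro ballI impI)
      fix p assume p: "p \<in> jpoly m E" "p \<in> jid m X"
      then have "jeq m X (jren \<pi> (jren \<tau> p)) (jren \<pi> 0)"
        by (simp add: jren_\<pi>\<tau>[OF p(1)] jren_simps idl_eq_0)
      then have "jren \<tau> p \<in> jid m Q"
        using inj jren_\<tau>_jpoly[OF p(1)] jpoly_const(3) by (metis idl_eq_0)
      moreover have "fun_alg_hom Q E \<pi>"
        using \<pi>_homX \<pi>_regs unfolding fun_alg_hom_def regs_E' by simp
      ultimately show "p \<in> jid m E" using jren_jid jren_\<pi>\<tau>[OF p(1)] by metis
    qed
  next
    assume inj: "jinj m X \<alpha> \<beta>"
    show "\<forall>p\<in>jpoly m Q. \<forall>r\<in>jpoly m Q. jeq m X (jren \<pi> p) (jren \<pi> r) \<longrightarrow> jeq m Q p r"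
    proof (intro ballI impI)
      fix p r assume pr: "p \<in> jpoly m Q" "r \<in> jpoly m Q" "jeq m X (jren \<pi> p) (jren \<pi> r)"
      have d: "p - r \<in> jpoly m Q" using pr by (intro jpoly_intros)
      have "jren \<pi> (p - r) \<in> jid m X" using pr(3) by (simp add: idl_eq_def jren_simps)
      then have "jren \<pi> (p - r) \<in> jid m E" using inj jren_\<pi>_jpoly[OF d] by (simp add: jinj_def)
      then show "jeq m Q p r" using jren_jid[OF \<tau>_hom] jren_\<tau>\<pi>[OF d] by (metis idl_eq_def)
    qed
  qed
  finally show ?thesis
    using hom good_iff[of m] unfolding very_good_def ring_iso_def bij_betw_def good_def by auto
qed

text \<open>A finite set of classes is the image of a finite set of representatives, and
  \<open>jdiff\<close> mirrors \<open>diff_alg_gen\<close> on representatives.\<close>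

theorem D_finite_iff: "D_finite G X act \<longleftrightarrow> jdfin X Y \<alpha> \<beta>"
proof
  assume "D_finite G X act"
  then have "\<exists>F. finite F \<and> F \<subseteq> jet_class \<infinity> X ` jinv \<infinity> X Y \<alpha> \<beta> \<and>
      diff_alg_gen X F = jet_class \<infinity> X ` jinv \<infinity> X Y \<alpha> \<beta>"
    unfolding D_finite_def jet_invariants_eq .
  then obtain F where F: "finite F" "F \<subseteq> jet_class \<infinity> X ` jinv \<infinity> X Y \<alpha> \<beta>"
    "diff_alg_gen X F = jet_class \<infinity> X ` jinv \<infinity> X Y \<alpha> \<beta>"
    by (elim exE conjE)
  from finite_subset_image[OF F(1,2)]
  obtain A where A: "A \<subseteq> jinv \<infinity> X Y \<alpha> \<beta>" "finite A" "F = jet_class \<infinity> X ` A"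
    by (elim exE conjE) (rule that)
  have AX: "A \<subseteq> jpoly \<infinity> X" using A(1) by (auto simp: jinv_def)
  have img: "jet_class \<infinity> X ` jdiff A = jet_class \<infinity> X ` jinv \<infinity> X Y \<alpha> \<beta>"
    using F(3) unfolding A(3) diff_alg_gen_class[OF X AX] .
  have AJ: "p \<in> jpoly \<infinity> X" if "p \<in> jdiff A" for p
    using jdiff_jinv[OF that A(1)] by (simp add: jinv_def)
  have "\<exists>p\<in>jdiff A. jeq \<infinity> X q p" if q: "q \<in> jinv \<infinity> X Y \<alpha> \<beta>" for q
  proof -
    have "jet_class \<infinity> X q \<in> jet_class \<infinity> X ` jdiff A" using img q by simp
    then obtain p where p: "p \<in> jdiff A" "jet_class \<infinity> X q = jet_class \<infinity> X p" by blast
    then show ?thesis using jet_class_eq_iff[OF X jinv_jpolyX[OF q] AJ[OF p(1)]] by (intro bexI[of _ p]) simp_all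
  qed
  then show "jdfin X Y \<alpha> \<beta>"
    unfolding jdfin_def using A(1,2) by (intro exI[of _ A] conjI ballI) simp_all
next
  assume "jdfin X Y \<alpha> \<beta>"
  then obtain A where A: "finite A" "A \<subseteq> jinv \<infinity> X Y \<alpha> \<beta>"
    "\<And>q. q \<in> jinv \<infinity> X Y \<alpha> \<beta> \<Longrightarrow> \<exists>p\<in>jdiff A. jeq \<infinity> X q p"
    unfolding jdfin_def by blast
  have AX: "A \<subseteq> jpoly \<infinity> X" using A(2) by (auto simp: jinv_def)
  have inv: "p \<in> jinv \<infinity> X Y \<alpha> \<beta>" if "p \<in> jdiff A" for p by (rule jdiff_jinv[OF that A(2)])
  have "jet_class \<infinity> X ` jdiff A = jet_class \<infinity> X ` jinv \<infinity> X Y \<alpha> \<beta>"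
  proof (intro equalityI subsetI)
    fix P assume "P \<in> jet_class \<infinity> X ` jinv \<infinity> X Y \<alpha> \<beta>"
    then obtain q where q: "q \<in> jinv \<infinity> X Y \<alpha> \<beta>" "P = jet_class \<infinity> X q" by blast
    then obtain p where "p \<in> jdiff A" "jeq \<infinity> X q p" using A(3) by blast
    then show "P \<in> jet_class \<infinity> X ` jdiff A"
      using jet_class_eq_iff[OF X jinv_jpolyX[OF q(1)] jinv_jpolyX[OF inv[of p]]] q(2)
      by (intro image_eqI[of _ _ p]) simp_all
  qed (use inv in blast)
  then show "D_finite G X act"
    unfolding D_finite_def jet_invariants_eq using A(1,2)
    by (intro exI[of _ "jet_class \<infinity> X ` A"]) (auto simp: diff_alg_gen_class[OF X AX])
qed

end

section \<open>Localization and isomorphisms of spaces with a group action\<close>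

text \<open>One predicate variable carries all three properties, so that localization, covers and
  isomorphisms are treated once for all of them.\<close>

definition jet_property ::
  "('g alg_group \<Rightarrow> 'a fun_space \<Rightarrow> ('g \<Rightarrow> 'a \<Rightarrow> 'a) \<Rightarrow> bool) \<Rightarrow> enat \<Rightarrow> bool" where
  "jet_property P m \<longleftrightarrow> P = very_good m \<or> P = good m \<or> P = D_finite"

lemma inv_functions_iff:
  "h \<in> inv_functions G X act \<longleftrightarrow> h \<in> regs X \<and> (\<forall>g\<in>carrier G. \<forall>x\<in>pts X. h (act g x) = h x)"
  by (simp add: inv_functions_def)

text \<open>Since \<open>f (g x) = f x\<close>, the pullback of \<open>a / f^n\<close> along the
  action has a power of \<open>f\<close>, read in the second variable, as its denominator;
  \<open>loc_prod\<close> turns it into a regular function on the product with the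
  localization.\<close>

lemma gspace_loc:
  assumes gs: "gspace G X act" and f: "f \<in> inv_functions G X act"
  shows "gspace G (loc X f) (restrict_act act (pts (loc X f)))"
proof -
  interpret gsp G X act by unfold_locales (rule gs)
  have fX: "f \<in> regs X" and fi: "\<And>g x. g \<in> carrier G \<Longrightarrow> x \<in> pts X \<Longrightarrow> f (act g x) = f x"
    using f by (auto simp: inv_functions_iff)
  note L = fun_alg_loc[OF X regs_reg[OF X fX]]
  let ?L = "loc X f" and ?a = "restrict_act act (pts (loc X f))"
  have "act_pull G ?L ?a h \<in> regs (gprod G ?L)" if h: "h \<in> regs ?L" for h
  proof -
    obtain a n where a: "a \<in> regs X" "\<And>x. x \<in> pts X \<Longrightarrow> f x \<noteq> 0 \<Longrightarrow> h x = a x / f x ^ n"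
      using loc_numerator[OF X h] by blast
    have "\<alpha> a \<in> regs Y" using \<alpha> a(1) by (simp add: fun_alg_hom_def)
    then have "reg Y (\<alpha> a)" using Y regs_reg by blast
    then have "reg (loc Y (\<lambda>z. f (snd z))) (\<lambda>z. h (?a (fst z) (snd z)))"
      by (rule reg_loc_fracI[of _ _ _ _ n])
         (auto simp: a(2) act_pts fi restrict_act_def act_pull_def pullback_def)
    then have "reg (gprod G ?L) (\<lambda>z. h (?a (fst z) (snd z)))"
      unfolding gprod_def loc_prod[OF GA X regs_reg[OF X fX]] .
    then show ?thesis
      by (simp add: reg_def act_pull_def pullback_def case_prod_unfold)
  qed
  then show ?thesis
    using grp GA L act_one act_mult act_pts fi group.is_monoid[OF grp]
    by (auto simp: gspace_def restrict_act_def monoid.m_closed monoid.one_closed)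
qed

lemma loc_cong:
  assumes "\<And>z. z \<in> pts Z \<Longrightarrow> u z = v z" shows "loc Z u = loc Z v"
proof (rule fun_space_eqI)
  show "pts (loc Z u) = pts (loc Z v)" using assms by auto
  show "regs (loc Z u) \<subseteq> extensional (pts (loc Z u))" "regs (loc Z v) \<subseteq> extensional (pts (loc Z v))"
    by (auto simp: loc_def)
  show "reg (loc Z u) h \<longleftrightarrow> reg (loc Z v) h" for h
    unfolding reg_loc_iff using assms by (simp cong: conj_cong ball_cong)
qed

lemma gspace_loc_pair:
  assumes gs: "gspace G X act" and f: "f \<in> inv_functions G X act"
  shows "loc_pair X (gprod G X) (act_pull G X act) (snd_pull G X)
    (act_pull G (loc X f) (restrict_act act (pts (loc X f)))) (snd_pull G (loc X f)) f"
    "loc (gprod G X) (act_pull G X act f) = gprod G (loc X f)"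
proof -
  interpret gsp G X act by unfold_locales (rule gs)
  interpret L: gsp G "loc X f" "restrict_act act (pts (loc X f))"
    by unfold_locales (rule gspace_loc[OF gs f])
  have fX: "f \<in> regs X" and fi: "\<And>g x. g \<in> carrier G \<Longrightarrow> x \<in> pts X \<Longrightarrow> f (act g x) = f x"
    using f by (auto simp: inv_functions_iff)
  have ab: "\<alpha> f = \<beta> f" using fi by (simp add: \<alpha>_eq_iff)
  have "loc Y (\<alpha> f) = loc Y (\<lambda>z. f (snd z))"
    by (rule loc_cong) (auto simp: act_pull_def pullback_def fi)
  then show LY: "loc Y (\<alpha> f) = L.Y"
    unfolding gprod_def loc_prod[OF GA X regs_reg[OF X fX]] by simp
  show "loc_pair X Y \<alpha> \<beta> L.\<alpha> L.\<beta> f"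
  proof
    show "fun_pair X Y \<alpha> \<beta>" "f \<in> regs X" "\<alpha> f = \<beta> f" by (rule pair fX ab)+
    show "fun_pair (loc X f) (loc Y (\<alpha> f)) L.\<alpha> L.\<beta>" unfolding LY by (rule L.pair)
    have pY: "pts (loc Y (\<alpha> f)) = carrier G \<times> pts (loc X f)" unfolding LY by simp
    show "L.\<alpha> (to_loc X f r) = to_loc Y (\<alpha> f) (\<alpha> r)" for r
      unfolding to_loc_def pY
      by (auto simp: act_pull_def pullback_def restrict_def restrict_act_def act_pts fi fun_eq_iff)
    show "L.\<beta> (to_loc X f r) = to_loc Y (\<alpha> f) (\<beta> r)" for r
      unfolding to_loc_def pY
      by (auto simp: snd_pull_def pullback_def restrict_def fun_eq_iff)
  qed
qed

theorem jet_property_loc: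
  assumes gs: "gspace G X act" and f: "f \<in> inv_functions G X act" and P: "jet_property P m"
    and PX: "P G X act"
  shows "P G (loc X f) (restrict_act act (pts (loc X f)))"
proof -
  interpret gsp G X act by unfold_locales (rule gs)
  interpret L: gsp G "loc X f" "restrict_act act (pts (loc X f))"
    by unfold_locales (rule gspace_loc[OF gs f])
  interpret lp: loc_pair X Y \<alpha> \<beta> L.\<alpha> L.\<beta> f by (rule gspace_loc_pair(1)[OF gs f])
  note LY = gspace_loc_pair(2)[OF gs f]
  from P PX show ?thesis
    unfolding jet_property_def
    using lp.jinj_loc[of m] lp.jsurj_loc[of m] lp.jdfin_loc
    by (auto simp: very_good_iff L.very_good_iff good_iff L.good_iff D_finite_iff L.D_finite_iff LY
        simp del: pts_loc)
qed

theorem jet_property_cover: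
  fixes k :: nat
  assumes gs: "gspace G X act" and P: "jet_property P m"
    and c: "\<And>j. j < k \<Longrightarrow> c j \<in> inv_functions G X act"
    and f: "\<And>j. j < k \<Longrightarrow> f j \<in> inv_functions G X act"
    and one: "\<And>x. x \<in> pts X \<Longrightarrow> (\<Sum>j<k. c j x * f j x) = 1"
    and PL: "\<And>j. j < k \<Longrightarrow> P G (loc X (f j)) (restrict_act act (pts (loc X (f j))))"
  shows "P G X act"
proof -
  interpret gsp G X act by unfold_locales (rule gs)
  let ?a = "\<lambda>j. restrict_act act (pts (loc X (f j)))"
  interpret cp: cover_pair X Y \<alpha> \<beta> k c f "\<lambda>j. act_pull G (loc X (f j)) (?a j)" "\<lambda>j. snd_pull G (loc X (f j))"
    by (rule cover_pair.intro)
       (use pair gspace_loc_pair(1)[OF gs f] c one regs_E in \<open>auto simp del: pts_loc\<close>)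
  have L: "gsp G (loc X (f j)) (?a j)" if "j < k" for j
    by unfold_locales (rule gspace_loc[OF gs f[OF that]])
  note iffs = gsp.very_good_iff[OF L] gsp.good_iff[OF L] gsp.D_finite_iff[OF L]
  have LY: "gprod G (loc X (f j)) = loc Y (\<alpha> (f j))" if "j < k" for j
    using gspace_loc_pair(2)[OF gs f[OF that]] by simp
  from P show ?thesis
    unfolding jet_property_def
  proof (elim disjE)
    assume "P = very_good m"
    then show ?thesis using PL cp.jinj_cover[of m] cp.jsurj_cover[of m] by (simp add: very_good_iff iffs LY del: pts_loc)
  next
    assume "P = good m"
    then show ?thesis using PL cp.jsurj_cover[of m] by (simp add: good_iff iffs LY del: pts_loc)
  next
    assume "P = D_finite"
    then show ?thesis using PL cp.jdfin_cover by (simp add: D_finite_iff iffs LY del: pts_loc)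
  qed
qed

subsection \<open>Isomorphisms\<close>

lemma jdiff_jren: "p \<in> jdiff A \<Longrightarrow> jren \<sigma> p \<in> jdiff (jren \<sigma> ` A)"
  by (induction rule: jdiff.induct) (auto simp: jren_simps jren_D intro: jdiff.intros)

text \<open>In the application \<open>s\<close> and \<open>t\<close> are the pullbacks along inverse
  equivariant maps, and \<open>S\<close> and \<open>U\<close> those along their products with the
  identity of the group.\<close>

locale pair_iso =
  fixes X :: "'a fun_space" and Y :: "'b fun_space" and \<alpha> \<beta>
    and X' :: "'c fun_space" and Y' :: "'d fun_space" and \<alpha>' \<beta>' and s t S U
  assumes s: "fun_alg_hom X X' s" and t: "fun_alg_hom X' X t"
    and ts: "\<And>h. h \<in> regs X \<Longrightarrow> t (s h) = h" and st: "\<And>h. h \<in> regs X' \<Longrightarrow> s (t h) = h"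
    and S: "fun_alg_hom Y Y' S" and U: "fun_alg_hom Y' Y U"
    and S\<alpha>: "\<And>h. h \<in> regs X \<Longrightarrow> S (\<alpha> h) = \<alpha>' (s h)" and S\<beta>: "\<And>h. h \<in> regs X \<Longrightarrow> S (\<beta> h) = \<beta>' (s h)"
    and U\<alpha>: "\<And>h. h \<in> regs X' \<Longrightarrow> U (\<alpha>' h) = \<alpha> (t h)" and U\<beta>: "\<And>h. h \<in> regs X' \<Longrightarrow> U (\<beta>' h) = \<beta> (t h)"
begin

abbreviation "E \<equiv> eq_space X \<alpha> \<beta>"
abbreviation "E' \<equiv> eq_space X' \<alpha>' \<beta>'"

lemma s_regs: "h \<in> regs X \<Longrightarrow> s h \<in> regs X'" and t_regs: "h' \<in> regs X' \<Longrightarrow> t h' \<in> regs X"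
  using s t by (auto simp: fun_alg_hom_def)

lemma sE: "h \<in> regs E \<Longrightarrow> s h \<in> regs E'"
  using s_regs[of h] S\<alpha>[of h] S\<beta>[of h] by simp

lemma tE: "h \<in> regs E' \<Longrightarrow> t h \<in> regs E"
  using t_regs[of h] U\<alpha>[of h] U\<beta>[of h] by simp

lemma s_homE: "fun_alg_hom E E' s"
  using s sE unfolding fun_alg_hom_def by simp

lemma jren_st: "p \<in> jpoly m X' \<Longrightarrow> jren s (jren t p) = p"
  unfolding jren_jren by (rule jren_id) (rule st)

lemma t_jinv: "q \<in> jinv m X' Y' \<alpha>' \<beta>' \<Longrightarrow> jren t q \<in> jinv m X Y \<alpha> \<beta>"
proof -
  assume q: "q \<in> jinv m X' Y' \<alpha>' \<beta>'"
  then have qX: "q \<in> jpoly m X'" by (simp add: jinv_def)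
  have a: "jren \<alpha> (jren t q) = jren U (jren \<alpha>' q)" "jren \<beta> (jren t q) = jren U (jren \<beta>' q)"
    unfolding jren_jren by (rule jren_cong[OF _ qX], simp add: U\<alpha> U\<beta>)+
  have "jeq m Y (jren U (jren \<alpha>' q)) (jren U (jren \<beta>' q))"
    by (rule jren_jeq[OF U]) (use q in \<open>simp add: jinv_def\<close>)
  then show ?thesis using jpoly_jren[OF qX t_regs] by (simp add: jinv_def a)
qed

lemma s_jinv: "q \<in> jinv m X Y \<alpha> \<beta> \<Longrightarrow> jren s q \<in> jinv m X' Y' \<alpha>' \<beta>'"
proof -
  assume q: "q \<in> jinv m X Y \<alpha> \<beta>"
  then have qX: "q \<in> jpoly m X" by (simp add: jinv_def)
  have a: "jren \<alpha>' (jren s q) = jren S (jren \<alpha> q)" "jren \<beta>' (jren s q) = jren S (jren \<beta> q)"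
    unfolding jren_jren by (rule jren_cong[OF _ qX], simp add: S\<alpha> S\<beta>)+
  have "jeq m Y' (jren S (jren \<alpha> q)) (jren S (jren \<beta> q))"
    by (rule jren_jeq[OF S]) (use q in \<open>simp add: jinv_def\<close>)
  then show ?thesis using jpoly_jren[OF qX s_regs] by (simp add: jinv_def a)
qed

lemma jinj: "jinj m X \<alpha> \<beta> \<Longrightarrow> jinj m X' \<alpha>' \<beta>'"
  unfolding jinj_def[of m X']
proof (intro ballI impI)
  fix p assume inj: "jinj m X \<alpha> \<beta>" and p: "p \<in> jpoly m E'" "p \<in> jid m X'"
  have "jren t p \<in> jid m X" "jren t p \<in> jpoly m E"
    by (rule jren_jid[OF t p(2)], rule jpoly_jren[OF p(1) tE])
  then have "jren t p \<in> jid m E" using inj by (simp add: jinj_def)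
  then have "jren s (jren t p) \<in> jid m E'" by (rule jren_jid[OF s_homE])
  then show "p \<in> jid m E'" by (simp add: jren_st[OF jpoly_eq_space[OF p(1)]])
qed

lemma jeq_s: "q \<in> jinv m X' Y' \<alpha>' \<beta>' \<Longrightarrow> jeq m X (jren t q) p \<Longrightarrow> jeq m X' q (jren s p)"
  using jren_jeq[OF s, of m "jren t q" p] jren_st[of q m] by (simp add: jinv_def)

lemma jsurj: "jsurj m X Y \<alpha> \<beta> \<Longrightarrow> jsurj m X' Y' \<alpha>' \<beta>'"
  unfolding jsurj_def[of m X']
proof
  fix q assume sj: "jsurj m X Y \<alpha> \<beta>" and q: "q \<in> jinv m X' Y' \<alpha>' \<beta>'"
  obtain p where p: "p \<in> jpoly m E" "jeq m X (jren t q) p"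
    using sj t_jinv[OF q] unfolding jsurj_def by blast
  show "\<exists>p\<in>jpoly m E'. jeq m X' q p"
    by (intro bexI[of _ "jren s p"] jeq_s[OF q p(2)] jpoly_jren[OF p(1) sE])
qed

lemma jdfin: "jdfin X Y \<alpha> \<beta> \<Longrightarrow> jdfin X' Y' \<alpha>' \<beta>'"
proof -
  assume "jdfin X Y \<alpha> \<beta>"
  then obtain A where A: "finite A" "A \<subseteq> jinv \<infinity> X Y \<alpha> \<beta>"
    "\<And>q. q \<in> jinv \<infinity> X Y \<alpha> \<beta> \<Longrightarrow> \<exists>p\<in>jdiff A. jeq \<infinity> X q p"
    unfolding jdfin_def by blast
  have "\<exists>p\<in>jdiff (jren s ` A). jeq \<infinity> X' q p" if q: "q \<in> jinv \<infinity> X' Y' \<alpha>' \<beta>'" for q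
  proof -
    obtain p where p: "p \<in> jdiff A" "jeq \<infinity> X (jren t q) p" using A(3)[OF t_jinv[OF q]] by blast
    show ?thesis by (intro bexI[of _ "jren s p"] jeq_s[OF q p(2)] jdiff_jren[OF p(1)])
  qed
  moreover have "jren s ` A \<subseteq> jinv \<infinity> X' Y' \<alpha>' \<beta>'" using A(2) s_jinv by blast
  ultimately show ?thesis unfolding jdfin_def using A(1) by (intro exI[of _ "jren s ` A"]) simp
qed

end

lemma fun_alg_hom_gprod:
  assumes G: "fun_alg (group_space G)" and Z: "fun_alg Z" "fun_alg Z'"
    and th: "\<And>x. x \<in> pts Z' \<Longrightarrow> \<theta> x \<in> pts Z" "\<And>h. h \<in> regs Z \<Longrightarrow> pullback Z' \<theta> h \<in> regs Z'"
  shows "fun_alg_hom (gprod G Z) (gprod G Z') (pullback (gprod G Z') (\<lambda>(g, x). (g, \<theta> x)))"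
proof (rule fun_alg_hom_pullback)
  fix h assume h: "h \<in> regs (gprod G Z)"
  have "reg (gprod G Z) h" unfolding gprod_def by (rule regs_reg[OF fun_alg_prod[OF G Z(1)] h[unfolded gprod_def]])
  then obtain k :: nat and a b where ab': "\<forall>i<k. reg (group_space G) (a i) \<and> reg Z (b i)"
    and hab: "\<forall>g\<in>pts (group_space G). \<forall>y\<in>pts Z. h (g, y) = (\<Sum>i<k. a i g * b i y)"
    unfolding gprod_def reg_prod_iff[OF G Z(1)] by (elim exE conjE)
  then have ab: "\<And>i. i < k \<Longrightarrow> reg (group_space G) (a i) \<and> reg Z (b i)" by blast
  have "reg Z' (\<lambda>x. b i (\<theta> x))" if "i < k" for i
  proof -
    have "pullback Z' \<theta> (restrict (b i) (pts Z)) = restrict (\<lambda>x. b i (\<theta> x)) (pts Z')"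
      unfolding pullback_def using th(1) by (intro restrict_ext) simp
    then show ?thesis using th(2)[of "restrict (b i) (pts Z)"] ab[OF that] by (simp add: reg_def)
  qed
  then have "reg (gprod G Z') (\<lambda>z. h (fst z, \<theta> (snd z)))"
    unfolding gprod_def reg_prod_iff[OF G Z(2)] using ab hab th(1)
    by (intro exI[of _ k] exI[of _ a] exI[of _ "\<lambda>i x. b i (\<theta> x)"]) simp
  then show "pullback (gprod G Z') (\<lambda>(g, x). (g, \<theta> x)) h \<in> regs (gprod G Z')"
    by (simp add: reg_def pullback_def case_prod_unfold)
qed (use th(1) in auto)

theorem jet_property_iso:
  assumes gX: "gspace G X act" and gX': "gspace G X' act'" and P: "jet_property P m"
    and \<phi>: "\<And>x. x \<in> pts X' \<Longrightarrow> \<phi> x \<in> pts X" and \<psi>: "\<And>x. x \<in> pts X \<Longrightarrow> \<psi> x \<in> pts X'"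
    and \<phi>\<psi>: "\<And>x. x \<in> pts X \<Longrightarrow> \<phi> (\<psi> x) = x" and \<psi>\<phi>: "\<And>x. x \<in> pts X' \<Longrightarrow> \<psi> (\<phi> x) = x"
    and r\<phi>: "\<And>h. h \<in> regs X \<Longrightarrow> pullback X' \<phi> h \<in> regs X'"
    and r\<psi>: "\<And>h. h \<in> regs X' \<Longrightarrow> pullback X \<psi> h \<in> regs X"
    and equiv: "\<And>g x. g \<in> carrier G \<Longrightarrow> x \<in> pts X' \<Longrightarrow> \<phi> (act' g x) = act g (\<phi> x)"
    and PX: "P G X act"
  shows "P G X' act'"
proof -
  interpret A: gsp G X act by unfold_locales (rule gX)
  interpret B: gsp G X' act' by unfold_locales (rule gX')
  define s where "s = pullback X' \<phi>"
  define t where "t = pullback X \<psi>"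
  define S where "S = pullback B.Y (\<lambda>(g, x). (g, \<phi> x))"
  define U where "U = pullback A.Y (\<lambda>(g, x). (g, \<psi> x))"
  have equiv': "\<psi> (act g x) = act' g (\<psi> x)" if "g \<in> carrier G" "x \<in> pts X" for g x
    using equiv[OF that(1) \<psi>[OF that(2)]] that B.act_pts \<psi> \<phi>\<psi> \<psi>\<phi> by metis
  have hs: "fun_alg_hom X X' s" unfolding s_def by (rule fun_alg_hom_pullback) (use \<phi> r\<phi> in auto)
  have ht: "fun_alg_hom X' X t" unfolding t_def by (rule fun_alg_hom_pullback) (use \<psi> r\<psi> in auto)
  have ts: "t (s h) = h" if "h \<in> regs X" for h
    using fun_algD(1)[OF A.X that] \<psi> \<phi>\<psi>
    by (intro extensionalityI[of _ "pts X"]) (auto simp: s_def t_def pullback_def)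
  have st: "s (t h) = h" if "h \<in> regs X'" for h
    using fun_algD(1)[OF B.X that] \<phi> \<psi>\<phi>
    by (intro extensionalityI[of _ "pts X'"]) (auto simp: s_def t_def pullback_def)
  interpret pair_iso X A.Y A.\<alpha> A.\<beta> X' B.Y B.\<alpha> B.\<beta> s t S U
  proof
    show "fun_alg_hom A.Y B.Y S"
      unfolding S_def by (rule fun_alg_hom_gprod[OF A.GA A.X B.X]) (use \<phi> r\<phi> in auto)
    show "fun_alg_hom B.Y A.Y U"
      unfolding U_def by (rule fun_alg_hom_gprod[OF A.GA B.X A.X]) (use \<psi> r\<psi> in auto)
    show "S (A.\<alpha> h) = B.\<alpha> (s h)" "S (A.\<beta> h) = B.\<beta> (s h)" for h
      using \<phi> equiv A.act_pts B.act_pts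
      by (auto simp: S_def s_def act_pull_def snd_pull_def pullback_def restrict_def fun_eq_iff)
    show "U (B.\<alpha> h) = A.\<alpha> (t h)" "U (B.\<beta> h) = A.\<beta> (t h)" for h
      using \<psi> equiv' A.act_pts B.act_pts
      by (auto simp: U_def t_def act_pull_def snd_pull_def pullback_def restrict_def fun_eq_iff)
  qed (rule hs ht ts st; assumption)+
  from P PX show ?thesis
    unfolding jet_property_def
    using jinj[of m] jsurj[of m] jdfin
    by (auto simp: A.very_good_iff B.very_good_iff A.good_iff B.good_iff A.D_finite_iff B.D_finite_iff)
qed

section \<open>Invariant solutions of linear equations\<close>

inductive_set fspan :: "('z \<Rightarrow> complex) set \<Rightarrow> ('z \<Rightarrow> complex) set" for S where
  zero: "(\<lambda>z. 0) \<in> fspan S"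
| base: "w \<in> S \<Longrightarrow> w \<in> fspan S"
| add: "w \<in> fspan S \<Longrightarrow> w' \<in> fspan S \<Longrightarrow> (\<lambda>z. w z + w' z) \<in> fspan S"
| scale: "w \<in> fspan S \<Longrightarrow> (\<lambda>z. c * w z) \<in> fspan S"

lemma fspan_sum: "(\<And>i. i \<in> A \<Longrightarrow> f i \<in> fspan S) \<Longrightarrow> (\<lambda>z. \<Sum>i\<in>A. c i * f i z) \<in> fspan S"
proof (induction A rule: infinite_finite_induct)
  case (insert i A)
  then have "(\<lambda>z. c i * f i z + (\<Sum>i\<in>A. c i * f i z)) \<in> fspan S"
    by (intro fspan.add[OF fspan.scale]) auto
  then show ?case using insert by simp
qed (simp_all add: fspan.zero)

lemma fspan_diff: "w \<in> fspan S \<Longrightarrow> w' \<in> fspan S \<Longrightarrow> (\<lambda>z. w z - c * w' z) \<in> fspan S"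
  using fspan.add[OF _ fspan.scale[of w' S "-c"]] by fastforce

lemma fspan_insert: "w \<in> fspan (insert \<beta> B) \<Longrightarrow> \<exists>c. (\<lambda>z. w z - c * \<beta> z) \<in> fspan B"
proof (induction rule: fspan.induct)
  case zero
  show ?case by (rule exI[of _ 0]) (simp add: fspan.zero)
next
  case (base w)
  then show ?case
  proof
    assume "w = \<beta>"
    then show ?thesis by (intro exI[of _ 1]) (simp add: fspan.zero)
  qed (auto intro!: exI[of _ 0] fspan.base)
next
  case (add w w')
  then obtain c c' where "(\<lambda>z. w z - c * \<beta> z) \<in> fspan B" "(\<lambda>z. w' z - c' * \<beta> z) \<in> fspan B" by blast
  from fspan.add[OF this] show ?case by (intro exI[of _ "c + c'"]) (simp add: algebra_simps)
next
  case (scale w d)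
  then obtain c where "(\<lambda>z. w z - c * \<beta> z) \<in> fspan B" by blast
  from fspan.scale[OF this, of d] show ?case by (intro exI[of _ "d * c"]) (simp add: algebra_simps)
qed

text \<open>Point evaluations separate functions, so finitely many of them are coordinates on a
  space \<open>V\<close> of finite dimension, and \<open>b\<close> is the dual basis. In such a
  basis the matrix entries of translations are values of translates at points, hence regular on the
  group.\<close>

lemma evaluation_basis:
  fixes V B :: "('z \<Rightarrow> complex) set"
  assumes "finite B" "fspan V = V" "V \<subseteq> fspan B"
  shows "\<exists>(n::nat) y b. (\<forall>j<n. b j \<in> V) \<and> (\<forall>j<n. \<forall>l<n. b j (y l) = (if j = l then 1 else 0)) \<and>
    (\<forall>w\<in>V. \<forall>z. w z = (\<Sum>l<n. w (y l) * b l z))"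
  using assms
proof (induction B arbitrary: V rule: finite_induct)
  case empty
  have "w = (\<lambda>z. 0)" if "w \<in> fspan {}" for w :: "'z \<Rightarrow> complex"
    using that by (induction rule: fspan.induct) auto
  then show ?case using empty by (intro exI[of _ 0]) auto
next
  case (insert \<beta> B)
  note V = fspan.intros[where S = V, unfolded insert.prems(1)]
    fspan_diff[where S = V, unfolded insert.prems(1)] fspan_sum[where S = V, unfolded insert.prems(1)]
  show ?case
  proof (cases "V \<subseteq> fspan B")
    case True
    then show ?thesis using insert by blast
  next
    case False
    then obtain w1 where w1: "w1 \<in> V" "w1 \<notin> fspan B" by blast
    obtain c1 where c1: "(\<lambda>z. w1 z - c1 * \<beta> z) \<in> fspan B" using fspan_insert w1(1) insert.prems(2) by blast
    have "c1 \<noteq> 0" using c1 w1(2) by (cases "c1 = 0") simp_all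
    \<comment> \<open>The induction hypothesis is applied to this subspace; by \<open>red\<close>,
      it and \<open>w1\<close> together span \<open>V\<close>.\<close>
    define V0 where "V0 = V \<inter> fspan B"
    have "w \<in> V0" if "w \<in> fspan V0" for w
      using that by (induction rule: fspan.induct) (auto simp: V0_def intro: V fspan.intros)
    then have "fspan V0 = V0" by (auto intro: fspan.base)
    moreover have "V0 \<subseteq> fspan B" by (simp add: V0_def)
    ultimately have "\<exists>(n::nat) y b. (\<forall>j<n. b j \<in> V0) \<and>
        (\<forall>j<n. \<forall>l<n. b j (y l) = (if j = l then 1 else 0)) \<and>
        (\<forall>w\<in>V0. \<forall>z. w z = (\<Sum>l<n. w (y l) * b l z))"
      by (rule insert.IH)
    then obtain n :: nat and y b where b: "\<forall>j<n. b j \<in> V0"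
      and d: "\<forall>j<n. \<forall>l<n. b j (y l) = (if j = l then 1 else 0)"
      and rep: "\<forall>w\<in>V0. \<forall>z. w z = (\<Sum>l<n. w (y l) * b l z)"
      by (elim exE conjE) (rule that)
    have bV: "b j \<in> V" if "j < n" for j using b that by (simp add: V0_def)
    have red: "\<exists>c. (\<lambda>z. w z - c * w1 z) \<in> V0" if w: "w \<in> V" for w
    proof -
      obtain c where c: "(\<lambda>z. w z - c * \<beta> z) \<in> fspan B" using fspan_insert w insert.prems(2) by blast
      have "(\<lambda>z. (w z - c * \<beta> z) - c / c1 * (w1 z - c1 * \<beta> z)) \<in> fspan B"
        by (rule fspan_diff[OF c c1])
      also have "(\<lambda>z. (w z - c * \<beta> z) - c / c1 * (w1 z - c1 * \<beta> z)) = (\<lambda>z. w z - c / c1 * w1 z)"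
        using \<open>c1 \<noteq> 0\<close> by (simp add: field_simps)
      finally show ?thesis unfolding V0_def
        by (intro exI[of _ "c / c1"] IntI V(5)[OF w w1(1)])
    qed
    \<comment> \<open>Subtracting the part of \<open>w1\<close> seen at the old points leaves a
      function that vanishes at all of them. It is nonzero because \<open>w1\<close> is not in the
      span of \<open>B\<close>, and a point \<open>y'\<close> where it is nonzero is the new
      point.\<close>
    define u where "u z = w1 z - (\<Sum>l<n. w1 (y l) * b l z)" for z
    have sumV: "(\<lambda>z. \<Sum>l<n. w1 (y l) * b l z) \<in> V" by (rule V(6)) (simp add: bV)
    have uV: "u \<in> V" using V(5)[OF w1(1) sumV, of 1] unfolding u_def[abs_def] by simp
    have sumB: "(\<lambda>z. \<Sum>l<n. w1 (y l) * b l z) \<in> fspan B"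
      by (rule fspan_sum) (use b in \<open>simp add: V0_def\<close>)
    have "\<exists>y'. u y' \<noteq> 0"
    proof (rule ccontr)
      assume "\<not> ?thesis"
      then have "u z = 0" for z by blast
      then have "w1 = (\<lambda>z. \<Sum>l<n. w1 (y l) * b l z)"
        unfolding u_def by (rule ext[OF eq_iff_diff_eq_0[THEN iffD2]])
      then have "w1 \<in> fspan B" by (rule ssubst) (rule sumB)
      then show False using w1(2) by contradiction
    qed
    then obtain y' where y': "u y' \<noteq> 0" by blast
    have uy: "u (y l) = 0" if "l < n" for l
    proof -
      have "(\<Sum>j<n. w1 (y j) * b j (y l)) = (\<Sum>j<n. if j = l then w1 (y j) else 0)"
        by (rule sum.cong) (use d that in auto)
      then show ?thesis using that by (simp add: u_def)
    qed
    define e where "e z = inverse (u y') * u z" for z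
    have eV: "e \<in> V" using V(4)[OF uV, of "inverse (u y')"] unfolding e_def[abs_def] .
    have e: "e y' = 1" "\<And>l. l < n \<Longrightarrow> e (y l) = 0" using y' uy by (simp_all add: e_def)
    \<comment> \<open>The function \<open>e\<close> is dual to \<open>y'\<close>, and the old basis
      elements are corrected so as to vanish at \<open>y'\<close>.\<close>
    define b' where "b' j z = (if j < n then b j z - b j y' * e z else e z)" for j z
    define yy where "yy l = (if l < n then y l else y')" for l
    have rep': "w z = (\<Sum>l<n. w (y l) * b l z) + (w y' - (\<Sum>l<n. w (y l) * b l y')) * e z"
      if w: "w \<in> V" for w z
    proof -
      obtain c where c: "(\<lambda>z. w z - c * w1 z) \<in> V0" using red[OF w] by blast
      define k where "k = c * u y'"
      have ke: "k * e z = c * u z" for z using y' by (simp add: k_def e_def)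
      have wk: "(\<lambda>z. w z - k * e z) \<in> V0"
      proof -
        have "(\<lambda>z. (w z - c * w1 z) - (-c) * (\<Sum>l<n. w1 (y l) * b l z)) \<in> V0"
          using V(5)[OF _ sumV, of "\<lambda>z. w z - c * w1 z" "-c"]
            fspan_diff[OF _ sumB, of "\<lambda>z. w z - c * w1 z" "-c"] c unfolding V0_def by blast
        then show ?thesis by (simp add: ke u_def algebra_simps)
      qed
      have *: "w z - k * e z = (\<Sum>l<n. w (y l) * b l z)" for z
        unfolding bspec[OF rep wk, THEN spec, of z] by (rule sum.cong) (simp_all add: e)
      from *[of y'] have k: "w y' - (\<Sum>l<n. w (y l) * b l y') = k" by (simp add: e algebra_simps)
      show ?thesis unfolding k using *[of z] by (simp add: algebra_simps)
    qed
    show ?thesis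
    proof (intro exI conjI allI impI ballI)
      show "b' j \<in> V" for j
      proof (cases "j < n")
        case True
        then have "b' j = (\<lambda>z. b j z - b j y' * e z)" by (simp add: b'_def fun_eq_iff)
        then show ?thesis using V(5)[OF bV[OF True] eV] by simp
      next
        case False
        then have "b' j = e" by (simp add: b'_def fun_eq_iff)
        then show ?thesis using eV by simp
      qed
      show "b' j (yy l) = (if j = l then 1 else 0)" if "j < Suc n" "l < Suc n" for j l
        using that d by (auto simp: b'_def yy_def e less_Suc_eq)
      show "w z = (\<Sum>l<Suc n. w (yy l) * b' l z)" if w: "w \<in> V" for w z
      proof -
        have "(\<Sum>l<Suc n. w (yy l) * b' l z) =
            (\<Sum>l<n. w (y l) * b l z - w (y l) * b l y' * e z) + w y' * e z"
          by (simp add: b'_def yy_def algebra_simps)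
        also have "\<dots> = w z"
          unfolding rep'[OF w, of z] by (simp add: sum_subtractf sum_distrib_left algebra_simps)
        finally show ?thesis by simp
      qed
    qed
  qed
qed

text \<open>The \<open>Z i\<close> are stable so that all translates of \<open>q i\<close> still
  vanish on them. For covers they are empty; for neighbourhoods in a saturated open set some of them
  are its complement.\<close>

locale inv_equation = gsp G X act for G :: "'g alg_group" and X :: "'a fun_space" and act +
  fixes k :: nat and q h :: "nat \<Rightarrow> 'a \<Rightarrow> complex" and Z :: "nat \<Rightarrow> 'a set"
  assumes red: "reductive_group G"
    and q: "\<And>i. i < k \<Longrightarrow> q i \<in> regs X" and h: "\<And>i. i < k \<Longrightarrow> h i \<in> inv_functions G X act"
    and one: "\<And>x. x \<in> pts X \<Longrightarrow> (\<Sum>i<k. q i x * h i x) = 1"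
    and Z: "\<And>i. i < k \<Longrightarrow> Z i \<subseteq> pts X" "\<And>i g x. i < k \<Longrightarrow> g \<in> carrier G \<Longrightarrow> x \<in> Z i \<Longrightarrow> act g x \<in> Z i"
    and qZ: "\<And>i x. i < k \<Longrightarrow> x \<in> Z i \<Longrightarrow> q i x = 0"
begin

text \<open>
  The tuples \<open>(q\<^sub>0, \<dots>, q\<^sub>k\<^sub>-\<^sub>1)\<close> are functions on \<open>{..<k} \<times> pts X\<close>. The translates of \<open>q\<close> span a module
  on which \<open>w \<mapsto> \<Sum>\<^sub>i w\<^sub>i h\<^sub>i\<close> is an invariant linear form that is \<open>1\<close> on \<open>q\<close>; a complement of
  its kernel consists of invariants.
\<close>

definition tr :: "'g \<Rightarrow> (nat \<times> 'a \<Rightarrow> complex) \<Rightarrow> nat \<times> 'a \<Rightarrow> complex" where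
  "tr g w z = (if fst z < k \<and> snd z \<in> pts X then w (fst z, act (inv\<^bsub>G\<^esub> g) (snd z)) else 0)"

definition v :: "nat \<times> 'a \<Rightarrow> complex" where
  "v z = (if fst z < k \<and> snd z \<in> pts X then q (fst z) (snd z) else 0)"

definition V :: "(nat \<times> 'a \<Rightarrow> complex) set" where
  "V = fspan ((\<lambda>g. tr g v) ` carrier G)"

definition \<Theta> :: "'a \<Rightarrow> (nat \<times> 'a \<Rightarrow> complex) \<Rightarrow> complex" where
  "\<Theta> x w = (\<Sum>i<k. w (i, x) * h i x)"

interpretation Gr: Group.group G by (rule grp)

lemma hX: "i < k \<Longrightarrow> h i \<in> regs X" and hinv: "i < k \<Longrightarrow> g \<in> carrier G \<Longrightarrow> x \<in> pts X \<Longrightarrow> h i (act g x) = h i x"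
  using h by (auto simp: inv_functions_iff)

lemma fspan_V: "fspan V = V"
proof -
  have "w \<in> V" if "w \<in> fspan V" for w
    using that by (induction rule: fspan.induct) (auto simp: V_def intro: fspan.intros)
  then show ?thesis by (auto intro: fspan.base)
qed

lemma V_outside: "w \<in> V \<Longrightarrow> \<not> (fst z < k \<and> snd z \<in> pts X) \<Longrightarrow> w z = 0"
  unfolding V_def by (induction rule: fspan.induct) (auto simp: tr_def)

lemma tr_tr: "g \<in> carrier G \<Longrightarrow> g' \<in> carrier G \<Longrightarrow> tr g (tr g' w) = tr (g \<otimes>\<^bsub>G\<^esub> g') w"
  by (auto simp: tr_def fun_eq_iff Gr.inv_mult_group act_mult act_pts)

lemma tr_V: "w \<in> V \<Longrightarrow> g \<in> carrier G \<Longrightarrow> tr g w \<in> V"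
  unfolding V_def
proof (induction rule: fspan.induct)
  case zero
  have "tr g (\<lambda>z. 0) = (\<lambda>z. 0)" by (auto simp: tr_def)
  then show ?case by (simp add: fspan.zero)
next
  case (base w)
  then obtain g' where "g' \<in> carrier G" "w = tr g' v" by blast
  then show ?case using base(2) by (auto simp: tr_tr intro!: fspan.base)
next
  case (add w w')
  have "tr g (\<lambda>z. w z + w' z) = (\<lambda>z. tr g w z + tr g w' z)" by (auto simp: tr_def)
  then show ?case using add by (auto intro: fspan.add)
next
  case (scale w c)
  have "tr g (\<lambda>z. c * w z) = (\<lambda>z. c * tr g w z)" by (auto simp: tr_def)
  then show ?case using scale by (auto intro: fspan.scale)
qed

lemma tr_one: "w \<in> V \<Longrightarrow> tr \<one>\<^bsub>G\<^esub> w = w"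
  using V_outside[of w] by (auto simp: tr_def fun_eq_iff act_one)

lemma v_V: "v \<in> V"
proof -
  have "tr \<one>\<^bsub>G\<^esub> v = v" by (auto simp: tr_def v_def fun_eq_iff act_one)
  then show ?thesis unfolding V_def by (metis Gr.one_closed fspan.base imageI)
qed

lemma V_reg: "w \<in> V \<Longrightarrow> i < k \<Longrightarrow> reg X (\<lambda>x. w (i, x))"
  unfolding V_def
proof (induction rule: fspan.induct)
  case (base w)
  then obtain g where g: "g \<in> carrier G" "w = tr g v" by blast
  have "\<alpha> (q i) \<in> regs Y" using \<alpha> q[OF base(2)] by (simp add: fun_alg_hom_def)
  then have "reg (prod_space (group_space G) X) (\<alpha> (q i))" using regs_reg[OF Y] by (simp add: gprod_def)
  then obtain n :: nat and a b where ab: "\<forall>j<n. reg (group_space G) (a j) \<and> reg X (b j)"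
    and e: "\<forall>g\<in>pts (group_space G). \<forall>x\<in>pts X. \<alpha> (q i) (g, x) = (\<Sum>j<n. a j g * b j x)"
    unfolding reg_prod_iff[OF GA X] by (elim exE conjE)
  have "reg X (\<lambda>x. \<Sum>j<n. a j (inv\<^bsub>G\<^esub> g) * b j x)"
    using ab by (intro reg_sum reg_mult X reg_const) auto
  moreover have "(\<Sum>j<n. a j (inv\<^bsub>G\<^esub> g) * b j x) = w (i, x)" if "x \<in> pts X" for x
    using e[rule_format, of "inv\<^bsub>G\<^esub> g" x] that g base(2) act_pts
    by (simp add: tr_def v_def act_pull_def pullback_def)
  ultimately show ?case by (rule iffD1[OF reg_cong, rotated])
qed (simp_all add: reg_const[OF X] reg_add[OF X] reg_mult[OF X])

lemma V_Z: "w \<in> V \<Longrightarrow> i < k \<Longrightarrow> x \<in> Z i \<Longrightarrow> w (i, x) = 0"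
  unfolding V_def
  by (induction rule: fspan.induct) (use Z qZ in \<open>auto simp: tr_def v_def\<close>)

lemma \<Theta>_tr: "g \<in> carrier G \<Longrightarrow> x \<in> pts X \<Longrightarrow> \<Theta> x (tr g w) = \<Theta> (act (inv\<^bsub>G\<^esub> g) x) w"
  unfolding \<Theta>_def by (rule sum.cong) (auto simp: tr_def hinv)

text \<open>On a translate of \<open>v\<close> the form is 1 at every point, because the
  \<open>h i\<close> are invariant. By linearity its value on an element of \<open>V\<close> is the
  same at all points.\<close>

lemma \<Theta>_const: "w \<in> V \<Longrightarrow> x \<in> pts X \<Longrightarrow> x' \<in> pts X \<Longrightarrow> \<Theta> x w = \<Theta> x' w"
  unfolding V_def
proof (induction rule: fspan.induct)
  case (base w)
  have "\<Theta> x v = 1" if "x \<in> pts X" for x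
    using one[OF that] that by (simp add: \<Theta>_def v_def)
  then show ?case using base by (auto simp: \<Theta>_tr act_pts)
next
  case (scale w c)
  have "\<Theta> x (\<lambda>z. c * w z) = c * \<Theta> x w" for x by (simp add: \<Theta>_def sum_distrib_left mult_ac)
  then show ?case using scale by simp
next
  case (add w w')
  have "\<Theta> x (\<lambda>z. w z + w' z) = \<Theta> x w + \<Theta> x w'" for x
    by (simp add: \<Theta>_def sum.distrib algebra_simps)
  then show ?case using add by simp
qed (simp add: \<Theta>_def)

text \<open>Local finiteness of rational actions: as \<open>q i (g x)\<close> is a finite sum of
  products \<open>a_j(g) b_j(x)\<close>, all translates of \<open>q i\<close> lie in the span of the
  finitely many \<open>b_j\<close>.\<close>

lemma V_finite: "\<exists>B. finite B \<and> V \<subseteq> fspan B"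
proof -
  have "\<forall>i<k. \<exists>(n::nat) a b. (\<forall>j<n. reg (group_space G) (a j) \<and> reg X (b j)) \<and>
     (\<forall>g\<in>pts (group_space G). \<forall>x\<in>pts X. \<alpha> (q i) (g, x) = (\<Sum>j<n. a j g * b j x))"
  proof (intro allI impI)
    fix i assume "i < k"
    then have "\<alpha> (q i) \<in> regs Y" using \<alpha> q by (simp add: fun_alg_hom_def)
    then have "reg (prod_space (group_space G) X) (\<alpha> (q i))" using regs_reg[OF Y] by (simp add: gprod_def)
    then show "\<exists>(n::nat) a b. (\<forall>j<n. reg (group_space G) (a j) \<and> reg X (b j)) \<and>
     (\<forall>g\<in>pts (group_space G). \<forall>x\<in>pts X. \<alpha> (q i) (g, x) = (\<Sum>j<n. a j g * b j x))"
      unfolding reg_prod_iff[OF GA X] .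
  qed
  then obtain n :: "nat \<Rightarrow> nat" and a b where
    e: "\<And>i g x. i < k \<Longrightarrow> g \<in> carrier G \<Longrightarrow> x \<in> pts X \<Longrightarrow> \<alpha> (q i) (g, x) = (\<Sum>j<n i. a i j g * b i j x)"
    unfolding pts_group_space by metis
  define \<beta>' where "\<beta>' p z = (if fst z = fst p \<and> fst z < k \<and> snd z \<in> pts X then b (fst p) (snd p) (snd z) else 0)" for p z
  define I where "I = Sigma {..<k} (\<lambda>i. {..<n i})"
  have fin: "finite I" by (simp add: I_def)
  have trB: "tr g v \<in> fspan (\<beta>' ` I)" if g: "g \<in> carrier G" for g
  proof -
    have "tr g v z = (\<Sum>p\<in>I. a (fst p) (snd p) (inv\<^bsub>G\<^esub> g) * \<beta>' p z)" for z
    proof (cases "fst z < k \<and> snd z \<in> pts X")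
      case True
      have "(\<Sum>p\<in>I. a (fst p) (snd p) (inv\<^bsub>G\<^esub> g) * \<beta>' p z) =
          (\<Sum>i<k. \<Sum>j<n i. a i j (inv\<^bsub>G\<^esub> g) * \<beta>' (i, j) z)"
        unfolding I_def by (subst sum.Sigma) (auto simp: case_prod_unfold)
      also have "\<dots> = (\<Sum>i<k. if i = fst z then \<Sum>j<n i. a i j (inv\<^bsub>G\<^esub> g) * b i j (snd z) else 0)"
        by (rule sum.cong) (use True in \<open>auto simp: \<beta>'_def\<close>)
      also have "\<dots> = (\<Sum>j<n (fst z). a (fst z) j (inv\<^bsub>G\<^esub> g) * b (fst z) j (snd z))"
        using True by simp
      also have "\<dots> = \<alpha> (q (fst z)) (inv\<^bsub>G\<^esub> g, snd z)"
        using True g by (simp add: e)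
      finally show ?thesis
        using True g act_pts by (simp add: tr_def v_def act_pull_def pullback_def)
    qed (auto simp: tr_def \<beta>'_def intro!: sum.neutral[symmetric])
    then have "tr g v = (\<lambda>z. \<Sum>p\<in>I. a (fst p) (snd p) (inv\<^bsub>G\<^esub> g) * \<beta>' p z)" by blast
    then show ?thesis by (simp add: fspan_sum fspan.base)
  qed
  have "w \<in> fspan (\<beta>' ` I)" if "w \<in> V" for w
    using that[unfolded V_def] by (induction rule: fspan.induct) (use trB in \<open>auto intro: fspan.intros\<close>)
  then show ?thesis using fin by (intro exI[of _ "\<beta>' ` I"]) auto
qed

lemma inverse_gregs:
  assumes "reg (group_space G) u" shows "reg (group_space G) (\<lambda>g. u (inv\<^bsub>G\<^esub> g))"
proof -
  have "morphism (group_space G) (group_space G) (\<lambda>g. inv\<^bsub>G\<^esub> g)"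
    using red by (simp add: reductive_group_def algebraic_group_def)
  then have "pullback (group_space G) (\<lambda>g. inv\<^bsub>G\<^esub> g) (restrict u (carrier G)) \<in> gregs G"
    using assms by (simp add: morphism_def reg_def)
  moreover have "pullback (group_space G) (\<lambda>g. inv\<^bsub>G\<^esub> g) (restrict u (carrier G)) =
      restrict (\<lambda>g. u (inv\<^bsub>G\<^esub> g)) (carrier G)"
    by (auto simp: pullback_def)
  ultimately show ?thesis by (simp add: reg_def)
qed

text \<open>Restricting the pullback along the action to one orbit leaves a sum of regular functions
  on the group with constant coefficients. This makes the matrix entries below regular.\<close>

lemma orbit_gregs:
  assumes u: "reg X u" and x: "x \<in> pts X"
  shows "reg (group_space G) (\<lambda>g. u (act (inv\<^bsub>G\<^esub> g) x))"
proof -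
  have "\<alpha> (restrict u (pts X)) \<in> regs Y" using \<alpha> u by (simp add: fun_alg_hom_def reg_def)
  then have "reg (prod_space (group_space G) X) (\<alpha> (restrict u (pts X)))"
    using regs_reg[OF Y] by (simp add: gprod_def)
  then obtain n :: nat and a b where ab: "\<forall>j<n. reg (group_space G) (a j) \<and> reg X (b j)"
    and e: "\<forall>g\<in>pts (group_space G). \<forall>x\<in>pts X. \<alpha> (restrict u (pts X)) (g, x) = (\<Sum>j<n. a j g * b j x)"
    unfolding reg_prod_iff[OF GA X] by (elim exE conjE)
  have "reg (group_space G) (\<lambda>g. \<Sum>j<n. a j g * b j x)"
    using ab by (intro reg_sum reg_mult GA reg_const) auto
  moreover have "(\<Sum>j<n. a j g * b j x) = u (act g x)" if "g \<in> pts (group_space G)" for g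
    using e that x act_pts by (simp add: act_pull_def pullback_def)
  ultimately have "reg (group_space G) (\<lambda>g. u (act g x))" by (rule iffD1[OF reg_cong, rotated])
  then show ?thesis by (rule inverse_gregs)
qed

theorem invariant_solution:
  "\<exists>c. (\<forall>i<k. c i \<in> inv_functions G X act \<and> (\<forall>x\<in>Z i. c i x = 0)) \<and>
     (\<forall>x\<in>pts X. (\<Sum>i<k. c i x * h i x) = 1)"
proof (cases "pts X = {}")
  case True
  then show ?thesis
    using Z(1) fun_algD(2)[OF X, of 0]
    by (intro exI[of _ "\<lambda>i. cfun (pts X) 0"]) (auto simp: inv_functions_iff)
next
  case False
  then obtain x0 where x0: "x0 \<in> pts X" by blast
  obtain B where B: "finite B" "V \<subseteq> fspan B" using V_finite by blast
  obtain n :: nat and y b where bV: "\<And>j. j < n \<Longrightarrow> b j \<in> V"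
    and d: "\<And>j l. j < n \<Longrightarrow> l < n \<Longrightarrow> b j (y l) = (if j = l then 1 else 0)"
    and rep: "\<And>w z. w \<in> V \<Longrightarrow> w z = (\<Sum>l<n. w (y l) * b l z)"
    using evaluation_basis[OF B(1) fspan_V B(2)] by blast
  have y: "fst (y l) < k" "snd (y l) \<in> pts X" if "l < n" for l
    using d[OF that that] V_outside[OF bV[OF that], of "y l"] by auto
  \<comment> \<open>In the basis dual to the evaluation points, the coordinates of a translate are
    its values at the points \<open>y l\<close>.\<close>
  define \<rho> where "\<rho> g = mat n n (\<lambda>(l, j). tr g (b j) (y l))" for g
  have \<rho>e: "\<rho> g $$ (l, j) = tr g (b j) (y l)" if "l < n" "j < n" for g l j
    using that by (simp add: \<rho>_def)
  have "G_module G n \<rho>"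
    unfolding G_module_def
  proof (intro conjI ballI allI impI)
    show "\<rho> g \<in> carrier_mat n n" for g by (simp add: \<rho>_def)
    show "\<rho> \<one>\<^bsub>G\<^esub> = 1\<^sub>m n"
      by (rule eq_matI) (auto simp: \<rho>_def tr_one bV d)
    show "\<rho> (g \<otimes>\<^bsub>G\<^esub> g') = \<rho> g * \<rho> g'" if g: "g \<in> carrier G" "g' \<in> carrier G" for g g'
    proof (rule eq_matI)
      fix l j assume "l < dim_row (\<rho> g * \<rho> g')" "j < dim_col (\<rho> g * \<rho> g')"
      then have lj: "l < n" "j < n" by (simp_all add: \<rho>_def)
      have "tr g (tr g' (b j)) (y l) = (\<Sum>i<n. tr g' (b j) (y i) * tr g (b i) (y l))"
        using rep[OF tr_V[OF bV[OF lj(2)] g(2)], of "(fst (y l), act (inv\<^bsub>G\<^esub> g) (snd (y l)))"] y[OF lj(1)]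
        by (simp add: tr_def[of g])
      then show "\<rho> (g \<otimes>\<^bsub>G\<^esub> g') $$ (l, j) = (\<rho> g * \<rho> g') $$ (l, j)"
        using lj by (simp add: \<rho>_def tr_tr[OF g] scalar_prod_def mult.commute atLeast0LessThan)
    qed (simp_all add: \<rho>_def)
    show "(\<lambda>g\<in>carrier G. \<rho> g $$ (l, j)) \<in> gregs G" if "l < n" "j < n" for l j
    proof -
      have "reg (group_space G) (\<lambda>g. b j (fst (y l), act (inv\<^bsub>G\<^esub> g) (snd (y l))))"
        using orbit_gregs[OF V_reg[OF bV[OF that(2)] y(1)[OF that(1)]] y(2)[OF that(1)]] .
      then show ?thesis using y[OF that(1)] by (simp add: reg_def \<rho>e[OF that] tr_def)
    qed
  qed
  then have cr: "completely_reducible G n \<rho>" using red by (simp add: reductive_group_def)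
  define \<Phi> where "\<Phi> c z = (\<Sum>j<n. c $ j * b j z)" for c :: "complex vec" and z
  have \<Phi>V: "\<Phi> c \<in> V" for c
    using fspan_sum[of "{..<n}" b V "\<lambda>j. c $ j"] bV unfolding \<Phi>_def[abs_def] fspan_V by simp
  have \<Phi>\<rho>: "\<Phi> (\<rho> g *\<^sub>v c) = tr g (\<Phi> c)" if g: "g \<in> carrier G" and c: "c \<in> carrier_vec n" for g c
  proof
    fix z
    have t: "tr g (\<Phi> c) z = (\<Sum>j<n. c $ j * tr g (b j) z)"
    proof (cases "fst z < k \<and> snd z \<in> pts X")
      case False
      then show ?thesis by (simp only: tr_def False if_False mult_zero_right sum.neutral_const)
    qed (simp add: tr_def \<Phi>_def)
    have "\<Phi> (\<rho> g *\<^sub>v c) z = (\<Sum>l<n. (\<Sum>j<n. tr g (b j) (y l) * c $ j) * b l z)"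
      unfolding \<Phi>_def using c by (intro sum.cong refl) (simp add: \<rho>_def scalar_prod_def atLeast0LessThan)
    also have "\<dots> = (\<Sum>j<n. c $ j * (\<Sum>l<n. tr g (b j) (y l) * b l z))"
      unfolding sum_distrib_left sum_distrib_right by (subst sum.swap) (simp add: mult_ac)
    also have "\<dots> = (\<Sum>j<n. c $ j * tr g (b j) z)"
    proof (rule sum.cong[OF refl])
      fix j assume "j \<in> {..<n}"
      then have "tr g (b j) z = (\<Sum>l<n. tr g (b j) (y l) * b l z)" by (intro rep tr_V bV g) simp
      then show "c $ j * (\<Sum>l<n. tr g (b j) (y l) * b l z) = c $ j * tr g (b j) z" by (simp only:)
    qed
    finally show "\<Phi> (\<rho> g *\<^sub>v c) z = tr g (\<Phi> c) z" using t by simp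
  qed
  define \<theta> where "\<theta> c = \<Theta> x0 (\<Phi> c)" for c
  have \<Phi>_add: "\<Phi> (c + c') z = \<Phi> c z + \<Phi> c' z" if "c \<in> carrier_vec n" "c' \<in> carrier_vec n" for c c' z
    using that by (simp add: \<Phi>_def sum.distrib algebra_simps)
  have \<Phi>_smult: "\<Phi> (r \<cdot>\<^sub>v c) z = r * \<Phi> c z" if "c \<in> carrier_vec n" for c r z
    using that by (simp add: \<Phi>_def sum_distrib_left mult_ac)
  have \<theta>_add: "\<theta> (c + c') = \<theta> c + \<theta> c'" if "c \<in> carrier_vec n" "c' \<in> carrier_vec n" for c c'
    by (simp add: \<theta>_def \<Theta>_def \<Phi>_add[OF that] sum.distrib algebra_simps)
  have \<theta>_smult: "\<theta> (r \<cdot>\<^sub>v c) = r * \<theta> c" if "c \<in> carrier_vec n" for c r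
    by (simp add: \<theta>_def \<Theta>_def \<Phi>_smult[OF that] sum_distrib_left mult_ac)
  have \<theta>_\<rho>: "\<theta> (\<rho> g *\<^sub>v c) = \<theta> c" if "g \<in> carrier G" "c \<in> carrier_vec n" for g c
    unfolding \<theta>_def \<Phi>\<rho>[OF that] using that(1) x0
    by (simp add: \<Theta>_tr \<Theta>_const[OF \<Phi>V, of "act (inv\<^bsub>G\<^esub> g) x0" x0] act_pts)
  have \<rho>c: "\<rho> g *\<^sub>v c \<in> carrier_vec n" for g c by (rule carrier_vecI) (simp add: \<rho>_def)
  \<comment> \<open>The kernel of the linear form \<theta>, a submodule because \<theta> is
    invariant.\<close>
  define S where "S = {c \<in> carrier_vec n. \<theta> c = 0}"
  have "\<theta> (0\<^sub>v n) = 0" by (simp add: \<theta>_def \<Theta>_def \<Phi>_def)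
  then have "submodule G n \<rho> S"
    unfolding submodule_def S_def by (auto simp: \<theta>_add \<theta>_smult \<theta>_\<rho> \<rho>c)
  from cr[unfolded completely_reducible_def, rule_format, OF this]
  obtain T where T: "submodule G n \<rho> T" "S \<inter> T = {0\<^sub>v n}"
    "{v + w | v w. v \<in> S \<and> w \<in> T} = carrier_vec n"
    by (elim exE conjE) (rule that)
  have Tc: "T \<subseteq> carrier_vec n" using T(1) by (simp add: submodule_def)
  define cv where "cv = vec n (\<lambda>l. v (y l))"
  have \<Phi>cv: "\<Phi> cv = v"
  proof
    fix z
    have "\<Phi> cv z = (\<Sum>l<n. v (y l) * b l z)" by (simp add: \<Phi>_def cv_def)
    also have "\<dots> = v z" by (rule rep[OF v_V, symmetric])
    finally show "\<Phi> cv z = v z" .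
  qed
  have "cv \<in> {v + w | v w. v \<in> S \<and> w \<in> T}" unfolding T(3) by (simp add: cv_def)
  \<comment> \<open>The component \<open>t\<close> in the complement keeps the value 1 of the form,
    since \<open>s\<close> lies in the kernel.\<close>
  then obtain s t where st: "s \<in> S" "t \<in> T" "cv = s + t" unfolding mem_Collect_eq by (elim exE conjE) (rule that)
  have tc: "t \<in> carrier_vec n" "s \<in> carrier_vec n" using st Tc by (auto simp: S_def)
  have "\<theta> cv = 1" using one[OF x0] x0 by (simp add: \<theta>_def \<Phi>cv \<Theta>_def v_def)
  then have \<theta>t: "\<theta> t = 1" using st \<theta>_add[OF tc(2,1)] by (simp add: S_def)
  \<comment> \<open>The difference \<open>g t - t\<close> lies in the complement and, by invariance
    of \<theta>, also in the kernel; so it is zero.\<close>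
  have fixed: "tr g (\<Phi> t) = \<Phi> t" if g: "g \<in> carrier G" for g
  proof -
    define r where "r = \<rho> g *\<^sub>v t + (- 1) \<cdot>\<^sub>v t"
    have "r \<in> T" using T(1) st(2) g unfolding submodule_def r_def by blast
    moreover have "r \<in> S"
      using tc(1) \<rho>c[of g t] by (simp add: S_def r_def \<theta>_add \<theta>_smult \<theta>_\<rho>[OF g tc(1)])
    ultimately have "r = 0\<^sub>v n" using T(2) by blast
    have "\<Phi> r z = tr g (\<Phi> t) z - \<Phi> t z" for z
      unfolding r_def using tc(1) \<rho>c[of g t] by (simp add: \<Phi>_add \<Phi>_smult \<Phi>\<rho>[OF g tc(1)])
    moreover have "\<Phi> r z = 0" for z unfolding \<open>r = 0\<^sub>v n\<close> by (simp add: \<Phi>_def)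
    ultimately show ?thesis by (metis eq_iff_diff_eq_0 ext)
  qed
  define c where "c i = restrict (\<lambda>x. \<Phi> t (i, x)) (pts X)" for i
  have "c i \<in> inv_functions G X act" if i: "i < k" for i
    unfolding inv_functions_iff
  proof (intro conjI ballI)
    show "c i \<in> regs X" using V_reg[OF \<Phi>V i] by (simp add: c_def reg_def)
    fix g x assume g: "g \<in> carrier G" "x \<in> pts X"
    have "tr (inv\<^bsub>G\<^esub> g) (\<Phi> t) (i, x) = \<Phi> t (i, x)" using fixed[of "inv\<^bsub>G\<^esub> g"] g by simp
    then show "c i (act g x) = c i x" using g i act_pts by (simp add: tr_def c_def)
  qed
  moreover have "c i x = 0" if "i < k" "x \<in> Z i" for i x
    using V_Z[OF \<Phi>V that] Z(1)[OF that(1)] that(2) by (auto simp: c_def)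
  moreover have "(\<Sum>i<k. c i x * h i x) = 1" if "x \<in> pts X" for x
    using \<Theta>_const[OF \<Phi>V that x0, of t] \<theta>t that by (simp add: \<theta>_def \<Theta>_def c_def)
  ultimately show ?thesis by blast
qed

end

section \<open>Saturated affine open subsets\<close>

lemma reductive_groupD:
  assumes "reductive_group G"
  shows "Group.group G" "affine_alg (group_space G)"
  using assms affine_variety_affine_alg by (auto simp: reductive_group_def algebraic_group_def)

lemma affine_G_variety_gspace:
  assumes G: "reductive_group G" and X: "affine_G_variety G X act"
  shows "gspace G X act" "affine_alg X"
proof -
  show aX: "affine_alg X"
    using X affine_variety_affine_alg by (auto simp: affine_G_variety_def)
  interpret group_action G "pts X" act using X by (simp add: affine_G_variety_def)
  have "(\<lambda>x\<in>pts X. x) = act \<one>\<^bsub>G\<^esub>" by (rule id_eq_one)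
  then have one: "act \<one>\<^bsub>G\<^esub> x = x" if "x \<in> pts X" for x using that by (metis restrict_apply')
  show "gspace G X act"
    unfolding gspace_def
  proof (intro conjI ballI)
    show "Group.group G" "fun_alg (group_space G)" "fun_alg X"
      using reductive_groupD[OF G] aX affine_alg_fun_alg by blast+
    show "act g x \<in> pts X" if "g \<in> carrier G" "x \<in> pts X" for g x
      using element_image[OF that refl] .
    show "act (g \<otimes>\<^bsub>G\<^esub> h) x = act g (act h x)" if "g \<in> carrier G" "h \<in> carrier G" "x \<in> pts X" for g h x
      using composition_rule that by blast
    show "act_pull G X act h \<in> regs (gprod G X)" if "h \<in> regs X" for h
      using X that by (simp add: affine_G_variety_def morphism_def act_pull_def gprod_def)
  qed (rule one)
qed

text \<open>The Nullstellensatz gives a partition of unity with regular coefficients, and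
  \<open>invariant_solution\<close>, with empty vanishing sets, makes the coefficients invariant as
  \<open>jet_property_cover\<close> requires.\<close>

theorem jet_property_invariant_cover:
  assumes G: "reductive_group G" and gs: "gspace G X act" and aX: "affine_alg X"
    and P: "jet_property P m"
    and F: "\<And>f. f \<in> F \<Longrightarrow> f \<in> inv_functions G X act"
    and nz: "\<And>x. x \<in> pts X \<Longrightarrow> \<exists>f\<in>F. f x \<noteq> 0"
    and PF: "\<And>f. f \<in> F \<Longrightarrow> P G (loc X f) (restrict_act act (pts (loc X f)))"
  shows "P G X act"
proof -
  note X = affine_alg_fun_alg[OF aX]
  have "reg X f" if "f \<in> F" for f using F[OF that] regs_reg[OF X] by (simp add: inv_functions_iff)
  then have "\<exists>(k::nat) c f. (\<forall>j<k. reg X (c j) \<and> f j \<in> F) \<and> (\<forall>x\<in>pts X. (\<Sum>j<k. c j x * f j x) = 1)"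
    using nz by (intro affine_alg_unit[OF aX])
  then obtain k :: nat and c f where cf: "\<forall>j<k. reg X (c j) \<and> f j \<in> F"
    and one: "\<forall>x\<in>pts X. (\<Sum>j<k. c j x * f j x) = 1" by (elim exE conjE) (rule that)
  interpret inv_equation G X act k "\<lambda>j. restrict (c j) (pts X)" f "\<lambda>_. {}"
    by unfold_locales (use gs G cf one F in \<open>auto simp: reg_def\<close>)
  obtain c' where c': "\<forall>i<k. c' i \<in> inv_functions G X act \<and> (\<forall>x\<in>{}. c' i x = 0)"
    and one': "\<forall>x\<in>pts X. (\<Sum>i<k. c' i x * f i x) = 1"
    using invariant_solution by (elim exE conjE)
  show ?thesis
    by (rule jet_property_cover[OF gs P, of k c' f]) (use c' one' cf F PF in \<open>auto simp del: pts_loc\<close>)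
qed

lemma quot_map_eq_iff:
  "quot_map G X act x = quot_map G X act y \<longleftrightarrow> (\<forall>h\<in>inv_functions G X act. h x = h y)"
  by (auto simp: quot_map_def restrict_def fun_eq_iff)

lemma saturated_act:
  assumes gs: "gspace G X act" and U: "saturated G X act U" and "g \<in> carrier G" "x \<in> U"
  shows "act g x \<in> U"
proof -
  interpret gsp G X act by unfold_locales (rule gs)
  have x: "x \<in> pts X" using U assms(4) unfolding saturated_def by blast
  have "quot_map G X act (act g x) = quot_map G X act x"
    using assms(3) x by (simp add: quot_map_eq_iff inv_functions_iff)
  then show ?thesis using act_pts[OF assms(3) x] assms(4) U unfolding saturated_def by blast
qed

text \<open>The functions cutting out the complement of \<open>U\<close> and the invariants
  \<open>h - h x\<close> have no common zero: it would lie outside \<open>U\<close> and have the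
  same image as \<open>x\<close>, contrary to saturation. In the resulting expression of 1, the
  summands coming from the complement are replaced by invariants that still vanish off
  \<open>U\<close>; their sum is the required function.\<close>

theorem saturated_principal_neighbourhood:
  assumes G: "reductive_group G" and gs: "gspace G X act" and aX: "affine_alg X"
    and U: "zariski_open X U" "saturated G X act U" and x: "x \<in> U"
  shows "\<exists>f\<in>inv_functions G X act. f x \<noteq> 0 \<and> (\<forall>y\<in>pts X. f y \<noteq> 0 \<longrightarrow> y \<in> U)"
proof -
  interpret gsp G X act by unfold_locales (rule gs)
  interpret Gr: Group.group G by (rule grp)
  define Zc where "Zc = pts X - U"
  obtain A0 where A0: "A0 \<subseteq> regs X" "Zc = {y \<in> pts X. \<forall>a\<in>A0. a y = 0}"
    using U(1) unfolding zariski_open_def zariski_closed_def Zc_def by blast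
  have xX: "x \<in> pts X" and UX: "U \<subseteq> pts X" using U(1) x by (auto simp: zariski_open_def)
  define sh where "sh h = restrict (\<lambda>y. h y - h x) (pts X)" for h :: "_ \<Rightarrow> complex"
  have sh: "sh h \<in> Inv" if "h \<in> Inv" for h
    using that reg_diff[OF X regs_reg[OF X] reg_const[OF X]] act_pts
    by (auto simp: inv_functions_iff sh_def reg_def)
  have Zact: "act g y \<in> Zc" if g: "g \<in> carrier G" and y: "y \<in> Zc" for g y
  proof -
    have yX: "y \<in> pts X" "y \<notin> U" using y by (auto simp: Zc_def)
    have "act (inv\<^bsub>G\<^esub> g) (act g y) = y"
      using act_mult[of "inv\<^bsub>G\<^esub> g" g y] g yX act_one by simp
    then have "act g y \<notin> U" using saturated_act[OF gs U(2), of "inv\<^bsub>G\<^esub> g" "act g y"] g yX(2) by auto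
    then show ?thesis using act_pts[OF g yX(1)] by (simp add: Zc_def)
  qed
  have "\<exists>f\<in>A0 \<union> sh ` Inv. f y \<noteq> 0" if y: "y \<in> pts X" for y
  proof (rule ccontr)
    assume neg: "\<not> ?thesis"
    then have "y \<in> Zc" using y unfolding A0(2) by blast
    then have "y \<notin> U" by (simp add: Zc_def)
    have "h y = h x" if "h \<in> Inv" for h
    proof -
      have "sh h y = 0" using neg that by blast
      then show ?thesis using y by (simp add: sh_def)
    qed
    then have "quot_map G X act y = quot_map G X act x" by (simp add: quot_map_eq_iff)
    then have "y \<in> U" using U(2) x y unfolding saturated_def by blast
    then show False using \<open>y \<notin> U\<close> by contradiction
  qed
  moreover have AI: "f \<in> regs X" if "f \<in> A0 \<union> sh ` Inv" for f
  proof -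
    have "Inv \<subseteq> regs X" by (auto simp: inv_functions_iff)
    then show ?thesis using that A0(1) sh by blast
  qed
  ultimately have "\<exists>(k::nat) c f. (\<forall>j<k. reg X (c j) \<and> f j \<in> A0 \<union> sh ` Inv) \<and>
      (\<forall>x\<in>pts X. (\<Sum>j<k. c j x * f j x) = 1)"
    using regs_reg[OF X] by (intro affine_alg_unit[OF aX]) simp_all
  then obtain k :: nat and c f where cf: "\<forall>j<k. reg X (c j) \<and> f j \<in> A0 \<union> sh ` Inv"
    and one: "\<forall>x\<in>pts X. (\<Sum>j<k. c j x * f j x) = 1" by (elim exE conjE) (rule that)
  \<comment> \<open>A product \<open>c j * f j\<close> with \<open>f j\<close> vanishing off
    \<open>U\<close> is taken as a whole, with the constant 1 as its invariant factor. Otherwise the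
    invariant factor is \<open>f j\<close>, which vanishes at \<open>x\<close>, and
    \<open>Z j\<close> is empty.\<close>
  define q where "q j = (if f j \<in> A0 then restrict (\<lambda>x. c j x * f j x) (pts X) else restrict (c j) (pts X))" for j
  define h where "h j = (if f j \<in> A0 then cfun (pts X) 1 else f j)" for j
  define Z where "Z j = (if f j \<in> A0 then Zc else {})" for j
  have AI0: "u \<in> Inv \<and> u x = 0" if uA: "u \<in> A0 \<union> sh ` Inv" "u \<notin> A0" for u
  proof -
    obtain v where v: "v \<in> Inv" "u = sh v" using uA by blast
    moreover have "sh v x = 0" using xX by (simp add: sh_def)
    ultimately show ?thesis by (simp add: sh)
  qed
  have fj: "f j \<in> regs X" "f j \<notin> A0 \<Longrightarrow> f j \<in> Inv \<and> f j x = 0" if "j < k" for j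
  proof -
    have *: "f j \<in> A0 \<union> sh ` Inv" using cf that by (elim allE[of _ j]) simp
    show "f j \<in> regs X" by (rule AI[OF *])
    show "f j \<notin> A0 \<Longrightarrow> f j \<in> Inv \<and> f j x = 0" by (rule AI0[OF *])
  qed
  interpret inv_equation G X act k q h Z
  proof
    show "reductive_group G" by (rule G)
    show "q i \<in> regs X" if "i < k" for i
      using cf that reg_mult[OF X _ regs_reg[OF X fj(1)[OF that]], of "c i"] by (auto simp: q_def reg_def)
    show "h i \<in> Inv" if "i < k" for i
      using fj(2)[OF that] Inv_closed(1) by (auto simp: h_def)
    show "(\<Sum>i<k. q i x * h i x) = 1" if "x \<in> pts X" for x
    proof -
      have "(\<Sum>i<k. q i x * h i x) = (\<Sum>i<k. c i x * f i x)"
        by (rule sum.cong) (use that in \<open>auto simp: q_def h_def cfun_def\<close>)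
      then show ?thesis using one that by simp
    qed
    show "Z i \<subseteq> pts X" for i by (auto simp: Z_def Zc_def)
    show "act g x \<in> Z i" if "g \<in> carrier G" "x \<in> Z i" for i g x
      using that Zact by (auto simp: Z_def split: if_splits)
    show "q i x = 0" if "x \<in> Z i" for i x
      using that A0(2) by (auto simp: q_def Z_def split: if_splits)
  qed
  obtain c' where c': "\<forall>i<k. c' i \<in> Inv \<and> (\<forall>x\<in>Z i. c' i x = 0)"
    and one': "\<forall>x\<in>pts X. (\<Sum>i<k. c' i x * h i x) = 1"
    using invariant_solution by (elim exE conjE)
  define J where "J = {j. j < k \<and> f j \<in> A0}"
  \<comment> \<open>At \<open>x\<close> the summands with index outside \<open>J\<close> are zero,
    so this sum is 1 there; off \<open>U\<close> each of its terms vanishes.\<close>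
  define u where "u = restrict (\<lambda>y. \<Sum>j\<in>J. c' j y) (pts X)"
  have "reg E (\<lambda>y. \<Sum>j\<in>J. c' j y)"
    by (rule reg_sum[OF EA]) (use c' regs_E' regs_reg[OF EA] in \<open>auto simp: J_def\<close>)
  then have "u \<in> regs E" by (simp only: u_def reg_def eq_space_simps(1))
  then have "u \<in> Inv" by (simp only: regs_E')
  moreover have "u x = 1"
  proof -
    have "(\<Sum>i<k. c' i x * h i x) = (\<Sum>i\<in>J. c' i x * h i x)"
      by (rule sum.mono_neutral_right) (use fj(2) in \<open>auto simp: J_def h_def\<close>)
    also have "\<dots> = (\<Sum>i\<in>J. c' i x)"
      by (rule sum.cong) (use xX in \<open>auto simp: J_def h_def cfun_def\<close>)
    finally show ?thesis using one' xX by (simp add: u_def)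
  qed
  moreover have "y \<in> U" if "y \<in> pts X" "u y \<noteq> 0" for y
  proof (rule ccontr)
    assume "y \<notin> U"
    then have "y \<in> Zc" using that by (simp add: Zc_def)
    then have "(\<Sum>j\<in>J. c' j y) = 0" using c' by (intro sum.neutral) (auto simp: J_def Z_def)
    then show False using that by (simp add: u_def)
  qed
  ultimately show ?thesis by (intro bexI[of _ u]) simp_all
qed

subsection \<open>Regular functions on open subsets\<close>

lemma pts_open_sub [simp]: "pts (open_sub X U) = U"
  by (simp add: open_sub_def)

lemma reg_open_sub:
  "reg (open_sub X U) h \<longleftrightarrow> (\<forall>x\<in>U. \<exists>a\<in>regs X. \<exists>b\<in>regs X.
     b x \<noteq> 0 \<and> (\<forall>y\<in>U. b y \<noteq> 0 \<longrightarrow> h y = a y / b y))"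
  by (simp add: reg_def open_sub_def)

lemma reg_open_subI:
  assumes X: "fun_alg X" and "U \<subseteq> pts X" "reg X h"
  shows "reg (open_sub X U) h"
  unfolding reg_open_sub
proof
  fix x assume "x \<in> U"
  then show "\<exists>a\<in>regs X. \<exists>b\<in>regs X. b x \<noteq> 0 \<and> (\<forall>y\<in>U. b y \<noteq> 0 \<longrightarrow> h y = a y / b y)"
    using assms fun_algD(2)[OF X, of 1]
    by (intro bexI[of _ "restrict h (pts X)"] bexI[of _ "cfun (pts X) 1"]) (auto simp: reg_def cfun_def)
qed

lemma open_sub_fraction:
  assumes X: "fun_alg X" and U: "U \<subseteq> pts X" and h: "reg (open_sub X U) h" and x: "x \<in> U"
  obtains a b where "reg X a" "reg X b" "b x \<noteq> 0" "\<And>y. y \<in> U \<Longrightarrow> b y \<noteq> 0 \<Longrightarrow> h y = a y / b y"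
proof -
  obtain a b where "a \<in> regs X" "b \<in> regs X" "b x \<noteq> 0" "\<forall>y\<in>U. b y \<noteq> 0 \<longrightarrow> h y = a y / b y"
    using h x unfolding reg_open_sub by blast
  then show ?thesis by (intro that[of a b]) (auto intro: regs_reg[OF X])
qed

text \<open>Local fractions are glued by \<open>locally_fraction_reg\<close> to a single one whose
  denominator is a power of \<open>f\<close>.\<close>

lemma open_sub_principal:
  assumes aX: "affine_alg X" and f: "reg X f"
  shows "open_sub X {x \<in> pts X. f x \<noteq> 0} = loc X f"
proof (rule fun_space_eqI)
  note X = affine_alg_fun_alg[OF aX]
  let ?U = "{x \<in> pts X. f x \<noteq> 0}"
  show "pts (open_sub X ?U) = pts (loc X f)" by simp
  show "regs (open_sub X ?U) \<subseteq> extensional (pts (open_sub X ?U))"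
    "regs (loc X f) \<subseteq> extensional (pts (loc X f))" by (auto simp: open_sub_def loc_def)
  fix h
  show "reg (open_sub X ?U) h \<longleftrightarrow> reg (loc X f) h"
  proof
    assume h: "reg (open_sub X ?U) h"
    show "reg (loc X f) h"
    proof (rule locally_fraction_reg[OF aX f])
      fix x assume "x \<in> pts X" "f x \<noteq> 0"
      then have x: "x \<in> ?U" by simp
      obtain a b where "reg X a" "reg X b" "b x \<noteq> 0" "\<And>y. y \<in> ?U \<Longrightarrow> b y \<noteq> 0 \<Longrightarrow> h y = a y / b y"
        by (rule open_sub_fraction[OF X _ h x]) auto
      then show "\<exists>a b. reg X a \<and> reg X b \<and> b x \<noteq> 0 \<and> (\<forall>y\<in>pts X. f y \<noteq> 0 \<longrightarrow> b y \<noteq> 0 \<longrightarrow> h y = a y / b y)"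
        by (intro exI[of _ a] exI[of _ b]) simp
    qed
  next
    assume "reg (loc X f) h"
    then obtain a n where a: "reg X a" "\<And>x. x \<in> pts X \<Longrightarrow> f x \<noteq> 0 \<Longrightarrow> h x = a x / f x ^ n"
      unfolding reg_loc_iff by blast
    show "reg (open_sub X ?U) h"
      unfolding reg_open_sub
    proof
      fix x assume "x \<in> ?U"
      then show "\<exists>a\<in>regs X. \<exists>b\<in>regs X. b x \<noteq> 0 \<and> (\<forall>y\<in>?U. b y \<noteq> 0 \<longrightarrow> h y = a y / b y)"
        using a reg_power[OF X f, of n]
        by (intro bexI[of _ "restrict a (pts X)"] bexI[of _ "restrict (\<lambda>x. f x ^ n) (pts X)"])
           (auto simp: reg_def)
    qed
  qed
qed

text \<open>A regular function on \<open>U\<close> divided by \<open>f^n\<close> is locally a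
  quotient \<open>p / (b * f^n)\<close> of functions on \<open>X\<close>, so
  \<open>locally_fraction_reg\<close> applies. This lets principal open sets of \<open>X\<close>
  serve as localizations of the members of a cover.\<close>

lemma loc_open_sub:
  assumes aX: "affine_alg X" and UX: "U \<subseteq> pts X" and f: "reg X f"
    and sub: "\<And>x. x \<in> pts X \<Longrightarrow> f x \<noteq> 0 \<Longrightarrow> x \<in> U"
  shows "loc (open_sub X U) (restrict f U) = loc X f"
proof -
  note X = affine_alg_fun_alg[OF aX]
  have "loc (open_sub X U) (restrict f U) = loc (open_sub X U) f" by (rule loc_cong) simp
  also have "\<dots> = loc X f"
  proof (rule fun_space_eqI)
    show "pts (loc (open_sub X U) f) = pts (loc X f)" using UX sub by auto
    show "regs (loc (open_sub X U) f) \<subseteq> extensional (pts (loc (open_sub X U) f))"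
      "regs (loc X f) \<subseteq> extensional (pts (loc X f))" by (auto simp: loc_def)
    fix h
    show "reg (loc (open_sub X U) f) h \<longleftrightarrow> reg (loc X f) h"
    proof
      assume "reg (loc (open_sub X U) f) h"
      then obtain a n where a: "reg (open_sub X U) a"
        and h: "\<And>x. x \<in> U \<Longrightarrow> f x \<noteq> 0 \<Longrightarrow> h x = a x / f x ^ n"
        unfolding reg_loc_iff by auto
      show "reg (loc X f) h"
      proof (rule locally_fraction_reg[OF aX f])
        fix x assume x: "x \<in> pts X" "f x \<noteq> 0"
        obtain p b where pb: "reg X p" "reg X b" "b x \<noteq> 0" "\<And>y. y \<in> U \<Longrightarrow> b y \<noteq> 0 \<Longrightarrow> a y = p y / b y"
          by (rule open_sub_fraction[OF X UX a sub[OF x]]) auto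
        have "reg X (\<lambda>y. b y * f y ^ n)" by (intro reg_mult reg_power X pb f)
        then show "\<exists>a b. reg X a \<and> reg X b \<and> b x \<noteq> 0 \<and> (\<forall>y\<in>pts X. f y \<noteq> 0 \<longrightarrow> b y \<noteq> 0 \<longrightarrow> h y = a y / b y)"
          using pb x by (intro exI[of _ p] exI[of _ "\<lambda>y. b y * f y ^ n"]) (simp add: sub h)
      qed
    next
      assume "reg (loc X f) h"
      then obtain a n where a: "reg X a" "\<And>x. x \<in> pts X \<Longrightarrow> f x \<noteq> 0 \<Longrightarrow> h x = a x / f x ^ n"
        unfolding reg_loc_iff by blast
      show "reg (loc (open_sub X U) f) h"
        by (rule reg_loc_fracI[OF reg_open_subI[OF X UX a(1)], of _ _ n]) (use a(2) UX in auto)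
    qed
  qed
  finally show ?thesis .
qed

text \<open>The pullback of a regular function along the action is at first only locally a fraction
  on the product of the group with \<open>U\<close>. As this product is affine,
  \<open>locally_fraction_reg\<close> makes it regular.\<close>

lemma gspace_open_sub:
  assumes G: "reductive_group G" and gs: "gspace G X act" and U: "zariski_open X U" "saturated G X act U"
    and aU: "affine_alg (open_sub X U)"
  shows "gspace G (open_sub X U) (restrict_act act U)"
proof -
  interpret gsp G X act by unfold_locales (rule gs)
  let ?O = "open_sub X U" and ?a = "restrict_act act U"
  have UX: "U \<subseteq> pts X" using U(1) by (simp add: zariski_open_def)
  note O = affine_alg_fun_alg[OF aU]
  have aP: "affine_alg (gprod G ?O)"
    unfolding gprod_def by (rule affine_alg_prod[OF reductive_groupD(2)[OF G] aU])
  note PA = affine_alg_fun_alg[OF aP]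
  have Uact: "act g x \<in> U" if "g \<in> carrier G" "x \<in> U" for g x
    by (rule saturated_act[OF gs U(2) that])
  have down: "reg (gprod G ?O) (\<lambda>z. u (act (fst z) (snd z)))" if u: "reg X u" for u
  proof -
    have "\<alpha> (restrict u (pts X)) \<in> regs Y" using \<alpha> u by (simp add: fun_alg_hom_def reg_def)
    then have "reg (prod_space (group_space G) X) (\<alpha> (restrict u (pts X)))"
      using regs_reg[OF Y] by (simp add: gprod_def)
    then obtain n :: nat and a b where ab: "\<forall>j<n. reg (group_space G) (a j) \<and> reg X (b j)"
      and e: "\<forall>g\<in>pts (group_space G). \<forall>x\<in>pts X. \<alpha> (restrict u (pts X)) (g, x) = (\<Sum>j<n. a j g * b j x)"
      unfolding reg_prod_iff[OF GA X] by (elim exE conjE)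
    have "u (act g x) = (\<Sum>j<n. a j g * b j x)" if "g \<in> carrier G" "x \<in> U" for g x
      using e that UX act_pts by (auto simp: act_pull_def pullback_def)
    then show ?thesis
      unfolding gprod_def reg_prod_iff[OF GA O] using ab
      by (intro exI[of _ n] exI[of _ a] exI[of _ b]) (auto intro: reg_open_subI[OF X UX])
  qed
  have "act_pull G ?O ?a h \<in> regs (gprod G ?O)" if h: "h \<in> regs ?O" for h
  proof -
    \<comment> \<open>Localizing at the constant 1 changes nothing; it brings the statement into the
      form of \<open>locally_fraction_reg\<close>.\<close>
    have "reg (loc (gprod G ?O) (\<lambda>z. 1)) (\<lambda>z. h (act (fst z) (snd z)))"
    proof (rule locally_fraction_reg[OF aP reg_const[OF PA]])
      fix z assume z: "z \<in> pts (gprod G ?O)"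
      then have zU: "act (fst z) (snd z) \<in> U" using Uact by auto
      obtain a b where ab: "reg X a" "reg X b" "b (act (fst z) (snd z)) \<noteq> 0"
        "\<And>y. y \<in> U \<Longrightarrow> b y \<noteq> 0 \<Longrightarrow> h y = a y / b y"
        by (rule open_sub_fraction[OF X UX regs_reg[OF O h] zU]) auto
      show "\<exists>a b. reg (gprod G ?O) a \<and> reg (gprod G ?O) b \<and> b z \<noteq> 0 \<and>
          (\<forall>y\<in>pts (gprod G ?O). (1::complex) \<noteq> 0 \<longrightarrow> b y \<noteq> 0 \<longrightarrow> h (act (fst y) (snd y)) = a y / b y)"
        by (intro exI[of _ "\<lambda>z. a (act (fst z) (snd z))"] exI[of _ "\<lambda>z. b (act (fst z) (snd z))"] conjI down)
           (use ab Uact in auto)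
    qed
    then obtain c n where c: "reg (gprod G ?O) c"
      "\<forall>z\<in>pts (gprod G ?O). (1::complex) \<noteq> 0 \<longrightarrow> h (act (fst z) (snd z)) = c z / 1 ^ n"
      unfolding reg_loc_iff by (elim exE conjE) (rule that)
    from c(1) have "reg (gprod G ?O) (\<lambda>z. h (act (fst z) (snd z)))"
      by (rule iffD1[OF reg_cong, rotated]) (use c(2) in auto)
    then have "restrict (\<lambda>z. h (act (fst z) (snd z))) (pts (gprod G ?O)) \<in> regs (gprod G ?O)"
      by (simp add: reg_def)
    also have "restrict (\<lambda>z. h (act (fst z) (snd z))) (pts (gprod G ?O)) = act_pull G ?O ?a h"
      by (auto simp: act_pull_def pullback_def restrict_act_def restrict_def fun_eq_iff)
    finally show ?thesis .
  qed
  then show ?thesis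
    using grp GA O act_one act_mult Uact UX group.is_monoid[OF grp]
    by (auto simp: gspace_def restrict_act_def monoid.m_closed monoid.one_closed subset_iff)
qed

lemma restrict_act_restrict_act:
  "V \<subseteq> U \<Longrightarrow> restrict_act (restrict_act act U) V = restrict_act act V"
  by (auto simp: restrict_act_def restrict_def fun_eq_iff)

text \<open>\<open>X\<close> and the members of the cover are compared only through sets
  \<open>X_f\<close> that lie in a member. These are localizations of both; those inside one member
  cover it, and all together cover \<open>X\<close>.\<close>

theorem jet_property_saturated_cover:
  assumes G: "reductive_group G" and XG: "affine_G_variety G X act" and P: "jet_property P m"
    and U: "\<And>i. i \<in> I \<Longrightarrow> zariski_open X (U i) \<and> affine_variety (open_sub X (U i)) \<and> saturated G X act (U i)"
    and cover: "pts X = (\<Union>i\<in>I. U i)"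
  shows "P G X act \<longleftrightarrow> (\<forall>i\<in>I. P G (open_sub X (U i)) (restrict_act act (U i)))"
proof -
  note gs = affine_G_variety_gspace(1)[OF G XG] and aX = affine_G_variety_gspace(2)[OF G XG]
  interpret gsp G X act by unfold_locales (rule gs)
  have aU: "affine_alg (open_sub X (U i))" if "i \<in> I" for i
    using U[OF that] affine_variety_affine_alg by blast
  have gU: "gspace G (open_sub X (U i)) (restrict_act act (U i))" if "i \<in> I" for i
    using gspace_open_sub[OF G gs _ _ aU[OF that]] U[OF that] by blast
  have UX: "U i \<subseteq> pts X" if "i \<in> I" for i using cover that by blast
  have nb: "\<exists>f\<in>Inv. f x \<noteq> 0 \<and> (\<forall>y\<in>pts X. f y \<noteq> 0 \<longrightarrow> y \<in> U i)" if "i \<in> I" "x \<in> U i" for i x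
    using saturated_principal_neighbourhood[OF G gs aX _ _ that(2)] U[OF that(1)] by blast
  have res: "restrict f (U i) \<in> inv_functions G (open_sub X (U i)) (restrict_act act (U i))"
    if "i \<in> I" "f \<in> Inv" for i f
  proof -
    have "reg X f" using that(2) regs_reg[OF X] by (simp add: inv_functions_iff)
    then have "reg (open_sub X (U i)) f" by (rule reg_open_subI[OF X UX[OF that(1)]])
    moreover have "act g x \<in> U i" if "g \<in> carrier G" "x \<in> U i" for g x
      using saturated_act[OF gs _ that] U[OF \<open>i \<in> I\<close>] by blast
    ultimately show ?thesis
      using that UX[OF that(1)] by (auto simp: inv_functions_iff reg_def restrict_act_def subset_iff)
  qed
  have eq: "loc (open_sub X (U i)) (restrict f (U i)) = loc X f"
    "restrict_act (restrict_act act (U i)) (pts (loc (open_sub X (U i)) (restrict f (U i)))) =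
      restrict_act act (pts (loc X f))"
    if "i \<in> I" "f \<in> Inv" "\<forall>y\<in>pts X. f y \<noteq> 0 \<longrightarrow> y \<in> U i" for i f
  proof -
    have "reg X f" using that(2) regs_reg[OF X] by (simp add: inv_functions_iff)
    then show *: "loc (open_sub X (U i)) (restrict f (U i)) = loc X f"
      by (rule loc_open_sub[OF aX UX[OF that(1)]]) (use that(3) in blast)
    have "pts (loc X f) \<subseteq> U i" using that(3) by auto
    then show "restrict_act (restrict_act act (U i)) (pts (loc (open_sub X (U i)) (restrict f (U i)))) =
      restrict_act act (pts (loc X f))" unfolding * by (rule restrict_act_restrict_act)
  qed
  show ?thesis
  proof
    assume PX: "P G X act"
    show "\<forall>i\<in>I. P G (open_sub X (U i)) (restrict_act act (U i))"
    proof
      fix i assume i: "i \<in> I"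
      define F where "F = {f \<in> Inv. \<forall>y\<in>pts X. f y \<noteq> 0 \<longrightarrow> y \<in> U i}"
      have F: "h \<in> inv_functions G (open_sub X (U i)) (restrict_act act (U i))"
        if "h \<in> (\<lambda>f. restrict f (U i)) ` F" for h
        using that res[OF i] unfolding F_def by blast
      have nz: "\<exists>h\<in>(\<lambda>f. restrict f (U i)) ` F. h x \<noteq> 0" if "x \<in> pts (open_sub X (U i))" for x
      proof -
        have x: "x \<in> U i" using that by simp
        obtain f where "f \<in> Inv" "f x \<noteq> 0" "\<forall>y\<in>pts X. f y \<noteq> 0 \<longrightarrow> y \<in> U i"
          using nb[OF i x] by blast
        then show ?thesis
          using x by (intro bexI[of _ "restrict f (U i)"] imageI) (simp_all add: F_def)
      qed
      have PF: "P G (loc (open_sub X (U i)) h) (restrict_act (restrict_act act (U i)) (pts (loc (open_sub X (U i)) h)))"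
        if hF: "h \<in> (\<lambda>f. restrict f (U i)) ` F" for h
      proof -
        obtain f where f: "f \<in> Inv" "\<forall>y\<in>pts X. f y \<noteq> 0 \<longrightarrow> y \<in> U i" and h: "h = restrict f (U i)"
          using hF unfolding F_def by blast
        show ?thesis
          unfolding h eq(2)[OF i f] unfolding eq(1)[OF i f]
          by (rule jet_property_loc[where P = P, OF gs f(1) P PX])
      qed
      show "P G (open_sub X (U i)) (restrict_act act (U i))"
        by (rule jet_property_invariant_cover[where P = P and F = "(\<lambda>f. restrict f (U i)) ` F",
              OF G gU[OF i] aU[OF i] P]) (fact F nz PF)+
    qed
  next
    assume PU: "\<forall>i\<in>I. P G (open_sub X (U i)) (restrict_act act (U i))"
    define F where "F = {f \<in> Inv. \<exists>i\<in>I. \<forall>y\<in>pts X. f y \<noteq> 0 \<longrightarrow> y \<in> U i}"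
    have F: "f \<in> Inv" if "f \<in> F" for f using that by (simp add: F_def)
    have PF: "P G (loc X f) (restrict_act act (pts (loc X f)))" if fF: "f \<in> F" for f
    proof -
      obtain i where i: "i \<in> I" and f: "f \<in> Inv" "\<forall>y\<in>pts X. f y \<noteq> 0 \<longrightarrow> y \<in> U i"
        using fF unfolding F_def by blast
      have "P G (loc (open_sub X (U i)) (restrict f (U i)))
          (restrict_act (restrict_act act (U i)) (pts (loc (open_sub X (U i)) (restrict f (U i)))))"
        by (rule jet_property_loc[where P = P, OF gU[OF i] res[OF i f(1)] P bspec[OF PU i]])
      then show ?thesis unfolding eq(2)[OF i f] unfolding eq(1)[OF i f] .
    qed
    have nz: "\<exists>f\<in>F. f x \<noteq> 0" if xX: "x \<in> pts X" for x
    proof -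
      obtain i where i: "i \<in> I" "x \<in> U i" using cover xX by blast
      then show ?thesis using nb[OF i] unfolding F_def by blast
    qed
    show "P G X act"
      by (rule jet_property_invariant_cover[where P = P and F = F, OF G gs aX P]) (fact F nz PF)+
  qed
qed

section \<open>Modules\<close>

lemma pts_affine_space [simp]: "pts (affine_space n) = carrier_vec n"
  by (simp add: affine_space_def)

lemma reg_affine_space:
  "reg (affine_space n) h \<longleftrightarrow>
     (\<exists>p. pvars p \<subseteq> {..<n} \<and> (\<forall>w\<in>carrier_vec n. h w = peval p (\<lambda>i. w $ i)))"
  by (auto simp: reg_def affine_space_def restrict_def fun_eq_iff)

lemma affine_alg_affine_space: "affine_alg (affine_space n)"
proof (rule affine_variety_affine_alg)
  have "zariski_closed (affine_space n) (carrier_vec n)"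
    unfolding zariski_closed_def by (rule exI[of _ "{}"]) simp
  moreover have "regs (affine_space n) = {(\<lambda>x\<in>carrier_vec n. h x) | h. h \<in> regs (affine_space n)}"
  proof -
    have e: "(\<lambda>x\<in>carrier_vec n. h x) = h" if "h \<in> regs (affine_space n)" for h
      using that by (auto simp: affine_space_def)
    then show ?thesis by (auto intro!: exI)
  qed
  ultimately show "affine_variety (affine_space n)"
    unfolding affine_variety_def
    by (intro exI[of _ n] exI[of _ "carrier_vec n"] exI[of _ "\<lambda>x. x"]) (simp add: bij_betw_def)
qed

lemma reg_coordinate: "i < n \<Longrightarrow> reg (affine_space n) (\<lambda>w. w $ i)"
  using pring_pvar[of i "{..<n}"] unfolding reg_affine_space
  by (intro exI[of _ "pvar i"]) (simp add: peval_simps pring_def)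

lemma gspace_module:
  assumes G: "reductive_group G" and M: "G_module G n \<rho>"
  shows "gspace G (affine_space n) (linear_act n \<rho>)"
proof -
  let ?W = "affine_space n" and ?a = "linear_act n \<rho>"
  note W = affine_alg_fun_alg[OF affine_alg_affine_space[of n]]
  note GA = affine_alg_fun_alg[OF reductive_groupD(2)[OF G]]
  have PA: "fun_alg (gprod G ?W)" unfolding gprod_def by (rule fun_alg_prod[OF GA W])
  have \<rho>c: "\<rho> g \<in> carrier_mat n n" if "g \<in> carrier G" for g using M that by (simp add: G_module_def)
  \<comment> \<open>A coordinate of \<open>g w\<close> is a sum of matrix entries times coordinates
    of \<open>w\<close>, which has the shape of an element of the tensor product.\<close>
  have coord: "reg (gprod G ?W) (\<lambda>z. (\<rho> (fst z) *\<^sub>v snd z) $ i)" if i: "i < n" for i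
    unfolding gprod_def reg_prod_iff[OF GA W]
  proof (intro exI[of _ n] exI[of _ "\<lambda>j g. \<rho> g $$ (i, j)"] exI[of _ "\<lambda>j w. w $ j"] conjI allI impI ballI)
    show "reg (group_space G) (\<lambda>g. \<rho> g $$ (i, j))" if "j < n" for j
      using M i that by (simp add: G_module_def reg_def)
    show "reg ?W (\<lambda>w. w $ j)" if "j < n" for j by (rule reg_coordinate[OF that])
    fix g w assume "g \<in> pts (group_space G)" "w \<in> pts ?W"
    then show "(\<rho> (fst (g, w)) *\<^sub>v snd (g, w)) $ i = (\<Sum>j<n. \<rho> g $$ (i, j) * w $ j)"
      using \<rho>c[of g] i by (simp add: scalar_prod_def atLeast0LessThan)
  qed
  have pol: "reg (gprod G ?W) (\<lambda>z. peval p (\<lambda>i. (\<rho> (fst z) *\<^sub>v snd z) $ i))" if "p \<in> pring {..<n}" for p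
    using that
    by (induction p rule: pring_induct)
       (simp_all add: peval_simps reg_const[OF PA] reg_add[OF PA] reg_mult[OF PA] coord)
  have "act_pull G ?W ?a h \<in> regs (gprod G ?W)" if h: "h \<in> regs ?W" for h
  proof -
    obtain p where p: "pvars p \<subseteq> {..<n}" "\<And>w. w \<in> carrier_vec n \<Longrightarrow> h w = peval p (\<lambda>i. w $ i)"
      using regs_reg[OF W h] unfolding reg_affine_space by blast
    have "restrict (\<lambda>z. peval p (\<lambda>i. (\<rho> (fst z) *\<^sub>v snd z) $ i)) (pts (gprod G ?W)) \<in> regs (gprod G ?W)"
      using pol[of p] p(1) by (simp add: pring_def reg_def)
    also have "restrict (\<lambda>z. peval p (\<lambda>i. (\<rho> (fst z) *\<^sub>v snd z) $ i)) (pts (gprod G ?W)) = act_pull G ?W ?a h"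
      using mult_mat_vec_carrier[OF \<rho>c]
      by (auto simp: act_pull_def pullback_def linear_act_def restrict_def fun_eq_iff p(2))
    finally show ?thesis .
  qed
  moreover have "?a (g \<otimes>\<^bsub>G\<^esub> h) w = ?a g (?a h w)"
    if "g \<in> carrier G" "h \<in> carrier G" "w \<in> carrier_vec n" for g h w
    using that M \<rho>c[of g] \<rho>c[of h] mult_mat_vec_carrier[OF \<rho>c[of h], of w]
    by (simp add: linear_act_def G_module_def assoc_mult_mat_vec[of _ n n _ n])
  moreover have "?a g w \<in> carrier_vec n" if "g \<in> carrier G" "w \<in> carrier_vec n" for g w
    using that mult_mat_vec_carrier[OF \<rho>c] by (simp add: linear_act_def)
  moreover have "?a \<one>\<^bsub>G\<^esub> w = w" if "w \<in> carrier_vec n" for w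
    using that M by (simp add: linear_act_def G_module_def)
  ultimately show ?thesis
    using W GA reductive_groupD(1)[OF G] by (simp add: gspace_def)
qed

lemma reg_scaled:
  assumes "reg (affine_space n) h" shows "reg (affine_space n) (\<lambda>w. h (c \<cdot>\<^sub>v w))"
proof -
  obtain p where p: "pvars p \<subseteq> {..<n}" "\<And>w. w \<in> carrier_vec n \<Longrightarrow> h w = peval p (\<lambda>i. w $ i)"
    using assms unfolding reg_affine_space by blast
  define q where "q = phom pconst (\<lambda>i. pconst c * pvar i) p"
  have "q \<in> pring {..<n}"
    unfolding q_def
  proof (rule phom_in_pring)
    show "p \<in> pring {..<n}" using p(1) by (simp add: pring_def)
    show "pconst c * pvar v \<in> pring {..<n}" if "v \<in> {..<n}" for v using that by (simp add: pring_mult)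
  qed
  moreover have "h (c \<cdot>\<^sub>v w) = peval q (\<lambda>i. w $ i)" if w: "w \<in> carrier_vec n" for w
  proof -
    have "peval q (\<lambda>i. w $ i) = phom (\<lambda>a. a) (\<lambda>i. c * w $ i) p"
      unfolding q_def peval_phom phom_phom[OF chom_id] by (simp add: phom_simps[OF chom_id])
    also have "\<dots> = phom (\<lambda>a. a) (\<lambda>i. (c \<cdot>\<^sub>v w) $ i) p"
      by (rule phom_cong[OF chom_id, of "{..<n}"]) (use w p(1) in \<open>auto simp: pring_def\<close>)
    finally show ?thesis using w p(2)[of "c \<cdot>\<^sub>v w"] by (simp add: peval_phom)
  qed
  ultimately show ?thesis unfolding reg_affine_space by (intro exI[of _ q]) (simp add: pring_def)
qed

text \<open>Along the line through \<open>w\<close>, \<open>f\<close> is a polynomial in the parameter that does not vanish at \<open>0\<close>.\<close>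

lemma ex_scaled_nonzero:
  assumes f: "reg (affine_space n) f" and f0: "f (0\<^sub>v n) \<noteq> 0" and w: "w \<in> carrier_vec n"
  shows "\<exists>c. c \<noteq> 0 \<and> f (c \<cdot>\<^sub>v w) \<noteq> 0"
proof -
  obtain p where p: "pvars p \<subseteq> {..<n}" "\<And>w. w \<in> carrier_vec n \<Longrightarrow> f w = peval p (\<lambda>i. w $ i)"
    using f unfolding reg_affine_space by blast
  define u where "u = phom (\<lambda>c. [:c:]) (\<lambda>i. [:0, w $ i:]) p"
  have ch: "chom (\<lambda>c::complex. [:c:])" by (simp add: chom_def one_pCons)
  have u: "poly u t = f (t \<cdot>\<^sub>v w)" for t
  proof -
    have "poly u t = phom (\<lambda>a. a) (\<lambda>i. t * w $ i) p"
      unfolding u_def by (rule pring_induct[of p UNIV, OF pring_UNIV])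
        (simp_all add: phom_simps[OF ch] phom_simps[OF chom_id])
    also have "\<dots> = phom (\<lambda>a. a) (\<lambda>i. (t \<cdot>\<^sub>v w) $ i) p"
      by (rule phom_cong[OF chom_id, of "{..<n}"]) (use w p(1) in \<open>auto simp: pring_def\<close>)
    finally show ?thesis using w p(2)[of "t \<cdot>\<^sub>v w"] by (simp add: peval_phom)
  qed
  have "0 \<cdot>\<^sub>v w = 0\<^sub>v n" using w by auto
  then have "poly u 0 \<noteq> 0" using u[of 0] f0 by simp
  then have "u \<noteq> 0" by auto
  then have "finite ({t. poly u t = 0} \<union> {0})" using poly_roots_finite by simp
  then obtain c where "c \<notin> {t. poly u t = 0} \<union> {0}"
    using ex_new_if_finite[OF infinite_UNIV_char_0] by blast
  then show ?thesis using u by auto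
qed

text \<open>Homotheties commute with the linear action, so multiplication by a nonzero
  \<open>c\<close> is an equivariant isomorphism from the set where \<open>f (c w)\<close> is
  nonzero onto the set where \<open>f\<close> is. The property thus holds on all these sets, and
  they cover the module by \<open>ex_scaled_nonzero\<close>.\<close>

theorem jet_property_module:
  assumes G: "reductive_group G" and M: "G_module G n \<rho>" and P: "jet_property P m"
    and f: "f \<in> inv_functions G (affine_space n) (linear_act n \<rho>)" and f0: "f (0\<^sub>v n) \<noteq> 0"
  shows "P G (affine_space n) (linear_act n \<rho>) \<longleftrightarrow>
    P G (loc (affine_space n) f) (restrict_act (linear_act n \<rho>) (pts (loc (affine_space n) f)))"
proof
  assume "P G (affine_space n) (linear_act n \<rho>)"
  then show "P G (loc (affine_space n) f) (restrict_act (linear_act n \<rho>) (pts (loc (affine_space n) f)))"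
    by (rule jet_property_loc[where P = P, OF gspace_module[OF G M] f P])
next
  let ?W = "affine_space n" and ?a = "linear_act n \<rho>"
  assume Pf: "P G (loc ?W f) (restrict_act ?a (pts (loc ?W f)))"
  note gs = gspace_module[OF G M]
  note aW = affine_alg_affine_space[of n]
  note W = affine_alg_fun_alg[OF aW]
  have rf: "reg ?W f" using f regs_reg[OF W] by (simp add: inv_functions_iff)
  have \<rho>c: "\<rho> g \<in> carrier_mat n n" if "g \<in> carrier G" for g using M that by (simp add: G_module_def)
  have ac: "?a g w \<in> carrier_vec n" if "g \<in> carrier G" "w \<in> carrier_vec n" for g w
    using that mult_mat_vec_carrier[OF \<rho>c] by (simp add: linear_act_def)
  have lin: "?a g (c \<cdot>\<^sub>v w) = c \<cdot>\<^sub>v ?a g w" if "g \<in> carrier G" "w \<in> carrier_vec n" for g c w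
    using that \<rho>c[of g] by (simp add: linear_act_def mult_mat_vec)
  have fi: "f (?a g w) = f w" if "g \<in> carrier G" "w \<in> carrier_vec n" for g w
    using f that by (simp add: inv_functions_iff)
  define fs where "fs c = restrict (\<lambda>w. f (c \<cdot>\<^sub>v w)) (carrier_vec n)" for c
  have fs: "fs c \<in> inv_functions G ?W ?a" for c
  proof -
    have "fs c \<in> regs ?W" using reg_scaled[OF rf, of c] by (simp add: fs_def reg_def)
    moreover have "fs c (?a g w) = fs c w" if "g \<in> carrier G" "w \<in> carrier_vec n" for g w
      using that ac[OF that] fi[of g "c \<cdot>\<^sub>v w"] lin[OF that, of c] by (simp add: fs_def)
    ultimately show ?thesis by (simp add: inv_functions_iff)
  qed
  have inv: "inverse c \<cdot>\<^sub>v (c \<cdot>\<^sub>v w) = w" "c \<cdot>\<^sub>v (inverse c \<cdot>\<^sub>v w) = w"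
    if "c \<noteq> 0" "w \<in> carrier_vec n" for c :: complex and w
    using that by (simp_all add: smult_smult_assoc)
  have P_scaled: "P G (loc ?W (fs c)) (restrict_act ?a (pts (loc ?W (fs c))))" if c: "c \<noteq> 0" for c
  proof -
    have to: "c \<cdot>\<^sub>v w \<in> pts (loc ?W f)" if "w \<in> pts (loc ?W (fs c))" for w
      using that by (auto simp: fs_def split: if_splits)
    have fro: "inverse c \<cdot>\<^sub>v w \<in> pts (loc ?W (fs c))" if "w \<in> pts (loc ?W f)" for w
      using that inv(2)[OF c] by (simp add: fs_def)
    have inv1: "c \<cdot>\<^sub>v (inverse c \<cdot>\<^sub>v w) = w" if "w \<in> pts (loc ?W f)" for w
      using that inv(2)[OF c] by simp
    have inv2: "inverse c \<cdot>\<^sub>v (c \<cdot>\<^sub>v w) = w" if "w \<in> pts (loc ?W (fs c))" for w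
      using that inv(1)[OF c] by simp
    have equiv: "c \<cdot>\<^sub>v restrict_act ?a (pts (loc ?W (fs c))) g w = restrict_act ?a (pts (loc ?W f)) g (c \<cdot>\<^sub>v w)"
      if "g \<in> carrier G" "w \<in> pts (loc ?W (fs c))" for g w
    proof -
      have w: "w \<in> carrier_vec n" using that(2) by simp
      show ?thesis
        using that(2) to[OF that(2)] lin[OF that(1) w, of c] by (simp add: restrict_act_def del: pts_loc)
    qed
    have reg_to: "pullback (loc ?W (fs c)) (\<lambda>w. c \<cdot>\<^sub>v w) u \<in> regs (loc ?W (fs c))"
      if u: "u \<in> regs (loc ?W f)" for u
    proof -
      obtain a k where a: "a \<in> regs ?W" "\<forall>x\<in>pts ?W. f x \<noteq> 0 \<longrightarrow> u x = a x / f x ^ k"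
        using loc_numerator[OF W u] by (elim exE conjE)
      have "reg (loc ?W (fs c)) (\<lambda>w. u (c \<cdot>\<^sub>v w))"
        by (rule reg_loc_fracI[OF reg_scaled[OF regs_reg[OF W a(1)], of c], of _ _ k])
           (use a(2) in \<open>simp add: fs_def\<close>)
      then show ?thesis by (simp add: reg_def pullback_def del: pts_loc)
    qed
    have reg_from: "pullback (loc ?W f) (\<lambda>w. inverse c \<cdot>\<^sub>v w) u \<in> regs (loc ?W f)"
      if u: "u \<in> regs (loc ?W (fs c))" for u
    proof -
      obtain a k where a: "a \<in> regs ?W" "\<forall>x\<in>pts ?W. fs c x \<noteq> 0 \<longrightarrow> u x = a x / fs c x ^ k"
        using loc_numerator[OF W u] by (elim exE conjE)
      have "reg (loc ?W f) (\<lambda>w. u (inverse c \<cdot>\<^sub>v w))"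
      proof (rule reg_loc_fracI[OF reg_scaled[OF regs_reg[OF W a(1)], of "inverse c"], of _ _ k])
        fix x assume x: "x \<in> pts ?W" "f x \<noteq> 0"
        then have "fs c (inverse c \<cdot>\<^sub>v x) = f x" using inv(2)[OF c] by (simp add: fs_def)
        moreover have "inverse c \<cdot>\<^sub>v x \<in> pts ?W" using x(1) by simp
        ultimately show "u (inverse c \<cdot>\<^sub>v x) = a (inverse c \<cdot>\<^sub>v x) / f x ^ k" using a(2) x(2) by metis
      qed
      then show ?thesis by (simp add: reg_def pullback_def del: pts_loc)
    qed
    show ?thesis
      by (rule jet_property_iso[where P = P and \<phi> = "\<lambda>w. c \<cdot>\<^sub>v w" and \<psi> = "\<lambda>w. inverse c \<cdot>\<^sub>v w",
            OF gspace_loc[OF gs f] gspace_loc[OF gs fs] P])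
         (fact to fro inv1 inv2 reg_to reg_from equiv Pf)+
  qed
  have F: "h \<in> inv_functions G ?W ?a" if "h \<in> fs ` (- {0})" for h using that fs by blast
  have nz: "\<exists>h\<in>fs ` (- {0}). h w \<noteq> 0" if w: "w \<in> pts ?W" for w
  proof -
    obtain c where "c \<noteq> 0" "f (c \<cdot>\<^sub>v w) \<noteq> 0" using ex_scaled_nonzero[OF rf f0] w by auto
    then show ?thesis using w by (intro bexI[of _ "fs c"] imageI) (simp_all add: fs_def)
  qed
  have PF: "P G (loc ?W h) (restrict_act ?a (pts (loc ?W h)))" if h: "h \<in> fs ` (- {0})" for h
  proof -
    obtain c where c: "c \<noteq> 0" "h = fs c" using h by blast
    show ?thesis unfolding c(2) by (rule P_scaled[OF c(1)])
  qed
  show "P G ?W ?a"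
    by (rule jet_property_invariant_cover[where P = P and F = "fs ` (- {0})", OF G gs aW P])
       (fact F nz PF)+
qed

theorem corollary3p3:
  fixes G :: "'g alg_group" and m :: enat
    and X :: "'a fun_space" and act :: "'g \<Rightarrow> 'a \<Rightarrow> 'a"
    and I :: "'i set" and U :: "'i \<Rightarrow> 'a set"
    and n :: nat and \<rho> :: "'g \<Rightarrow> complex mat" and f :: "complex vec \<Rightarrow> complex"
  assumes "reductive_group G"
  shows
    "(affine_G_variety G X act \<and>
      (\<forall>i\<in>I. zariski_open X (U i) \<and> affine_variety (open_sub X (U i)) \<and> saturated G X act (U i)) \<and>
      pts X = (\<Union>i\<in>I. U i) \<longrightarrow>
        (very_good m G X act \<longleftrightarrow>
           (\<forall>i\<in>I. very_good m G (open_sub X (U i)) (restrict_act act (U i)))) \<and>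
        (good m G X act \<longleftrightarrow>
           (\<forall>i\<in>I. good m G (open_sub X (U i)) (restrict_act act (U i)))) \<and>
        (D_finite G X act \<longleftrightarrow>
           (\<forall>i\<in>I. D_finite G (open_sub X (U i)) (restrict_act act (U i)))))
     \<and>
     (G_module G n \<rho> \<and>
      f \<in> inv_functions G (affine_space n) (linear_act n \<rho>) \<and> f (0\<^sub>v n) \<noteq> 0 \<longrightarrow>
        (let W = affine_space n; actW = linear_act n \<rho>;
             Wf = {w \<in> pts W. f w \<noteq> 0};
             U = open_sub W Wf; actU = restrict_act actW Wf
         in (very_good m G W actW \<longleftrightarrow> very_good m G U actU) \<and>
            (good m G W actW \<longleftrightarrow> good m G U actU) \<and>
            (D_finite G W actW \<longleftrightarrow> D_finite G U actU)))"
proof (intro conjI impI)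
  have P: "jet_property (very_good m) m" "jet_property (good m) m" "jet_property D_finite m"
    for m :: enat by (simp_all add: jet_property_def)
  {
    assume *: "affine_G_variety G X act \<and>
      (\<forall>i\<in>I. zariski_open X (U i) \<and> affine_variety (open_sub X (U i)) \<and> saturated G X act (U i)) \<and>
      pts X = (\<Union>i\<in>I. U i)"
    have XG: "affine_G_variety G X act"
      and U: "\<And>i. i \<in> I \<Longrightarrow> zariski_open X (U i) \<and> affine_variety (open_sub X (U i)) \<and> saturated G X act (U i)"
      and cover: "pts X = (\<Union>i\<in>I. U i)" using * by blast+
    note main = jet_property_saturated_cover[OF assms XG _ U cover]
    show "very_good m G X act \<longleftrightarrow> (\<forall>i\<in>I. very_good m G (open_sub X (U i)) (restrict_act act (U i)))"
      by (rule main[OF P(1)[of m]])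
    show "good m G X act \<longleftrightarrow> (\<forall>i\<in>I. good m G (open_sub X (U i)) (restrict_act act (U i)))"
      by (rule main[OF P(2)[of m]])
    show "D_finite G X act \<longleftrightarrow> (\<forall>i\<in>I. D_finite G (open_sub X (U i)) (restrict_act act (U i)))"
      by (rule main[OF P(3)[of m]])
  }
  assume *: "G_module G n \<rho> \<and> f \<in> inv_functions G (affine_space n) (linear_act n \<rho>) \<and> f (0\<^sub>v n) \<noteq> 0"
  note aW = affine_alg_affine_space[of n]
  have "reg (affine_space n) f"
    using * regs_reg[OF affine_alg_fun_alg[OF aW]] by (simp add: inv_functions_iff)
  \<comment> \<open>The open subspace is rewritten as a localization, the form in which the result
    on modules is stated.\<close>
  then have loc: "open_sub (affine_space n) {w \<in> pts (affine_space n). f w \<noteq> 0} = loc (affine_space n) f"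
    by (rule open_sub_principal[OF aW])
  have pts: "{w \<in> pts (affine_space n). f w \<noteq> 0} = pts (loc (affine_space n) f)" by simp
  have main: "P G (affine_space n) (linear_act n \<rho>) \<longleftrightarrow>
      P G (open_sub (affine_space n) {w \<in> pts (affine_space n). f w \<noteq> 0})
        (restrict_act (linear_act n \<rho>) {w \<in> pts (affine_space n). f w \<noteq> 0})"
    if "jet_property P m" for P
    unfolding loc unfolding pts using jet_property_module[OF assms _ that] * by blast
  show "let W = affine_space n; actW = linear_act n \<rho>;
             Wf = {w \<in> pts W. f w \<noteq> 0};
             U = open_sub W Wf; actU = restrict_act actW Wf
         in (very_good m G W actW \<longleftrightarrow> very_good m G U actU) \<and>
            (good m G W actW \<longleftrightarrow> good m G U actU) \<and>
            (D_finite G W actW \<longleftrightarrow> D_finite G U actU)"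
    unfolding Let_def
    by (intro conjI main P)
qed

end
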